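(* For a sequence of graphs $(H_n)$, let $f_n$ be the indicator of the property that the random graph $\mathcal{G}(n,p)$ contains a copy of $H_n$ (as a not necessarily induced subgraph), where $p=p(n)$ is such that $(f_n)$ is nondegenerate. The following holds: (1) If $H_n$ is strictly balanced with $\ell_n$ edges, where $1\ll\ell_n\le\left(\frac{\log n}{\log\log n}\right)^{1/2}$, then $(f_n)$ is noise sensitive, and furthermore it is 1-strongly noise sensitive. (2) There exists a sequence of strictly balanced graphs $H_n$ with $\ell_n\asymp\log n$ edges (and $p=p(n)$ for which $(f_n)$ is nondegenerate) such that $(f_n)$ is not noise sensitive.
   Context: Setting: $f_n:\Omega_n=\{0,1\}^{\Lambda_n}\to\{0,1\}$ are Boolean functions, $\Lambda_n$ finite, and $\Omega_n$ carries the product measure $\mathbb{P}$ under which the coordinates are i.i.d. Bernoulli$(p_n)$. For the random graph $\mathcal{G}(n,p)$, $\Lambda_n$ is the set of $\binom n2$ potential edges of a graph on $n$ labeled vertices and $p_n=p$; a monotone increasing graph property is identified with its indicator. The sequence is nondegenerate if $\mathbb{P}(f_n=1)$ is bounded away from $0$ and $1$ as $n\to\infty$. For $\omega\in\Omega_n$ and $\varepsilon\in(0,1)$, $\omega^\varepsilon$ is obtained from $\omega$ by independently resampling each coordinate (from Bernoulli$(p_n)$) with probability $\varepsilon$. Noise sensitive: for every fixed $\varepsilon\in(0,1)$, $\lim_{n\to\infty}\mathbb{P}(f_n(\omega^\varepsilon)=1\mid f_n(\omega)=1)-\mathbb{P}(f_n=1)=0$. A 1-witness for a monotone increasing $f$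 is a minimal subset $W\subset\Lambda$ such that $\omega_W\equiv1$ implies $f(\omega)=1$; $\mathcal{W}_1(f)$ is the set of 1-witnesses. 1-strongly noise sensitive: for every fixed $\varepsilon\in(0,1)$, $\lim_{n\to\infty}\max_{W\in\mathcal{W}_1(f_n)}\mathbb{P}(f_n(\omega^\varepsilon)=1\mid\omega_W\equiv1)-\mathbb{P}(f_n=1)=0$. A graph is strictly balanced if its average degree is strictly larger than that of each of its proper subgraphs. $g\ll h$ means $g/h\to0$; $g\asymp h$ means $g/h$ is bounded away from $0$ and $\infty$. *)

theory Defs
  imports "HOL-Probability.Probability" "HOL-Library.Ramsey" "HOL-Library.Landau_Symbols"
begin

section \<open>Boolean functions on product spaces\<close>

(* A configuration in {0,1}^\<Lambda> is a predicate on the index type that is False outside \<Lambda>;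
   this matches the default value used by Pi_pmf in the measures below. *)

definition configs :: "'a set \<Rightarrow> ('a \<Rightarrow> bool) set" where
  "configs \<Lambda> = PiE_dflt \<Lambda> False (\<lambda>_. UNIV)"

definition bernoulli_product :: "'a set \<Rightarrow> real \<Rightarrow> ('a \<Rightarrow> bool) pmf" where
  "bernoulli_product \<Lambda> p = Pi_pmf \<Lambda> False (\<lambda>_. bernoulli_pmf p)"

(* Joint law of the pair (\<omega>, \<omega>^\<epsilon>): r marks the resampled coordinates, \<eta> holds their new values. *)

definition noise_pair :: "'a set \<Rightarrow> real \<Rightarrow> real \<Rightarrow> (('a \<Rightarrow> bool) \<times> ('a \<Rightarrow> bool)) pmf" where
  "noise_pair \<Lambda> p \<epsilon> =
     do {
       \<omega> \<leftarrow> bernoulli_product \<Lambda> p;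
       \<eta> \<leftarrow> bernoulli_product \<Lambda> p;
       r \<leftarrow> bernoulli_product \<Lambda> \<epsilon>;
       return_pmf (\<omega>, \<lambda>e. if r e then \<eta> e else \<omega> e)
     }"

definition nondegenerate ::
    "(nat \<Rightarrow> 'a set) \<Rightarrow> (nat \<Rightarrow> real) \<Rightarrow> (nat \<Rightarrow> ('a \<Rightarrow> bool) \<Rightarrow> bool) \<Rightarrow> bool" where
  "nondegenerate \<Lambda> p f \<longleftrightarrow>
     (\<exists>c>0. \<forall>\<^sub>F n in sequentially.
        c \<le> \<P>(\<omega> in measure_pmf (bernoulli_product (\<Lambda> n) (p n)). f n \<omega>) \<and>
        \<P>(\<omega> in measure_pmf (bernoulli_product (\<Lambda> n) (p n)). f n \<omega>) \<le> 1 - c)"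

definition noise_sensitive ::
    "(nat \<Rightarrow> 'a set) \<Rightarrow> (nat \<Rightarrow> real) \<Rightarrow> (nat \<Rightarrow> ('a \<Rightarrow> bool) \<Rightarrow> bool) \<Rightarrow> bool" where
  "noise_sensitive \<Lambda> p f \<longleftrightarrow>
     (\<forall>\<epsilon>\<in>{0<..<1}.
        (\<lambda>n. \<P>(x in measure_pmf (noise_pair (\<Lambda> n) (p n) \<epsilon>). f n (snd x) \<bar> f n (fst x))
             - \<P>(\<omega> in measure_pmf (bernoulli_product (\<Lambda> n) (p n)). f n \<omega>))
        \<longlonglongrightarrow> 0)"

definition forces_one :: "'a set \<Rightarrow> (('a \<Rightarrow> bool) \<Rightarrow> bool) \<Rightarrow> 'a set \<Rightarrow> bool" where
  "forces_one \<Lambda> f W \<longleftrightarrow> (\<forall>\<omega>\<in>configs \<Lambda>. (\<forall>e\<in>W. \<omega> e) \<longrightarrow> f \<omega>)"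

definition one_witnesses :: "'a set \<Rightarrow> (('a \<Rightarrow> bool) \<Rightarrow> bool) \<Rightarrow> 'a set set" where
  "one_witnesses \<Lambda> f =
     {W. W \<subseteq> \<Lambda> \<and> forces_one \<Lambda> f W \<and> (\<forall>W'. W' \<subset> W \<longrightarrow> \<not> forces_one \<Lambda> f W')}"

(* Max {} is unspecified, but one_witnesses (\<Lambda> n) (f n) is empty only if f n vanishes on
   configs (\<Lambda> n), which nondegeneracy excludes for all large n. *)

definition one_strongly_noise_sensitive ::
    "(nat \<Rightarrow> 'a set) \<Rightarrow> (nat \<Rightarrow> real) \<Rightarrow> (nat \<Rightarrow> ('a \<Rightarrow> bool) \<Rightarrow> bool) \<Rightarrow> bool" where
  "one_strongly_noise_sensitive \<Lambda> p f \<longleftrightarrow>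
     (\<forall>\<epsilon>\<in>{0<..<1}.
        (\<lambda>n. Max ((\<lambda>W. \<P>(x in measure_pmf (noise_pair (\<Lambda> n) (p n) \<epsilon>).
                            f n (snd x) \<bar> \<forall>e\<in>W. fst x e))
                    ` one_witnesses (\<Lambda> n) (f n))
             - \<P>(\<omega> in measure_pmf (bernoulli_product (\<Lambda> n) (p n)). f n \<omega>))
        \<longlonglongrightarrow> 0)"

section \<open>Finite simple graphs\<close>

type_synonym 'a ugraph = "'a set \<times> 'a set set"

abbreviation verts :: "'a ugraph \<Rightarrow> 'a set" where "verts \<equiv> fst"
abbreviation edges :: "'a ugraph \<Rightarrow> 'a set set" where "edges \<equiv> snd"

(* Graphs are nonempty, so that the average degree is always meaningful. *)

definition simple_graph :: "'a ugraph \<Rightarrow> bool" where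
  "simple_graph G \<longleftrightarrow> finite (verts G) \<and> verts G \<noteq> {} \<and> edges G \<subseteq> nsets (verts G) 2"

definition subgraph :: "'a ugraph \<Rightarrow> 'a ugraph \<Rightarrow> bool" where
  "subgraph K G \<longleftrightarrow> simple_graph K \<and> verts K \<subseteq> verts G \<and> edges K \<subseteq> edges G"

definition graph_iso :: "'a ugraph \<Rightarrow> 'b ugraph \<Rightarrow> bool" where
  "graph_iso G H \<longleftrightarrow>
     (\<exists>\<phi>. bij_betw \<phi> (verts G) (verts H) \<and> edges H = (\<lambda>e. \<phi> ` e) ` edges G)"

definition contains_copy :: "'b ugraph \<Rightarrow> 'a ugraph \<Rightarrow> bool" where
  "contains_copy G H \<longleftrightarrow> (\<exists>K. subgraph K G \<and> graph_iso H K)"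

definition degree :: "'a ugraph \<Rightarrow> 'a \<Rightarrow> nat" where
  "degree G v = card {e \<in> edges G. v \<in> e}"

definition average_degree :: "'a ugraph \<Rightarrow> real" where
  "average_degree G = (\<Sum>v\<in>verts G. real (degree G v)) / real (card (verts G))"

definition strictly_balanced :: "'a ugraph \<Rightarrow> bool" where
  "strictly_balanced H \<longleftrightarrow>
     (\<forall>K. subgraph K H \<and> K \<noteq> H \<longrightarrow> average_degree K < average_degree H)"

section \<open>Containment of a given graph in the random graph\<close>

definition potential_edges :: "nat \<Rightarrow> nat set set" where
  "potential_edges n = nsets {..<n} 2"

definition config_graph :: "nat \<Rightarrow> (nat set \<Rightarrow> bool) \<Rightarrow> nat ugraph" where
  "config_graph n \<omega> = ({..<n}, {e \<in> potential_edges n. \<omega> e})"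

definition copy_indicator :: "(nat \<Rightarrow> 'a ugraph) \<Rightarrow> nat \<Rightarrow> (nat set \<Rightarrow> bool) \<Rightarrow> bool" where
  "copy_indicator H n \<omega> \<longleftrightarrow> contains_copy (config_graph n \<omega>) (H n)"

end

theory Submission
  imports Defs "HOL-Real_Asymp.Real_Asymp"
begin

text \<open>Part (1). Condition on a copy \<open>W\<close> of \<open>H\<close> being open. After noise, a copy is present only if \<open>W\<close>
  survives intact (probability at most \<open>(1 - \<epsilon> / 2) ^ l\<close>, which tends to 0), or a copy disjoint
  from \<open>W\<close> is present, or a copy sharing some but not all edges with \<open>W\<close> is. The expected number of
  the latter is the correlation term \<open>\<Delta> W\<close> of the second moment method. If \<open>H\<close> has \<open>v\<close> vertices and
  the overlap has \<open>s\<close> vertices and \<open>f\<close> edges, strict balance gives \<open>f * v + 1 \<le> l * s\<close>, which gains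
  a factor \<open>n powr (- 1 / l)\<close>; for \<open>l \<le> sqrt (ln n / ln (ln n))\<close> this beats the at most
  \<open>(2 * v) ^ v\<close> ways to overlap, so \<open>\<Delta> W\<close> tends to 0. Noise sensitivity follows from the bound on
  witnesses by Harris' inequality.

  Part (2). Take \<open>p = 6 / n\<close> and let \<open>H\<close> be a cycle of length about \<open>2 * ln n\<close> with a chord that cuts
  off a triangle. The event \<open>f\<close> of containing \<open>H\<close> has probability bounded below by the second moment
  method, and it implies the event \<open>g\<close> of containing a triangle, whose probability is bounded away
  from 1. Hence \<open>f\<close> and \<open>g\<close> are positively correlated; since \<open>g\<close> is stable under small noise, \<open>f\<close>
  remains correlated with the noisy \<open>g\<close>, and as the noise operator is positive semidefinite, \<open>f\<close> is
  correlated with the noisy \<open>f\<close>.\<close>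

section \<open>Expectations under product measures and noise\<close>

text \<open>No Fourier analysis is used: expectation and noise obey a recursion on single
  coordinates, and one induction scheme gives both Harris' inequality with noise and the
  semidefiniteness of the noise operator. The obstacle in part (1) is a circle: the bound on the
  correlation term grows with the mean number m of copies, while m is controlled only through
  nondegeneracy and a second moment bound containing that same term. The circle closes because the
  term is a small multiple of \<open>max m 1\<close> and can be absorbed; p itself is never
  computed, only shown to be at most 1/2. In part (2) the correlation term cannot be small, as this
  would imply noise sensitivity; but there a probability bounded below is enough, so the second
  moment of the count need only be of the order of the squared mean. The constant 6 is tuned to the
  maximal degree 3 of H: per step a free walk gains a factor 6 and a walk inside a fixed copy at
  most 3, and after 2 ln n steps the ratio of the two exceeds n, which pays for the closing vertex
  of the cycle. The chord makes only the whole graph denser than 1, and creates a triangle, an event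
  so small that a tiny constant noise rarely destroys it.\<close>

definition ev :: "'a set \<Rightarrow> real \<Rightarrow> (('a \<Rightarrow> bool) \<Rightarrow> real) \<Rightarrow> real" where
  "ev \<Lambda> p F = measure_pmf.expectation (bernoulli_product \<Lambda> p) F"

definition nev :: "'a set \<Rightarrow> real \<Rightarrow> real \<Rightarrow> (('a \<Rightarrow> bool) \<Rightarrow> ('a \<Rightarrow> bool) \<Rightarrow> real) \<Rightarrow> real" where
  "nev \<Lambda> p \<epsilon> F = measure_pmf.expectation (noise_pair \<Lambda> p \<epsilon>) (\<lambda>x. F (fst x) (snd x))"

lemma finite_configs: "finite \<Lambda> \<Longrightarrow> finite (configs \<Lambda>)"
  unfolding configs_def by (rule finite_PiE_dflt) auto

lemma set_bernoulli_product_subset: "finite \<Lambda> \<Longrightarrow> set_pmf (bernoulli_product \<Lambda> p) \<subseteq> configs \<Lambda>"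
  unfolding bernoulli_product_def configs_def
  by (rule order.trans[OF set_Pi_pmf_subset']) (auto simp: PiE_dflt_def)

lemma finite_set_bernoulli_product: "finite \<Lambda> \<Longrightarrow> finite (set_pmf (bernoulli_product \<Lambda> p))"
  using finite_subset[OF set_bernoulli_product_subset finite_configs] .

lemma finite_set_noise_pair: "finite \<Lambda> \<Longrightarrow> finite (set_pmf (noise_pair \<Lambda> p \<epsilon>))"
  unfolding noise_pair_def by (auto simp: finite_set_bernoulli_product)

lemma ev_add: "finite \<Lambda> \<Longrightarrow> ev \<Lambda> p (\<lambda>w. F w + G w) = ev \<Lambda> p F + ev \<Lambda> p G"
  unfolding ev_def
  by (intro Bochner_Integration.integral_add integrable_measure_pmf_finite finite_set_bernoulli_product)

lemma ev_diff: "finite \<Lambda> \<Longrightarrow> ev \<Lambda> p (\<lambda>w. F w - G w) = ev \<Lambda> p F - ev \<Lambda> p G"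
  unfolding ev_def
  by (intro Bochner_Integration.integral_diff integrable_measure_pmf_finite finite_set_bernoulli_product)

lemma ev_cmult: "ev \<Lambda> p (\<lambda>w. c * F w) = c * ev \<Lambda> p F"
  unfolding ev_def by simp

lemma ev_const [simp]: "ev \<Lambda> p (\<lambda>w. c) = c"
  unfolding ev_def by simp

lemma ev_sum: "finite \<Lambda> \<Longrightarrow> ev \<Lambda> p (\<lambda>w. \<Sum>i\<in>I. F i w) = (\<Sum>i\<in>I. ev \<Lambda> p (F i))"
  unfolding ev_def
  by (intro Bochner_Integration.integral_sum integrable_measure_pmf_finite finite_set_bernoulli_product)

lemma ev_mono: "finite \<Lambda> \<Longrightarrow> (\<And>w. F w \<le> G w) \<Longrightarrow> ev \<Lambda> p F \<le> ev \<Lambda> p G"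
  unfolding ev_def
  by (intro Bochner_Integration.integral_mono integrable_measure_pmf_finite finite_set_bernoulli_product) auto

lemma ev_nonneg: "(\<And>w. 0 \<le> F w) \<Longrightarrow> 0 \<le> ev \<Lambda> p F"
  unfolding ev_def by (intro Bochner_Integration.integral_nonneg) auto

lemma prob_eq_ev: "\<P>(w in measure_pmf (bernoulli_product \<Lambda> p). P w) = ev \<Lambda> p (\<lambda>w. of_bool (P w))"
proof -
  have "(\<lambda>w. of_bool (P w) :: real) = indicator {w. P w}" by (auto simp: indicator_def fun_eq_iff)
  then show ?thesis unfolding ev_def by simp
qed

lemma nev_add: "finite \<Lambda> \<Longrightarrow> nev \<Lambda> p \<epsilon> (\<lambda>a b. F a b + G a b) = nev \<Lambda> p \<epsilon> F + nev \<Lambda> p \<epsilon> G"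
  unfolding nev_def
  by (intro Bochner_Integration.integral_add integrable_measure_pmf_finite finite_set_noise_pair)

lemma nev_diff: "finite \<Lambda> \<Longrightarrow> nev \<Lambda> p \<epsilon> (\<lambda>a b. F a b - G a b) = nev \<Lambda> p \<epsilon> F - nev \<Lambda> p \<epsilon> G"
  unfolding nev_def
  by (intro Bochner_Integration.integral_diff integrable_measure_pmf_finite finite_set_noise_pair)

lemma nev_cmult: "nev \<Lambda> p \<epsilon> (\<lambda>a b. c * F a b) = c * nev \<Lambda> p \<epsilon> F"
  unfolding nev_def by simp

lemma nev_const [simp]: "nev \<Lambda> p \<epsilon> (\<lambda>a b. c) = c"
  unfolding nev_def by simp

lemma nev_sum: "finite \<Lambda> \<Longrightarrow> nev \<Lambda> p \<epsilon> (\<lambda>a b. \<Sum>i\<in>I. F i a b) = (\<Sum>i\<in>I. nev \<Lambda> p \<epsilon> (F i))"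
  unfolding nev_def
  by (intro Bochner_Integration.integral_sum integrable_measure_pmf_finite finite_set_noise_pair)

lemma nev_mono: "finite \<Lambda> \<Longrightarrow> (\<And>a b. F a b \<le> G a b) \<Longrightarrow> nev \<Lambda> p \<epsilon> F \<le> nev \<Lambda> p \<epsilon> G"
  unfolding nev_def
  by (intro Bochner_Integration.integral_mono integrable_measure_pmf_finite finite_set_noise_pair) auto

lemma prob_noise_pair_eq_nev:
  "\<P>(x in measure_pmf (noise_pair \<Lambda> p \<epsilon>). P (fst x) (snd x)) = nev \<Lambda> p \<epsilon> (\<lambda>a b. of_bool (P a b))"
proof -
  have "(\<lambda>x. of_bool (P (fst x) (snd x)) :: real) = indicator {x. P (fst x) (snd x)}"
    by (auto simp: indicator_def fun_eq_iff)
  then show ?thesis unfolding nev_def by simp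
qed

lemma expectation_bind_finite:
  fixes f :: "_ \<Rightarrow> real"
  assumes "finite (set_pmf M)" "\<And>x. x \<in> set_pmf M \<Longrightarrow> finite (set_pmf (N x))"
  shows "measure_pmf.expectation (bind_pmf M N) f =
    measure_pmf.expectation M (\<lambda>x. measure_pmf.expectation (N x) f)"
proof -
  have "measure_pmf.expectation (bind_pmf M N) f
      = (\<Sum>a\<in>set_pmf M. pmf M a *\<^sub>R measure_pmf.expectation (N a) f)"
    using assms by (intro pmf_expectation_bind) auto
  also have "\<dots> = measure_pmf.expectation M (\<lambda>x. measure_pmf.expectation (N x) f)"
    using assms by (intro integral_measure_pmf[symmetric]) auto
  finally show ?thesis .
qed

lemma ev_insert:
  assumes "finite \<Lambda>" "x \<notin> \<Lambda>" "0 \<le> p" "p \<le> 1"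
  shows "ev (insert x \<Lambda>) p F =
    p * ev \<Lambda> p (\<lambda>w. F (w(x := True))) + (1 - p) * ev \<Lambda> p (\<lambda>w. F (w(x := False)))"
proof -
  have fin: "finite (set_pmf (Pi_pmf \<Lambda> False (\<lambda>_. bernoulli_pmf p)))"
    using finite_set_bernoulli_product[OF assms(1)] unfolding bernoulli_product_def .
  show ?thesis
    unfolding ev_def bernoulli_product_def Pi_pmf_insert'[OF assms(1,2)]
    using assms(3,4) fin by (simp add: expectation_bind_finite)
qed

lemma nev_eq_ev:
  assumes "finite \<Lambda>"
  shows "nev \<Lambda> p \<epsilon> F = ev \<Lambda> p (\<lambda>w. ev \<Lambda> p (\<lambda>\<eta>. ev \<Lambda> \<epsilon> (\<lambda>r. F w (\<lambda>e. if r e then \<eta> e else w e))))"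
  unfolding nev_def ev_def noise_pair_def
  by (simp add: expectation_bind_finite finite_set_bernoulli_product[OF assms])

lemma mix_upd:
  "(\<lambda>e. if (r(x := True)) e then (\<eta>(x := u)) e else (w(x := v)) e) = (\<lambda>e. if r e then \<eta> e else w e)(x := u)"
  "(\<lambda>e. if (r(x := False)) e then (\<eta>(x := u)) e else (w(x := v)) e) = (\<lambda>e. if r e then \<eta> e else w e)(x := v)"
  by (auto simp: fun_eq_iff)

text \<open>With weight \<open>1 - \<epsilon>\<close> the new coordinate is kept, so both
  configurations share its value; with weight \<epsilon> the two values are independent. The
  inductions on \<open>\<Lambda>\<close> for the noise all rest on this recursion.\<close>

lemma nev_insert:
  fixes F :: "('a \<Rightarrow> bool) \<Rightarrow> ('a \<Rightarrow> bool) \<Rightarrow> real"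
  assumes "finite \<Lambda>" "x \<notin> \<Lambda>" "0 \<le> p" "p \<le> 1" "0 \<le> \<epsilon>" "\<epsilon> \<le> 1"
  defines "N u v \<equiv> nev \<Lambda> p \<epsilon> (\<lambda>a b. F (a(x := u)) (b(x := v)))"
  shows "nev (insert x \<Lambda>) p \<epsilon> F =
    (1 - \<epsilon>) * (p * N True True + (1 - p) * N False False) +
    \<epsilon> * (p * p * N True True + p * (1 - p) * N True False
       + (1 - p) * p * N False True + (1 - p) * (1 - p) * N False False)"
proof -
  have fin: "finite (insert x \<Lambda>)" using assms by simp
  show ?thesis
    unfolding N_def nev_eq_ev[OF fin] nev_eq_ev[OF assms(1)]
    by (simp only: ev_insert[OF assms(1,2,3,4)] ev_insert[OF assms(1,2,5,6)] mix_upd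
        ev_add[OF assms(1)] ev_cmult) (simp add: algebra_simps)
qed

lemma nev_fst:
  assumes "finite \<Lambda>" "0 \<le> p" "p \<le> 1" "0 \<le> \<epsilon>" "\<epsilon> \<le> 1"
  shows "nev \<Lambda> p \<epsilon> (\<lambda>a b. G a) = ev \<Lambda> p G"
  using assms(1)
proof (induction \<Lambda> arbitrary: G rule: finite_induct)
  case empty
  show ?case by (simp add: nev_eq_ev)
next
  case (insert x \<Lambda>)
  show ?case
    by (simp add: nev_insert ev_insert insert assms) (simp add: algebra_simps)
qed

text \<open>Reversibility of the noise: the weights of the recursion are symmetric in the two values
  of a coordinate.\<close>

lemma nev_commute:
  assumes "finite \<Lambda>" "0 \<le> p" "p \<le> 1" "0 \<le> \<epsilon>" "\<epsilon> \<le> 1"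
  shows "nev \<Lambda> p \<epsilon> (\<lambda>a b. F b a) = nev \<Lambda> p \<epsilon> F"
  using assms(1)
proof (induction \<Lambda> arbitrary: F rule: finite_induct)
  case empty
  show ?case by (simp add: nev_eq_ev ev_def bernoulli_product_def)
next
  case (insert x \<Lambda>)
  have IH: "nev \<Lambda> p \<epsilon> (\<lambda>a b. F (b(x := u)) (a(x := v))) = nev \<Lambda> p \<epsilon> (\<lambda>a b. F (a(x := u)) (b(x := v)))"
    for u v using insert.IH[of "\<lambda>a b. F (a(x := u)) (b(x := v))"] .
  show ?case
    by (simp add: nev_insert insert.hyps assms IH)
qed

text \<open>In the resampled part the averages of \<open>F\<close> and \<open>G\<close> over the new
  coordinate appear, again as a product, so an induction hypothesis about products applies to all
  three terms.\<close>

lemma nev_insert_prod: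
  fixes F G :: "('a \<Rightarrow> bool) \<Rightarrow> real"
  assumes "finite \<Lambda>" "x \<notin> \<Lambda>" "0 \<le> p" "p \<le> 1" "0 \<le> \<epsilon>" "\<epsilon> \<le> 1"
  shows "nev (insert x \<Lambda>) p \<epsilon> (\<lambda>a b. F a * G b) =
    (1 - \<epsilon>) * (p * nev \<Lambda> p \<epsilon> (\<lambda>a b. F (a(x := True)) * G (b(x := True)))
       + (1 - p) * nev \<Lambda> p \<epsilon> (\<lambda>a b. F (a(x := False)) * G (b(x := False)))) +
    \<epsilon> * nev \<Lambda> p \<epsilon> (\<lambda>a b. (p * F (a(x := True)) + (1 - p) * F (a(x := False)))
                      * (p * G (b(x := True)) + (1 - p) * G (b(x := False))))"
proof -
  have e: "(p * F (a(x := True)) + (1 - p) * F (a(x := False))) * (p * G (b(x := True)) + (1 - p) * G (b(x := False)))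
     = p * p * (F (a(x := True)) * G (b(x := True))) + p * (1 - p) * (F (a(x := True)) * G (b(x := False)))
       + (1 - p) * p * (F (a(x := False)) * G (b(x := True))) + (1 - p) * (1 - p) * (F (a(x := False)) * G (b(x := False)))"
    for a b by (simp only: distrib_left distrib_right mult.assoc mult.left_commute add.assoc)
  show ?thesis
    unfolding e nev_insert[OF assms] nev_add[OF assms(1)] nev_cmult ..
qed

section \<open>Correlation inequalities\<close>

text \<open>The arithmetic shared by the induction steps of \<open>nev_harris\<close> and
  \<open>nev_square_ge\<close>: \<open>A\<close> and \<open>B\<close> bound the two terms with the
  coordinate kept, and the target \<open>P\<close> itself bounds the resampled term.\<close>

lemma convex_comb_ge:
  fixes p \<epsilon> P :: real
  assumes "0 \<le> p" "p \<le> 1" "0 \<le> \<epsilon>" "\<epsilon> \<le> 1" "P \<le> p * A + (1 - p) * B" "A \<le> n1" "B \<le> n0" "P \<le> nb"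
  shows "P \<le> (1 - \<epsilon>) * (p * n1 + (1 - p) * n0) + \<epsilon> * nb"
proof -
  have "p * A + (1 - p) * B \<le> p * n1 + (1 - p) * n0"
    using assms by (intro add_mono mult_left_mono) auto
  then have "(1 - \<epsilon>) * P \<le> (1 - \<epsilon>) * (p * n1 + (1 - p) * n0)" "\<epsilon> * P \<le> \<epsilon> * nb"
    using assms by (auto intro!: mult_left_mono)
  then show ?thesis by (simp add: algebra_simps)
qed

text \<open>Where the coordinate is kept, the average of the two products dominates the product of
  the averages because \<open>F\<close> and \<open>G\<close> both increase in it (Chebyshev's
  inequality on two points). Where it is resampled, the product of the averages arises
  directly.\<close>

lemma nev_harris:
  fixes F G :: "('a \<Rightarrow> bool) \<Rightarrow> real"
  assumes "finite \<Lambda>" "0 \<le> p" "p \<le> 1" "0 \<le> \<epsilon>" "\<epsilon> \<le> 1" "mono F" "mono G"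
  shows "ev \<Lambda> p F * ev \<Lambda> p G \<le> nev \<Lambda> p \<epsilon> (\<lambda>a b. F a * G b)"
  using assms(1,6,7)
proof (induction \<Lambda> arbitrary: F G rule: finite_induct)
  case empty
  show ?case by (simp add: nev_eq_ev ev_def bernoulli_product_def)
next
  case (insert x \<Lambda>)
  let ?t = "\<lambda>F w. F (w(x := True)) :: real" and ?f = "\<lambda>F w. F (w(x := False)) :: real"
  let ?b = "\<lambda>F w. p * ?t F w + (1 - p) * ?f F w"
  have m: "mono (?t F)" "mono (?f F)" if "mono F" for F :: "('a \<Rightarrow> bool) \<Rightarrow> real"
    using that by (auto simp: mono_def le_fun_def)
  have mb: "mono (?b F)" if "mono F" for F :: "('a \<Rightarrow> bool) \<Rightarrow> real"
    unfolding mono_def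
  proof (intro allI impI)
    fix a b :: "'a \<Rightarrow> bool" assume "a \<le> b"
    then have "?t F a \<le> ?t F b" "?f F a \<le> ?f F b" using m[OF that] by (auto dest: monoD)
    then show "?b F a \<le> ?b F b" using assms by (intro add_mono mult_left_mono) auto
  qed
  have le: "ev \<Lambda> p (?f F) \<le> ev \<Lambda> p (?t F)" if "mono F" for F
    using that by (intro ev_mono insert.hyps monoD[OF that]) (auto simp: le_fun_def)
  define F1 F0 G1 G0 where "F1 = ev \<Lambda> p (?t F)" "F0 = ev \<Lambda> p (?f F)" "G1 = ev \<Lambda> p (?t G)" "G0 = ev \<Lambda> p (?f G)"
  note d = this
  have bar: "ev \<Lambda> p (?b F) = p * F1 + (1 - p) * F0" "ev \<Lambda> p (?b G) = p * G1 + (1 - p) * G0"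
    unfolding d by (simp_all add: ev_add ev_cmult insert.hyps)
  have "0 \<le> p * (1 - p) * ((F1 - F0) * (G1 - G0))"
    using le[OF insert.prems(1)] le[OF insert.prems(2)] assms unfolding d
    by (intro mult_nonneg_nonneg) (auto simp del: fun_upd_apply)
  then have ch: "(p * F1 + (1 - p) * F0) * (p * G1 + (1 - p) * G0) \<le> p * (F1 * G1) + (1 - p) * (F0 * G0)"
    by (simp add: algebra_simps)
  let ?P = "(p * F1 + (1 - p) * F0) * (p * G1 + (1 - p) * G0)"
  have "?P \<le> nev (insert x \<Lambda>) p \<epsilon> (\<lambda>a b. F a * G b)"
    unfolding nev_insert_prod[OF insert.hyps assms(2-5)]
    using insert.IH[OF m(1)[OF insert.prems(1)] m(1)[OF insert.prems(2)]]
      insert.IH[OF m(2)[OF insert.prems(1)] m(2)[OF insert.prems(2)]]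
      insert.IH[OF mb[OF insert.prems(1)] mb[OF insert.prems(2)]]
    unfolding bar d[symmetric]
    by (rule convex_comb_ge[OF assms(2-5) ch])
  then show ?case by (simp add: ev_insert insert.hyps assms d)
qed

text \<open>The noise operator is positive semidefinite even after the constants are split off. The
  induction is that of Harris' inequality with convexity of the square in place of monotonicity, so
  \<open>F\<close> may be arbitrary; it is applied to a difference of two indicators.\<close>

lemma nev_square_ge:
  fixes F :: "('a \<Rightarrow> bool) \<Rightarrow> real"
  assumes "finite \<Lambda>" "0 \<le> p" "p \<le> 1" "0 \<le> \<epsilon>" "\<epsilon> \<le> 1"
  shows "(ev \<Lambda> p F)\<^sup>2 \<le> nev \<Lambda> p \<epsilon> (\<lambda>a b. F a * F b)"
  using assms(1)
proof (induction \<Lambda> arbitrary: F rule: finite_induct)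
  case empty
  show ?case by (simp add: nev_eq_ev ev_def bernoulli_product_def power2_eq_square)
next
  case (insert x \<Lambda>)
  let ?t = "\<lambda>w. F (w(x := True)) :: real" and ?f = "\<lambda>w. F (w(x := False)) :: real"
  let ?b = "\<lambda>w. p * ?t w + (1 - p) * ?f w"
  define F1 F0 where "F1 = ev \<Lambda> p ?t" "F0 = ev \<Lambda> p ?f"
  note d = this
  have bar: "ev \<Lambda> p ?b = p * F1 + (1 - p) * F0"
    unfolding d by (simp_all add: ev_add ev_cmult insert.hyps)
  let ?P = "(p * F1 + (1 - p) * F0)\<^sup>2"
  have "0 \<le> p * (1 - p) * (F1 - F0)\<^sup>2" using assms by simp
  then have ch: "?P \<le> p * F1\<^sup>2 + (1 - p) * F0\<^sup>2"
    by (simp add: algebra_simps power2_eq_square)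
  have "?P \<le> nev (insert x \<Lambda>) p \<epsilon> (\<lambda>a b. F a * F b)"
    unfolding nev_insert_prod[OF insert.hyps assms(2-5)]
    using insert.IH[of ?t] insert.IH[of ?f] insert.IH[of ?b]
    unfolding bar d[symmetric]
    by (rule convex_comb_ge[OF assms(2-5) ch])
  then show ?case by (simp add: ev_insert insert.hyps assms d)
qed

section \<open>Independence of disjoint coordinates\<close>

lemma nev_indep_coord:
  assumes "finite \<Lambda>" "x \<in> \<Lambda>" "0 \<le> p" "p \<le> 1" "0 \<le> \<epsilon>" "\<epsilon> \<le> 1"
    and F: "\<And>a b u v. F (a(x := u)) (b(x := v)) = F a b"
  shows "nev \<Lambda> p \<epsilon> (\<lambda>a b. of_bool (a x) * F a b) = p * nev \<Lambda> p \<epsilon> F"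
    and "nev \<Lambda> p \<epsilon> (\<lambda>a b. of_bool (a x \<and> b x) * F a b) = p * (1 - \<epsilon> + \<epsilon> * p) * nev \<Lambda> p \<epsilon> F"
proof -
  obtain L where L: "\<Lambda> = insert x L" "x \<notin> L" "finite L"
    using assms by (metis finite_insert mk_disjoint_insert)
  show "nev \<Lambda> p \<epsilon> (\<lambda>a b. of_bool (a x) * F a b) = p * nev \<Lambda> p \<epsilon> F"
    "nev \<Lambda> p \<epsilon> (\<lambda>a b. of_bool (a x \<and> b x) * F a b) = p * (1 - \<epsilon> + \<epsilon> * p) * nev \<Lambda> p \<epsilon> F"
    unfolding L(1) by (simp_all add: nev_insert L assms F) (simp_all add: algebra_simps)
qed

text \<open>The coordinates in \<open>W\<close> split off one at a time;
  \<open>p * (1 - \<epsilon> + \<epsilon> * p)\<close> is the probability that one coordinate is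
  open both before and after the noise.\<close>

lemma nev_indep:
  assumes "finite \<Lambda>" "W \<subseteq> \<Lambda>" "0 \<le> p" "p \<le> 1" "0 \<le> \<epsilon>" "\<epsilon> \<le> 1"
    and F: "\<And>a b u v x. x \<in> W \<Longrightarrow> F (a(x := u)) (b(x := v)) = F a b"
  shows "nev \<Lambda> p \<epsilon> (\<lambda>a b. of_bool (\<forall>e\<in>W. a e) * F a b) = p ^ card W * nev \<Lambda> p \<epsilon> F"
    and "nev \<Lambda> p \<epsilon> (\<lambda>a b. of_bool ((\<forall>e\<in>W. a e) \<and> (\<forall>e\<in>W. b e)) * F a b)
           = (p * (1 - \<epsilon> + \<epsilon> * p)) ^ card W * nev \<Lambda> p \<epsilon> F"
proof -
  have "finite W" using assms finite_subset by blast
  then have "W \<subseteq> \<Lambda> \<longrightarrow> (\<forall>a b u v x. x \<in> W \<longrightarrow> F (a(x := u)) (b(x := v)) = F a b) \<longrightarrow>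
    nev \<Lambda> p \<epsilon> (\<lambda>a b. of_bool (\<forall>e\<in>W. a e) * F a b) = p ^ card W * nev \<Lambda> p \<epsilon> F \<and>
    nev \<Lambda> p \<epsilon> (\<lambda>a b. of_bool ((\<forall>e\<in>W. a e) \<and> (\<forall>e\<in>W. b e)) * F a b)
           = (p * (1 - \<epsilon> + \<epsilon> * p)) ^ card W * nev \<Lambda> p \<epsilon> F"
  proof (induction W rule: finite_induct)
    case empty
    show ?case by simp
  next
    case (insert x W)
    show ?case
    proof (intro impI)
      assume a: "insert x W \<subseteq> \<Lambda>" and i: "\<forall>a b u v y. y \<in> insert x W \<longrightarrow> F (a(y := u)) (b(y := v)) = F a b"
      have 1: "nev \<Lambda> p \<epsilon> (\<lambda>a b. of_bool (a x) * (of_bool (\<forall>e\<in>W. a e) * F a b))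
          = p * nev \<Lambda> p \<epsilon> (\<lambda>a b. of_bool (\<forall>e\<in>W. a e) * F a b)"
        using a i insert.hyps
        by (intro nev_indep_coord(1)[OF assms(1) _ assms(3-6)]) (auto intro!: arg_cong2[of _ _ _ _ "(*)"])
      have 2: "nev \<Lambda> p \<epsilon> (\<lambda>a b. of_bool (a x \<and> b x) * (of_bool ((\<forall>e\<in>W. a e) \<and> (\<forall>e\<in>W. b e)) * F a b))
          = p * (1 - \<epsilon> + \<epsilon> * p) * nev \<Lambda> p \<epsilon> (\<lambda>a b. of_bool ((\<forall>e\<in>W. a e) \<and> (\<forall>e\<in>W. b e)) * F a b)"
        using a i insert.hyps
        by (intro nev_indep_coord(2)[OF assms(1) _ assms(3-6)]) (auto intro!: arg_cong2[of _ _ _ _ "(*)"])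
      have e1: "of_bool (\<forall>e\<in>insert x W. a e) * F a b = of_bool (a x) * (of_bool (\<forall>e\<in>W. a e) * F a b)" for a b
        by auto
      have e2: "of_bool ((\<forall>e\<in>insert x W. a e) \<and> (\<forall>e\<in>insert x W. b e)) * F a b
          = of_bool (a x \<and> b x) * (of_bool ((\<forall>e\<in>W. a e) \<and> (\<forall>e\<in>W. b e)) * F a b)" for a b
        by auto
      show "nev \<Lambda> p \<epsilon> (\<lambda>a b. of_bool (\<forall>e\<in>insert x W. a e) * F a b) = p ^ card (insert x W) * nev \<Lambda> p \<epsilon> F \<and>
        nev \<Lambda> p \<epsilon> (\<lambda>a b. of_bool ((\<forall>e\<in>insert x W. a e) \<and> (\<forall>e\<in>insert x W. b e)) * F a b)
           = (p * (1 - \<epsilon> + \<epsilon> * p)) ^ card (insert x W) * nev \<Lambda> p \<epsilon> F"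
        unfolding e1 e2 1 2 using insert.IH insert.hyps a i by (simp add: mult.assoc del: fun_upd_apply)
    qed
  qed
  then show "nev \<Lambda> p \<epsilon> (\<lambda>a b. of_bool (\<forall>e\<in>W. a e) * F a b) = p ^ card W * nev \<Lambda> p \<epsilon> F"
    and "nev \<Lambda> p \<epsilon> (\<lambda>a b. of_bool ((\<forall>e\<in>W. a e) \<and> (\<forall>e\<in>W. b e)) * F a b)
           = (p * (1 - \<epsilon> + \<epsilon> * p)) ^ card W * nev \<Lambda> p \<epsilon> F"
    using assms(2) F by auto
qed

lemma ev_all:
  assumes "finite \<Lambda>" "W \<subseteq> \<Lambda>" "0 \<le> p" "p \<le> 1"
  shows "ev \<Lambda> p (\<lambda>w. of_bool (\<forall>e\<in>W. w e)) = p ^ card W"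
  using nev_indep(1)[of \<Lambda> W p 0 "\<lambda>a b. 1"] nev_fst[of \<Lambda> p 0 "\<lambda>w. of_bool (\<forall>e\<in>W. w e)"] assms by simp

text \<open>Turns statements about noise into statements about a single configuration; at \<epsilon>
  = 0 \<open>nev_harris\<close> becomes the classical inequality.\<close>

lemma nev_zero:
  assumes "finite \<Lambda>" "0 \<le> p" "p \<le> 1"
  shows "nev \<Lambda> p 0 F = ev \<Lambda> p (\<lambda>w. F w w)"
  using assms(1)
proof (induction \<Lambda> arbitrary: F rule: finite_induct)
  case empty
  show ?case by (simp add: nev_eq_ev ev_def bernoulli_product_def)
next
  case (insert x \<Lambda>)
  show ?case by (simp add: nev_insert ev_insert insert assms)
qed

lemma harris:
  fixes F G :: "('a \<Rightarrow> bool) \<Rightarrow> real"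
  assumes "finite \<Lambda>" "0 \<le> p" "p \<le> 1" "mono F" "mono G"
  shows "ev \<Lambda> p F * ev \<Lambda> p G \<le> ev \<Lambda> p (\<lambda>w. F w * G w)"
  using nev_harris[of \<Lambda> p 0 F G] assms by (simp add: nev_zero)

lemma cond_prob_noise_pair_eq:
  assumes "finite \<Lambda>" "0 \<le> p" "p \<le> 1" "0 \<le> \<epsilon>" "\<epsilon> \<le> 1"
  shows "\<P>(x in measure_pmf (noise_pair \<Lambda> p \<epsilon>). f (snd x) \<bar> f (fst x))
    = nev \<Lambda> p \<epsilon> (\<lambda>a b. of_bool (f a) * of_bool (f b)) / ev \<Lambda> p (\<lambda>w. of_bool (f w))"
proof -
  have "\<P>(x in measure_pmf (noise_pair \<Lambda> p \<epsilon>). f (snd x) \<and> f (fst x))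
      = nev \<Lambda> p \<epsilon> (\<lambda>a b. of_bool (f a) * of_bool (f b))"
    unfolding prob_noise_pair_eq_nev[of _ _ _ "\<lambda>a b. f b \<and> f a"] by (simp add: of_bool_conj mult.commute)
  moreover have "\<P>(x in measure_pmf (noise_pair \<Lambda> p \<epsilon>). f (fst x)) = ev \<Lambda> p (\<lambda>w. of_bool (f w))"
    unfolding prob_noise_pair_eq_nev[of _ _ _ "\<lambda>a b. f a"] by (rule nev_fst[OF assms])
  ultimately show ?thesis unfolding cond_prob_def by simp
qed

lemma nev_harris_antimono:
  fixes B G :: "('a \<Rightarrow> bool) \<Rightarrow> real"
  assumes "finite \<Lambda>" "0 \<le> p" "p \<le> 1" "0 \<le> \<epsilon>" "\<epsilon> \<le> 1" "antimono B" "mono G"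
  shows "nev \<Lambda> p \<epsilon> (\<lambda>a b. B a * G b) \<le> ev \<Lambda> p B * ev \<Lambda> p G"
proof -
  \<comment> \<open>Written as a scalar multiple so that \<open>ev_cmult\<close> and
    \<open>nev_cmult\<close> pull out the sign.\<close>
  have "mono (\<lambda>w. - 1 * B w)" using assms(6) by (auto simp: mono_def antimono_def)
  from nev_harris[OF assms(1-5) this assms(7)] show ?thesis
    by (simp only: ev_cmult mult.assoc nev_cmult)
qed

section \<open>Second moment inequalities\<close>

lemma second_moment_ge:
  assumes "finite \<Lambda>" and "\<And>w. X w \<noteq> 0 \<Longrightarrow> P w"
  shows "(ev \<Lambda> p X)\<^sup>2 \<le> ev \<Lambda> p (\<lambda>w. X w * X w) * ev \<Lambda> p (\<lambda>w. of_bool (P w))"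
proof -
  define a where "a = ev \<Lambda> p (\<lambda>w. X w * X w)"
  define b where "b = ev \<Lambda> p X"
  define c where "c = ev \<Lambda> p (\<lambda>w. of_bool (P w))"
  \<comment> \<open>Cauchy-Schwarz for \<open>X\<close> and the indicator of \<open>P\<close>
    through a nonnegative quadratic form; the mixed term is the mean \<open>b\<close> because
    \<open>X\<close> vanishes off \<open>P\<close>.\<close>
  have *: "0 \<le> s * s * a - 2 * s * b * t + t * t * c" for s t
  proof -
    have "0 \<le> ev \<Lambda> p (\<lambda>w. (s * X w - t * of_bool (P w))\<^sup>2)" by (rule ev_nonneg) simp
    also have "(\<lambda>w. (s * X w - t * of_bool (P w))\<^sup>2) = (\<lambda>w. s * s * (X w * X w) - 2 * s * t * X w + t * t * of_bool (P w))"
      using assms(2) by (fastforce simp: power2_eq_square algebra_simps)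
    also have "ev \<Lambda> p \<dots> = s * s * a - 2 * s * t * b + t * t * c"
      unfolding a_def b_def c_def by (simp only: ev_add[OF assms(1)] ev_diff[OF assms(1)] ev_cmult)
    finally show ?thesis by (simp add: mult_ac)
  qed
  have "a \<ge> 0" unfolding a_def by (rule ev_nonneg) simp
  show ?thesis
  proof (cases "a = 0")
    case True
    have "b = 0"
    proof (rule ccontr)
      assume "b \<noteq> 0"
      \<comment> \<open>For \<open>a = 0\<close> this choice gives the form the value -1.\<close>
      from *[of "(c + 1) / (2 * b)" 1] show False using \<open>b \<noteq> 0\<close> True by simp
    qed
    then show ?thesis unfolding a_def[symmetric] b_def[symmetric] c_def[symmetric] using True by simp
  next
    case False
    have "0 \<le> a * (a * c - b * b)" using *[of b a] by (simp add: algebra_simps)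
    then have "0 \<le> a * c - b * b" using False \<open>a \<ge> 0\<close> by (simp add: zero_le_mult_iff)
    then show ?thesis unfolding a_def b_def c_def by (simp add: power2_eq_square)
  qed
qed

text \<open>Chebyshev's inequality: off \<open>P\<close> the deviation from the mean is the mean
  itself. Unlike \<open>second_moment_ge\<close> it turns a lower bound on the probability of
  failure into an upper bound on the mean.\<close>

lemma second_moment_zero_le:
  assumes "finite \<Lambda>" and "\<And>w. \<not> P w \<Longrightarrow> X w = 0"
  shows "(1 - ev \<Lambda> p (\<lambda>w. of_bool (P w))) * (ev \<Lambda> p X)\<^sup>2 \<le> ev \<Lambda> p (\<lambda>w. X w * X w) - (ev \<Lambda> p X)\<^sup>2"
proof -
  define b where "b = ev \<Lambda> p X"
  have "(1 - ev \<Lambda> p (\<lambda>w. of_bool (P w))) * b\<^sup>2 = ev \<Lambda> p (\<lambda>w. b\<^sup>2 * (1 - of_bool (P w)))"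
    by (simp add: ev_diff[OF assms(1)] ev_cmult)
  also have "\<dots> \<le> ev \<Lambda> p (\<lambda>w. (X w - b)\<^sup>2)"
    using assms(2) by (intro ev_mono assms(1)) (case_tac "P w", auto)
  also have "(\<lambda>w. (X w - b)\<^sup>2) = (\<lambda>w. X w * X w - 2 * b * X w + b\<^sup>2)"
    by (auto simp: power2_eq_square algebra_simps)
  also have "ev \<Lambda> p \<dots> = ev \<Lambda> p (\<lambda>w. X w * X w) - b\<^sup>2"
    unfolding ev_add[OF assms(1)] ev_diff[OF assms(1)] ev_cmult ev_const b_def[symmetric]
    by (simp add: power2_eq_square)
  finally show ?thesis unfolding b_def .
qed

section \<open>Noise for uniform set families\<close>

definition covered :: "'a set set \<Rightarrow> ('a \<Rightarrow> bool) \<Rightarrow> bool" where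
  "covered \<C> w \<longleftrightarrow> (\<exists>W\<in>\<C>. \<forall>e\<in>W. w e)"

lemma mono_covered: "mono (\<lambda>w. of_bool (covered \<C> w) :: real)"
  unfolding mono_def covered_def le_fun_def of_bool_def by simp blast

lemma mono_all: "mono (\<lambda>w. of_bool (\<forall>e\<in>W. w e) :: real)"
  unfolding mono_def le_fun_def by (auto simp: of_bool_def)

text \<open>The noise estimates see nothing of graphs: they use only that all members of the family
  have the same size.\<close>

locale uniform_family =
  fixes \<Lambda> :: "'a set" and \<C> :: "'a set set" and l :: nat and p :: real
  assumes finite_ground: "finite \<Lambda>"
    and family: "\<And>W. W \<in> \<C> \<Longrightarrow> W \<subseteq> \<Lambda>"
    and card_member: "\<And>W. W \<in> \<C> \<Longrightarrow> card W = l"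
    and p_ge: "0 \<le> p" and p_le: "p \<le> 1"
begin

definition \<Delta> :: "'a set \<Rightarrow> real" where
  "\<Delta> W = (\<Sum>W'\<in>{W'\<in>\<C>. W' \<noteq> W \<and> W' \<inter> W \<noteq> {}}. p ^ card (W' - W))"

lemma finite_family: "finite \<C>"
  using family finite_ground by (meson PowI finite_Pow_iff finite_subset subsetI)

text \<open>\<open>B\<close> is a decreasing side condition on the coordinates outside
  \<open>W\<close>. With \<open>B = 1\<close> this is conditioning on \<open>W\<close> alone; with
  \<open>B\<close> saying that no earlier member is open it becomes conditioning on \<open>W\<close>
  being the first open one.\<close>

lemma nev_witness_le:
  assumes W: "W \<in> \<C>" and eps: "0 \<le> \<epsilon>" "\<epsilon> \<le> 1" and "antimono B" "\<And>w. 0 \<le> B w"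
    and indep: "\<And>w x u. x \<in> W \<Longrightarrow> B (w(x := u)) = B w"
  shows "nev \<Lambda> p \<epsilon> (\<lambda>a b. of_bool (\<forall>e\<in>W. a e) * (B a * of_bool (covered \<C> b)))
    \<le> p ^ l * ev \<Lambda> p B * ((1 - \<epsilon> + \<epsilon> * p) ^ l + ev \<Lambda> p (\<lambda>w. of_bool (covered \<C> w)) + \<Delta> W)"
proof -
  define q where "q = 1 - \<epsilon> + \<epsilon> * p"
  \<comment> \<open>\<open>G\<close> admits only members disjoint from \<open>W\<close>, and
    \<open>J W'\<close> counts the coordinates shared with \<open>W\<close> as open for free.
    Neither depends on \<open>W\<close>, so \<open>p ^ l\<close> factors out.\<close>
  define G :: "('a \<Rightarrow> bool) \<Rightarrow> real" where "G = (\<lambda>w. of_bool (covered \<C> (\<lambda>e. e \<notin> W \<and> w e)))"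
  define T where "T = {W'\<in>\<C>. W' \<noteq> W \<and> W' \<inter> W \<noteq> {}}"
  define J :: "'a set \<Rightarrow> ('a \<Rightarrow> bool) \<Rightarrow> real" where "J W' w = of_bool (\<forall>e\<in>W' - W. w e)" for W' w
  have finT: "finite T" unfolding T_def using finite_family by auto
  have WL: "W \<subseteq> \<Lambda>" using family[OF W] .
  have cW: "card W = l" using card_member[OF W] .
  note par = p_ge p_le eps
  have B0: "0 \<le> ev \<Lambda> p B" by (rule ev_nonneg) (rule assms)
  have pw: "of_bool (covered \<C> b) \<le> of_bool (\<forall>e\<in>W. b e) + G b + (\<Sum>W'\<in>T. J W' b)" for b
  proof (cases "covered \<C> b")
    case True
    then obtain W' where W': "W' \<in> \<C>" "\<forall>e\<in>W'. b e" unfolding covered_def by auto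
    have nn: "0 \<le> (\<Sum>W'\<in>T. J W' b)" "0 \<le> G b" unfolding J_def G_def by (auto intro: sum_nonneg)
    consider "W' = W" | "W' \<inter> W = {}" | "W' \<in> T" unfolding T_def using W' by auto
    then show ?thesis
    proof cases
      case 1
      then show ?thesis using nn W' True by simp
    next
      case 2
      then have "G b = 1" unfolding G_def covered_def using W' by auto
      then show ?thesis using nn True by simp
    next
      case 3
      have "J W' b = 1" unfolding J_def using W' by auto
      moreover have "J W' b \<le> (\<Sum>W'\<in>T. J W' b)"
        by (rule member_le_sum[OF 3 _ finT]) (auto simp: J_def)
      ultimately show ?thesis using nn True by simp
    qed
  next
    case False
    then show ?thesis by (auto intro!: add_nonneg_nonneg sum_nonneg simp: J_def G_def)
  qed
  have "nev \<Lambda> p \<epsilon> (\<lambda>a b. of_bool (\<forall>e\<in>W. a e) * (B a * of_bool (covered \<C> b)))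
    \<le> nev \<Lambda> p \<epsilon> (\<lambda>a b. of_bool ((\<forall>e\<in>W. a e) \<and> (\<forall>e\<in>W. b e)) * B a
        + of_bool (\<forall>e\<in>W. a e) * (B a * G b) + (\<Sum>W'\<in>T. of_bool (\<forall>e\<in>W. a e) * (B a * J W' b)))"
  proof (rule nev_mono[OF finite_ground])
    fix a b
    have "of_bool (\<forall>e\<in>W. a e) * (B a * of_bool (covered \<C> b)) \<le>
       of_bool (\<forall>e\<in>W. a e) * (B a * (of_bool (\<forall>e\<in>W. b e) + G b + (\<Sum>W'\<in>T. J W' b)))"
      by (intro mult_left_mono pw assms) auto
    also have "\<dots> = of_bool ((\<forall>e\<in>W. a e) \<and> (\<forall>e\<in>W. b e)) * B a
        + of_bool (\<forall>e\<in>W. a e) * (B a * G b) + (\<Sum>W'\<in>T. of_bool (\<forall>e\<in>W. a e) * (B a * J W' b))"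
      unfolding of_bool_conj by (simp add: algebra_simps sum_distrib_left)
    finally show "of_bool (\<forall>e\<in>W. a e) * (B a * of_bool (covered \<C> b)) \<le> \<dots>" .
  qed
  also have "\<dots> = nev \<Lambda> p \<epsilon> (\<lambda>a b. of_bool ((\<forall>e\<in>W. a e) \<and> (\<forall>e\<in>W. b e)) * B a)
      + nev \<Lambda> p \<epsilon> (\<lambda>a b. of_bool (\<forall>e\<in>W. a e) * (B a * G b))
      + (\<Sum>W'\<in>T. nev \<Lambda> p \<epsilon> (\<lambda>a b. of_bool (\<forall>e\<in>W. a e) * (B a * J W' b)))"
    by (simp only: nev_add[OF finite_ground] nev_sum[OF finite_ground])
  also have "\<dots> \<le> (p * q) ^ l * ev \<Lambda> p B + p ^ l * (ev \<Lambda> p B * ev \<Lambda> p (\<lambda>w. of_bool (covered \<C> w)))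
      + (\<Sum>W'\<in>T. p ^ l * (ev \<Lambda> p B * p ^ card (W' - W)))"
  proof (intro add_mono sum_mono)
    show "nev \<Lambda> p \<epsilon> (\<lambda>a b. of_bool ((\<forall>e\<in>W. a e) \<and> (\<forall>e\<in>W. b e)) * B a) \<le> (p * q) ^ l * ev \<Lambda> p B"
      using nev_indep(2)[OF finite_ground WL par, of "\<lambda>a b. B a", OF indep]
      by (simp only: cW nev_fst[OF finite_ground par] q_def order.refl)
    have Gi: "G (w(x := u)) = G w" if "x \<in> W" for x u w
    proof -
      have "(\<lambda>e. e \<notin> W \<and> (w(x := u)) e) = (\<lambda>e. e \<notin> W \<and> w e)" using that by auto
      then show ?thesis unfolding G_def by simp
    qed
    have "mono G" unfolding mono_def G_def covered_def le_fun_def of_bool_def by simp blast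
    have "nev \<Lambda> p \<epsilon> (\<lambda>a b. of_bool (\<forall>e\<in>W. a e) * (B a * G b)) = p ^ l * nev \<Lambda> p \<epsilon> (\<lambda>a b. B a * G b)"
      using nev_indep(1)[OF finite_ground WL par, of "\<lambda>a b. B a * G b"] indep Gi
      by (simp add: cW del: fun_upd_apply)
    \<comment> \<open>\<open>B\<close> is decreasing and \<open>G\<close> increasing, so the side
      condition can only lower the probability of \<open>G\<close> after noise.\<close>
    also have "\<dots> \<le> p ^ l * (ev \<Lambda> p B * ev \<Lambda> p G)"
      by (intro mult_left_mono nev_harris_antimono finite_ground par assms \<open>mono G\<close>) (use p_ge in auto)
    also have "\<dots> \<le> p ^ l * (ev \<Lambda> p B * ev \<Lambda> p (\<lambda>w. of_bool (covered \<C> w)))"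
      by (intro mult_left_mono ev_mono finite_ground B0)
         (use p_ge in \<open>auto simp: G_def covered_def of_bool_def\<close>)
    finally show "nev \<Lambda> p \<epsilon> (\<lambda>a b. of_bool (\<forall>e\<in>W. a e) * (B a * G b))
      \<le> p ^ l * (ev \<Lambda> p B * ev \<Lambda> p (\<lambda>w. of_bool (covered \<C> w)))" .
  next
    fix W' assume "W' \<in> T"
    then have W': "W' - W \<subseteq> \<Lambda>" unfolding T_def using family by auto
    have Ji: "J W' (w(x := u)) = J W' w" if "x \<in> W" for x u w
      using that unfolding J_def by auto
    have "nev \<Lambda> p \<epsilon> (\<lambda>a b. of_bool (\<forall>e\<in>W. a e) * (B a * J W' b)) = p ^ l * nev \<Lambda> p \<epsilon> (\<lambda>a b. B a * J W' b)"
      using nev_indep(1)[OF finite_ground WL par, of "\<lambda>a b. B a * J W' b"] indep Ji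
      by (simp add: cW del: fun_upd_apply)
    also have "\<dots> \<le> p ^ l * (ev \<Lambda> p B * ev \<Lambda> p (J W'))"
      by (intro mult_left_mono nev_harris_antimono finite_ground par assms)
         (use p_ge in \<open>auto simp: J_def[abs_def] mono_all\<close>)
    also have "ev \<Lambda> p (J W') = p ^ card (W' - W)"
      unfolding J_def[abs_def] by (rule ev_all[OF finite_ground W' p_ge p_le])
    finally show "nev \<Lambda> p \<epsilon> (\<lambda>a b. of_bool (\<forall>e\<in>W. a e) * (B a * J W' b)) \<le> p ^ l * (ev \<Lambda> p B * p ^ card (W' - W))" .
  qed
  also have "\<dots> = p ^ l * ev \<Lambda> p B * (q ^ l + ev \<Lambda> p (\<lambda>w. of_bool (covered \<C> w)) + \<Delta> W)"
    unfolding \<Delta>_def T_def[symmetric] power_mult_distrib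
    by (simp add: algebra_simps sum_distrib_left)
  finally show ?thesis unfolding q_def .
qed

lemma nev_one_witness_le:
  assumes W: "W \<in> \<C>" and eps: "0 \<le> \<epsilon>" "\<epsilon> \<le> 1"
  shows "nev \<Lambda> p \<epsilon> (\<lambda>a b. of_bool (\<forall>e\<in>W. a e) * of_bool (covered \<C> b))
    \<le> p ^ l * ((1 - \<epsilon> + \<epsilon> * p) ^ l + ev \<Lambda> p (\<lambda>w. of_bool (covered \<C> w)) + \<Delta> W)"
  using nev_witness_le[OF assms, of "\<lambda>w. 1"] by (simp add: antimono_def)

text \<open>By positive association, an open witness cannot lower the probability of being covered
  after noise; so only upper bounds remain to be found.\<close>

lemma nev_one_witness_ge:
  assumes W: "W \<in> \<C>" and eps: "0 \<le> \<epsilon>" "\<epsilon> \<le> 1"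
  shows "p ^ l * ev \<Lambda> p (\<lambda>w. of_bool (covered \<C> w))
    \<le> nev \<Lambda> p \<epsilon> (\<lambda>a b. of_bool (\<forall>e\<in>W. a e) * of_bool (covered \<C> b))"
  using nev_harris[OF finite_ground p_ge p_le eps mono_all[of W] mono_covered[of \<C>]]
    ev_all[OF finite_ground family[OF W] p_ge p_le] card_member[OF W] by simp

text \<open>The event is decomposed according to the first open member of the family; that no earlier
  member is open is a decreasing event, which by Harris' inequality can only lower the
  probability of being covered after noise.\<close>

lemma nev_covered_le:
  assumes eps: "0 \<le> \<epsilon>" "\<epsilon> \<le> 1" and \<delta>: "\<And>W. W \<in> \<C> \<Longrightarrow> \<Delta> W \<le> \<delta>"
  shows "nev \<Lambda> p \<epsilon> (\<lambda>a b. of_bool (covered \<C> a) * of_bool (covered \<C> b))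
    \<le> ev \<Lambda> p (\<lambda>w. of_bool (covered \<C> w)) *
      ((1 - \<epsilon> + \<epsilon> * p) ^ l + ev \<Lambda> p (\<lambda>w. of_bool (covered \<C> w)) + \<delta>)"
proof -
  define M where "M = (1 - \<epsilon> + \<epsilon> * p) ^ l + ev \<Lambda> p (\<lambda>w. of_bool (covered \<C> w)) + \<delta>"
  note par = p_ge p_le eps
  \<comment> \<open>Only the family for the first configuration is built up member by member; for
    the second it stays \<open>\<C>\<close>.\<close>
  have "nev \<Lambda> p \<epsilon> (\<lambda>a b. of_bool (covered \<S> a) * of_bool (covered \<C> b))
    \<le> ev \<Lambda> p (\<lambda>w. of_bool (covered \<S> w)) * M" if "\<S> \<subseteq> \<C>" for \<S>
    using finite_subset[OF that finite_family] that
  proof (induction \<S> rule: finite_induct)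
    case empty
    show ?case by (simp add: covered_def)
  next
    case (insert W \<S>)
    have W: "W \<in> \<C>" using insert by auto
    \<comment> \<open>No earlier member is open, evaluated with all of \<open>W\<close> set to True.
      On the event that \<open>W\<close> is open this changes nothing, and it makes \<open>B\<close>
      independent of \<open>W\<close>.\<close>
    define B :: "('a \<Rightarrow> bool) \<Rightarrow> real" where "B w = of_bool (\<not> covered \<S> (\<lambda>e. e \<in> W \<or> w e))" for w
    have split: "of_bool (covered (insert W \<S>) w)
        = of_bool (covered \<S> w) + of_bool (\<forall>e\<in>W. w e) * B w" for w
    proof (cases "\<forall>e\<in>W. w e")
      case True
      then have "(\<lambda>e. e \<in> W \<or> w e) = w" by auto
      then show ?thesis unfolding B_def using True by (auto simp: covered_def)
    qed (auto simp: covered_def)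
    have Bi: "B (w(x := u)) = B w" if "x \<in> W" for x u w
    proof -
      have "(\<lambda>e. e \<in> W \<or> (w(x := u)) e) = (\<lambda>e. e \<in> W \<or> w e)" using that by auto
      then show ?thesis unfolding B_def by simp
    qed
    have Ba: "antimono B"
      unfolding antimono_def B_def covered_def le_fun_def of_bool_def by simp blast
    have evB: "ev \<Lambda> p (\<lambda>w. of_bool (\<forall>e\<in>W. w e) * B w) = p ^ l * ev \<Lambda> p B"
      using nev_indep(1)[OF finite_ground family[OF W] p_ge p_le order.refl zero_le_one, of "\<lambda>a b. B a"] Bi
      by (simp add: nev_zero finite_ground p_ge p_le card_member[OF W] del: fun_upd_apply)
    have "nev \<Lambda> p \<epsilon> (\<lambda>a b. of_bool (\<forall>e\<in>W. a e) * (B a * of_bool (covered \<C> b)))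
      \<le> p ^ l * ev \<Lambda> p B * ((1 - \<epsilon> + \<epsilon> * p) ^ l + ev \<Lambda> p (\<lambda>w. of_bool (covered \<C> w)) + \<Delta> W)"
      by (rule nev_witness_le[OF W eps Ba _ Bi]) (simp_all add: B_def)
    also have "\<dots> \<le> p ^ l * ev \<Lambda> p B * M"
      unfolding M_def using \<delta>[OF W] p_ge
      by (intro mult_left_mono mult_nonneg_nonneg ev_nonneg) (simp_all add: B_def)
    finally have 1: "nev \<Lambda> p \<epsilon> (\<lambda>a b. of_bool (\<forall>e\<in>W. a e) * (B a * of_bool (covered \<C> b)))
        \<le> p ^ l * ev \<Lambda> p B * M" .
    have "nev \<Lambda> p \<epsilon> (\<lambda>a b. of_bool (covered (insert W \<S>) a) * of_bool (covered \<C> b))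
      = nev \<Lambda> p \<epsilon> (\<lambda>a b. of_bool (covered \<S> a) * of_bool (covered \<C> b))
        + nev \<Lambda> p \<epsilon> (\<lambda>a b. of_bool (\<forall>e\<in>W. a e) * (B a * of_bool (covered \<C> b)))"
      unfolding split by (simp only: distrib_right nev_add[OF finite_ground] mult.assoc)
    also have "\<dots> \<le> ev \<Lambda> p (\<lambda>w. of_bool (covered \<S> w)) * M + p ^ l * ev \<Lambda> p B * M"
      using insert 1 by (intro add_mono) auto
    also have "\<dots> = ev \<Lambda> p (\<lambda>w. of_bool (covered (insert W \<S>) w)) * M"
      unfolding split ev_add[OF finite_ground] evB by (simp add: algebra_simps)
    finally show ?case .
  qed
  then show ?thesis unfolding M_def by blast
qed

text \<open>With m the mean number of open members, the second moment is at most m (m + 1 +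
  \<delta>), so the variance is at most m (1 + \<delta>). Under nondegeneracy this bounds m from
  above.\<close>

lemma uncovered_prob_le:
  assumes pos: "0 < real (card \<C>) * p ^ l" and \<delta>: "\<And>W. W \<in> \<C> \<Longrightarrow> \<Delta> W \<le> \<delta>"
  shows "(1 - ev \<Lambda> p (\<lambda>w. of_bool (covered \<C> w))) * (real (card \<C>) * p ^ l) \<le> 1 + \<delta>"
proof -
  define X :: "('a \<Rightarrow> bool) \<Rightarrow> real" where "X w = (\<Sum>W\<in>\<C>. of_bool (\<forall>e\<in>W. w e))" for w
  define m where "m = real (card \<C>) * p ^ l"
  have evX: "ev \<Lambda> p X = m"
    unfolding X_def[abs_def] m_def
    by (simp add: ev_sum finite_ground ev_all family p_ge p_le card_member)
  have "ev \<Lambda> p (\<lambda>w. X w * X w) = ev \<Lambda> p (\<lambda>w. \<Sum>W\<in>\<C>. \<Sum>W'\<in>\<C>. of_bool (\<forall>e\<in>W \<union> W'. w e))"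
    unfolding X_def sum_product
    by (intro arg_cong[of _ _ "ev \<Lambda> p"] ext sum.cong refl) (auto simp: of_bool_def)
  also have "\<dots> = (\<Sum>W\<in>\<C>. \<Sum>W'\<in>\<C>. p ^ card (W \<union> W'))"
    by (simp only: ev_sum finite_ground)
       (intro sum.cong refl ev_all finite_ground p_ge p_le Un_least family)
  also have "\<dots> \<le> (\<Sum>W\<in>\<C>. p ^ l * (m + 1 + \<delta>))"
  proof (intro sum_mono)
    fix W assume W: "W \<in> \<C>"
    have finW: "finite W" using family[OF W] finite_ground finite_subset by blast
    have "(\<Sum>W'\<in>\<C>. p ^ card (W \<union> W')) \<le>
       (\<Sum>W'\<in>\<C>. p ^ l * (p ^ l + of_bool (W' = W) + of_bool (W' \<noteq> W \<and> W' \<inter> W \<noteq> {}) * p ^ card (W' - W)))"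
    proof (intro sum_mono)
      fix W' assume W': "W' \<in> \<C>"
      have fin': "finite W'" using family[OF W'] finite_ground finite_subset by blast
      have c: "card (W \<union> W') = l + card (W' - W)"
        using card_Un_disjoint[of W "W' - W"] finW fin' card_member[OF W] by auto
      have c2: "card (W' - W) = l" if "W' \<inter> W = {}" using that card_member[OF W'] by (simp add: Diff_triv)
      show "p ^ card (W \<union> W') \<le> p ^ l * (p ^ l + of_bool (W' = W) + of_bool (W' \<noteq> W \<and> W' \<inter> W \<noteq> {}) * p ^ card (W' - W))"
        unfolding c power_add using p_ge c2 by (intro mult_left_mono) (auto simp: of_bool_def)
    qed
    also have "\<dots> = p ^ l * ((\<Sum>W'\<in>\<C>. p ^ l) + (\<Sum>W'\<in>\<C>. of_bool (W' = W))
        + (\<Sum>W'\<in>\<C>. of_bool (W' \<noteq> W \<and> W' \<inter> W \<noteq> {}) * p ^ card (W' - W)))"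
      by (simp only: sum_distrib_left[symmetric] sum.distrib)
    also have "(\<Sum>W'\<in>\<C>. p ^ l) = m" unfolding m_def by simp
    also have "(\<Sum>W'\<in>\<C>. of_bool (W' = W) :: real) = 1"
      using W finite_family by (simp add: of_bool_def)
    also have "(\<Sum>W'\<in>\<C>. of_bool (W' \<noteq> W \<and> W' \<inter> W \<noteq> {}) * p ^ card (W' - W)) = \<Delta> W"
      unfolding \<Delta>_def using finite_family
      by (subst sum.inter_filter) (auto intro!: sum.cong simp: of_bool_def)
    finally show "(\<Sum>W'\<in>\<C>. p ^ card (W \<union> W')) \<le> p ^ l * (m + 1 + \<delta>)"
      using mult_left_mono[OF \<delta>[OF W], of "p ^ l"] p_ge by (simp add: algebra_simps)
  qed
  also have "\<dots> = m * (m + 1 + \<delta>)" unfolding m_def by simp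
  finally have "ev \<Lambda> p (\<lambda>w. X w * X w) \<le> m * (m + 1 + \<delta>)" .
  moreover have "(1 - ev \<Lambda> p (\<lambda>w. of_bool (covered \<C> w))) * (ev \<Lambda> p X)\<^sup>2
      \<le> ev \<Lambda> p (\<lambda>w. X w * X w) - (ev \<Lambda> p X)\<^sup>2"
    by (rule second_moment_zero_le[OF finite_ground]) (auto simp: X_def covered_def intro!: sum.neutral)
  ultimately have "m * ((1 - ev \<Lambda> p (\<lambda>w. of_bool (covered \<C> w))) * m) \<le> m * (1 + \<delta>)"
    unfolding evX by (simp add: power2_eq_square algebra_simps)
  then show ?thesis using pos unfolding m_def[symmetric] by (simp only: mult_le_cancel_left_pos)
qed

lemma covered_prob_le: "ev \<Lambda> p (\<lambda>w. of_bool (covered \<C> w)) \<le> real (card \<C>) * p ^ l"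
proof -
  have "ev \<Lambda> p (\<lambda>w. of_bool (covered \<C> w)) \<le> ev \<Lambda> p (\<lambda>w. \<Sum>W\<in>\<C>. of_bool (\<forall>e\<in>W. w e))"
  proof (rule ev_mono[OF finite_ground])
    fix w
    show "of_bool (covered \<C> w) \<le> (\<Sum>W\<in>\<C>. of_bool (\<forall>e\<in>W. w e) :: real)"
    proof (cases "covered \<C> w")
      case True
      then obtain W where W: "W \<in> \<C>" "\<forall>e\<in>W. w e" unfolding covered_def by auto
      have "of_bool (\<forall>e\<in>W. w e) \<le> (\<Sum>W\<in>\<C>. of_bool (\<forall>e\<in>W. w e) :: real)"
        by (rule member_le_sum[OF W(1) _ finite_family]) auto
      then show ?thesis using W True by auto
    qed (auto intro: sum_nonneg)
  qed
  also have "\<dots> = real (card \<C>) * p ^ l"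
    by (simp add: ev_sum finite_ground ev_all family p_ge p_le card_member)
  finally show ?thesis .
qed

end

section \<open>Copies of a graph\<close>

definition embeddings :: "'b ugraph \<Rightarrow> nat \<Rightarrow> ('b \<Rightarrow> nat) set" where
  "embeddings H n = {\<phi> \<in> verts H \<rightarrow>\<^sub>E {..<n}. inj_on \<phi> (verts H)}"

definition edge_image :: "'b ugraph \<Rightarrow> ('b \<Rightarrow> nat) \<Rightarrow> nat set set" where
  "edge_image H \<phi> = (`) \<phi> ` edges H"

text \<open>A copy is recorded by its edge set alone. Its vertex set is recovered as the union of
  the edges when H has no isolated vertices.\<close>

definition copies :: "'b ugraph \<Rightarrow> nat \<Rightarrow> nat set set set" where
  "copies H n = edge_image H ` embeddings H n"

lemma simple_graphD:
  assumes "simple_graph G"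
  shows "finite (verts G)" "verts G \<noteq> {}" "finite (edges G)"
    "\<And>e. e \<in> edges G \<Longrightarrow> e \<subseteq> verts G \<and> finite e \<and> card e = 2"
proof -
  have E: "edges G \<subseteq> nsets (verts G) 2" and f: "finite (verts G)" and n: "verts G \<noteq> {}"
    using assms by (simp_all add: simple_graph_def)
  show "finite (verts G)" "verts G \<noteq> {}" by fact+
  show "finite (edges G)" by (rule finite_subset[OF E finite_imp_finite_nsets[OF f]])
  show "\<And>e. e \<in> edges G \<Longrightarrow> e \<subseteq> verts G \<and> finite e \<and> card e = 2"
    using E unfolding nsets_def by blast
qed

lemma simple_graph_subset:
  assumes "simple_graph G" "V \<subseteq> verts G" "V \<noteq> {}" "F \<subseteq> edges G" "\<Union>F \<subseteq> V"
  shows "subgraph (V, F) G"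
  using assms finite_subset[of V "verts G"]
  by (auto simp: subgraph_def simple_graph_def nsets_def subset_iff)

text \<open>Handshake lemma, by counting incidences twice; it turns strict balance into a comparison
  of ratios of edges to vertices.\<close>

lemma average_degree_eq:
  assumes "simple_graph G"
  shows "average_degree G = 2 * real (card (edges G)) / real (card (verts G))"
proof -
  note G = simple_graphD[OF assms]
  have "(\<Sum>v\<in>verts G. degree G v) = (\<Sum>v\<in>verts G. \<Sum>e\<in>edges G. if v \<in> e then 1 else 0)"
    unfolding degree_def using G(3)
    by (intro sum.cong refl) (simp add: sum.If_cases Int_def)
  also have "\<dots> = (\<Sum>e\<in>edges G. \<Sum>v\<in>verts G. if v \<in> e then 1 else 0)"
    by (rule sum.swap)
  also have "\<dots> = (\<Sum>e\<in>edges G. 2)"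
  proof (intro sum.cong refl)
    fix e assume "e \<in> edges G"
    then have "verts G \<inter> e = e" "card e = 2" using G(4) by auto
    then show "(\<Sum>v\<in>verts G. if v \<in> e then 1 else 0) = (2::nat)"
      using G(1) by (simp add: sum.If_cases)
  qed
  finally have "(\<Sum>v\<in>verts G. degree G v) = 2 * card (edges G)" by simp
  then have "(\<Sum>v\<in>verts G. real (degree G v)) = 2 * real (card (edges G))"
    by (metis of_nat_sum of_nat_mult of_nat_numeral)
  then show ?thesis unfolding average_degree_def by simp
qed

lemma edge_image_subset:
  assumes "simple_graph H" "\<phi> \<in> embeddings H n"
  shows "edge_image H \<phi> \<subseteq> potential_edges n"
proof
  fix e' assume "e' \<in> edge_image H \<phi>"
  then obtain e where e: "e \<in> edges H" "e' = \<phi> ` e" by (auto simp: edge_image_def)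
  have "e \<subseteq> verts H" "finite e" "card e = 2" using simple_graphD(4)[OF assms(1) e(1)] by auto
  moreover have "inj_on \<phi> e" using assms(2) \<open>e \<subseteq> verts H\<close> by (auto simp: embeddings_def intro: inj_on_subset)
  ultimately show "e' \<in> potential_edges n"
    using assms(2) e(2) by (auto simp: potential_edges_def nsets_def card_image embeddings_def)
qed

lemma copy_indicator_iff_embedding:
  assumes "simple_graph (H n)"
  shows "copy_indicator H n w \<longleftrightarrow> (\<exists>\<phi>\<in>embeddings (H n) n. \<forall>e\<in>edge_image (H n) \<phi>. w e)"
proof
  assume "copy_indicator H n w"
  then obtain K \<phi> where K: "subgraph K (config_graph n w)" "bij_betw \<phi> (verts (H n)) (verts K)"
    "edges K = (\<lambda>e. \<phi> ` e) ` edges (H n)"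
    unfolding copy_indicator_def contains_copy_def graph_iso_def by auto
  let ?\<phi> = "restrict \<phi> (verts (H n))"
  have "?\<phi> ` e = \<phi> ` e" if "e \<in> edges (H n)" for e
    using simple_graphD(4)[OF assms that] by (intro image_cong) auto
  then have e: "edge_image (H n) ?\<phi> = edges K" unfolding edge_image_def K(3) by auto
  have "?\<phi> \<in> embeddings (H n) n"
    using K(1,2) by (auto simp: embeddings_def subgraph_def config_graph_def bij_betw_def)
  moreover have "\<forall>e\<in>edge_image (H n) ?\<phi>. w e"
    unfolding e using K(1) by (auto simp: subgraph_def config_graph_def)
  ultimately show "\<exists>\<phi>\<in>embeddings (H n) n. \<forall>e\<in>edge_image (H n) \<phi>. w e" by blast
next
  assume "\<exists>\<phi>\<in>embeddings (H n) n. \<forall>e\<in>edge_image (H n) \<phi>. w e"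
  then obtain \<phi> where \<phi>: "\<phi> \<in> embeddings (H n) n" "\<forall>e\<in>edge_image (H n) \<phi>. w e" by auto
  let ?K = "(\<phi> ` verts (H n), edge_image (H n) \<phi>)"
  have "edge_image (H n) \<phi> \<subseteq> nsets (\<phi> ` verts (H n)) 2"
  proof
    fix e' assume e': "e' \<in> edge_image (H n) \<phi>"
    then have "finite e'" "card e' = 2"
      using edge_image_subset[OF assms \<phi>(1)] by (auto simp: potential_edges_def nsets_def)
    moreover have "e' \<subseteq> \<phi> ` verts (H n)"
      using e' simple_graphD(4)[OF assms] unfolding edge_image_def by (metis (no_types, lifting) imageE image_mono)
    ultimately show "e' \<in> nsets (\<phi> ` verts (H n)) 2" by (simp add: nsets_def)
  qed
  then have "simple_graph ?K" using simple_graphD[OF assms] by (auto simp: simple_graph_def)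
  then have "subgraph ?K (config_graph n w)"
    using \<phi> edge_image_subset[OF assms \<phi>(1)] by (auto simp: subgraph_def config_graph_def embeddings_def)
  moreover have "graph_iso (H n) ?K"
    using \<phi>(1) by (auto simp: graph_iso_def embeddings_def edge_image_def bij_betw_def intro!: exI[of _ \<phi>])
  ultimately show "copy_indicator H n w"
    unfolding copy_indicator_def contains_copy_def by blast
qed

lemma copy_indicator_iff_covered:
  "simple_graph (H n) \<Longrightarrow> copy_indicator H n w \<longleftrightarrow> covered (copies (H n) n) w"
  by (simp add: copy_indicator_iff_embedding covered_def copies_def)

lemma inj_on_edge_image:
  assumes "simple_graph H" "\<phi> \<in> embeddings H n"
  shows "inj_on ((`) \<phi>) (edges H)"
proof (rule inj_on_subset)
  show "inj_on ((`) \<phi>) (Pow (verts H))"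
    using assms(2) by (auto simp: embeddings_def intro: inj_on_image_Pow)
  show "edges H \<subseteq> Pow (verts H)" using simple_graphD(4)[OF assms(1)] by auto
qed

lemma card_edge_image:
  assumes "simple_graph H" "\<phi> \<in> embeddings H n"
  shows "card (edge_image H \<phi>) = card (edges H)"
  unfolding edge_image_def by (rule card_image[OF inj_on_edge_image[OF assms]])

lemma finite_embeddings: "simple_graph H \<Longrightarrow> finite (embeddings H n)"
  unfolding embeddings_def
  by (rule finite_subset[of _ "verts H \<rightarrow>\<^sub>E {..<n}"]) (auto intro!: finite_PiE simple_graphD(1))

lemma finite_potential_edges: "finite (potential_edges n)"
  unfolding potential_edges_def by (simp add: finite_imp_finite_nsets)

lemma uniform_family_copies:
  assumes "simple_graph H" "0 \<le> p" "p \<le> 1"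
  shows "uniform_family (potential_edges n) (copies H n) (card (edges H)) p"
  using assms edge_image_subset[OF assms(1)] card_edge_image[OF assms(1)] finite_potential_edges
  by unfold_locales (auto simp: copies_def)

lemma card_inj_PiE_ge:
  assumes "finite V" "card V \<le> m"
  shows "(n - m) ^ card V \<le> card {\<phi> \<in> V \<rightarrow>\<^sub>E {..<n::nat}. inj_on \<phi> V}"
  using assms
proof (induction V rule: finite_induct)
  case (insert x V)
  define I where "I V = {\<phi> \<in> V \<rightarrow>\<^sub>E {..<n::nat}. inj_on \<phi> V}" for V :: "'a set"
  have fin: "finite (I V)" if "finite V" for V
    unfolding I_def by (rule finite_subset[OF _ finite_PiE[of V "\<lambda>_. {..<n}"]]) (use that in auto)
  let ?S = "SIGMA \<phi>:I V. {..<n} - \<phi> ` V"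
  have "(n - m) ^ card (insert x V) = (n - m) ^ card V * (n - m)" using insert.hyps by simp
  also have "\<dots> \<le> card (I V) * (n - m)" using insert unfolding I_def by (intro mult_le_mono1) auto
  also have "\<dots> = (\<Sum>\<phi>\<in>I V. n - m)" by simp
  also have "\<dots> \<le> (\<Sum>\<phi>\<in>I V. card ({..<n} - \<phi> ` V))"
  proof (rule sum_mono)
    fix \<phi> :: "'a \<Rightarrow> nat"
    have "card (\<phi> ` V) \<le> m" using card_image_le[OF insert.hyps(1), of \<phi>] insert by simp
    moreover have "card {..<n} - card (\<phi> ` V) \<le> card ({..<n} - \<phi> ` V)"
      using insert.hyps(1) by (intro diff_card_le_card_Diff) simp
    ultimately show "n - m \<le> card ({..<n} - \<phi> ` V)" by simp
  qed
  also have "\<dots> = card ?S" by (rule card_SigmaI[symmetric]) (use fin insert.hyps in auto)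
  also have "\<dots> \<le> card (I (insert x V))"
  proof (rule card_inj_on_le)
    show "inj_on (\<lambda>(\<phi>, y). \<phi>(x := y)) ?S"
    proof (rule inj_onI, clarify)
      fix \<phi> y \<psi> z assume a: "\<phi> \<in> I V" "\<psi> \<in> I V" and eq: "\<phi>(x := y) = \<psi>(x := z)"
      have "\<phi> u = \<psi> u" for u
        using fun_cong[OF eq, of u] a insert.hyps(2)
        by (cases "u = x") (auto simp: I_def PiE_def extensional_def)
      moreover have "y = z" using fun_cong[OF eq, of x] by simp
      ultimately show "\<phi> = \<psi> \<and> y = z" by auto
    qed
    show "(\<lambda>(\<phi>, y). \<phi>(x := y)) ` ?S \<subseteq> I (insert x V)"
    proof clarify
      fix \<phi> y assume a: "\<phi> \<in> I V" "y < n" "y \<notin> \<phi> ` V"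
      have im: "(\<phi>(x := y)) ` V = \<phi> ` V" using insert.hyps(2) by (intro image_cong) auto
      have "inj_on (\<phi>(x := y)) V" using a(1) insert.hyps(2) by (auto simp: I_def inj_on_def)
      then have "inj_on (\<phi>(x := y)) (insert x V)" using a(3) im insert.hyps(2) by (simp only: inj_on_insert) simp
      moreover have "\<phi>(x := y) \<in> insert x V \<rightarrow>\<^sub>E {..<n}"
        using a by (intro PiE_fun_upd) (auto simp: I_def)
      ultimately show "\<phi>(x := y) \<in> I (insert x V)" by (simp add: I_def)
    qed
    show "finite (I (insert x V))" using fin insert.hyps by simp
  qed
  finally show ?case unfolding I_def .
qed simp

text \<open>By Bernoulli's inequality \<open>(1 - v / n) ^ v\<close> is at least 1 - v^2 / n, hence
  at least 1/2 under the assumption on \<open>n\<close>.\<close>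

lemma card_embeddings_ge:
  assumes "simple_graph H" "2 * (card (verts H))\<^sup>2 \<le> n"
  shows "real n ^ card (verts H) / 2 \<le> real (card (embeddings H n))"
proof -
  define v where "v = card (verts H)"
  have "v > 0" using simple_graphD(1,2)[OF assms(1)] unfolding v_def by (simp add: card_gt_0_iff)
  have "v \<le> v * v" by simp
  then have vn: "v \<le> n" "2 * (v * v) \<le> n" using assms(2) unfolding v_def power2_eq_square by linarith+
  have n0: "n > 0" using vn \<open>v > 0\<close> by linarith
  have "(n - v) ^ v \<le> card (embeddings H n)"
    using card_inj_PiE_ge[OF simple_graphD(1)[OF assms(1)], of v n] unfolding embeddings_def v_def by simp
  then have 1: "real (n - v) ^ v \<le> real (card (embeddings H n))"
    by (metis of_nat_le_iff of_nat_power)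
  have "1 + real v * (- (real v / real n)) \<le> (1 + - (real v / real n)) ^ v"
    using vn n0 by (intro Bernoulli_inequality) (auto simp: field_simps)
  moreover have "real v * (real v / real n) \<le> 1 / 2"
    using vn(2) n0 by (simp add: field_simps) (metis of_nat_le_iff of_nat_mult of_nat_numeral)
  ultimately have "1 / 2 \<le> (1 - real v / real n) ^ v" by simp
  then have "real n ^ v * (1 / 2) \<le> real n ^ v * (1 - real v / real n) ^ v" by (intro mult_left_mono) auto
  also have "\<dots> = real (n - v) ^ v"
    using vn n0 by (simp add: power_mult_distrib[symmetric] of_nat_diff field_simps)
  also have "\<dots> \<le> real (card (embeddings H n))" by (rule 1)
  finally show ?thesis unfolding v_def by simp
qed

text \<open>The relabelling \<open>t\<close>, which sends \<open>f x\<close> to \<open>g x\<close>,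
  carries embeddings onto \<open>W\<close> to embeddings onto \<open>W'\<close>. Since H has no
  isolated vertices, every embedding onto \<open>W\<close> has the same image as \<open>f\<close>,
  and there \<open>t\<close> is injective. By symmetry all copies have equal multiplicity.\<close>

lemma copies_multiplicity:
  assumes H: "simple_graph H" and V: "\<Union>(edges H) = verts H" and W: "W \<in> copies H n" "W' \<in> copies H n"
  shows "card {\<phi>\<in>embeddings H n. edge_image H \<phi> = W} \<le> card {\<phi>\<in>embeddings H n. edge_image H \<phi> = W'}"
proof -
  obtain f g where f: "f \<in> embeddings H n" "edge_image H f = W" and g: "g \<in> embeddings H n" "edge_image H g = W'"
    using W unfolding copies_def by auto
  have un: "\<Union>(edge_image H \<phi>) = \<phi> ` verts H" for \<phi>
    unfolding edge_image_def V[symmetric] by auto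
  define t where "t = (\<lambda>x. g (inv_into (verts H) f x))"
  have fi: "inj_on f (verts H)" and gi: "inj_on g (verts H)" using f g by (auto simp: embeddings_def)
  have tf: "t (f x) = g x" if "x \<in> verts H" for x
    unfolding t_def by (simp add: inv_into_f_f[OF fi that])
  have ti: "inj_on t (f ` verts H)"
    using gi by (auto simp: inj_on_def tf)
  define T where "T \<phi> = restrict (\<lambda>x. t (\<phi> x)) (verts H)" for \<phi>
  let ?A = "{\<phi>\<in>embeddings H n. edge_image H \<phi> = W}" and ?B = "{\<phi>\<in>embeddings H n. edge_image H \<phi> = W'}"
  have im: "\<phi> ` verts H = f ` verts H" if "\<phi> \<in> ?A" for \<phi>
    using that f(2) un[of \<phi>] un[of f] by auto
  have eT: "edge_image H (T \<phi>) = W'" if "edge_image H \<phi> = W" for \<phi>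
  proof -
    have sub: "e \<subseteq> verts H" if "e \<in> edges H" for e using simple_graphD(4)[OF H that] by simp
    have "edge_image H (T \<phi>) = (`) t ` edge_image H \<phi>"
      unfolding edge_image_def image_image
    proof (rule image_cong[OF refl])
      fix e assume "e \<in> edges H"
      from sub[OF this] show "T \<phi> ` e = (\<lambda>x. t (\<phi> x)) ` e"
        unfolding T_def by (intro image_cong) auto
    qed
    also have "\<dots> = (`) t ` edge_image H f" using that f(2) by simp
    also have "\<dots> = edge_image H g"
      unfolding edge_image_def image_image
    proof (rule image_cong[OF refl])
      fix e assume "e \<in> edges H"
      from sub[OF this] show "(\<lambda>x. t (f x)) ` e = g ` e"
        by (intro image_cong refl tf) auto
    qed
    finally show ?thesis using g by simp
  qed
  show ?thesis
  proof (rule card_inj_on_le)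
    show "inj_on T ?A"
    proof (rule inj_onI)
      fix \<phi> \<psi> assume a: "\<phi> \<in> ?A" "\<psi> \<in> ?A" and eq: "T \<phi> = T \<psi>"
      show "\<phi> = \<psi>"
      proof (rule extensionalityI)
        show "\<phi> \<in> extensional (verts H)" "\<psi> \<in> extensional (verts H)"
          using a by (auto simp: embeddings_def PiE_def)
        fix x assume x: "x \<in> verts H"
        have "t (\<phi> x) = t (\<psi> x)" using fun_cong[OF eq, of x] x by (simp add: T_def)
        moreover have "\<phi> x \<in> f ` verts H" "\<psi> x \<in> f ` verts H" using im a x by blast+
        ultimately show "\<phi> x = \<psi> x" using ti by (auto dest: inj_onD)
      qed
    qed
    show "T ` ?A \<subseteq> ?B"
    proof
      fix \<psi> assume "\<psi> \<in> T ` ?A"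
      then obtain \<phi> where \<phi>: "\<phi> \<in> ?A" "\<psi> = T \<phi>" by auto
      have phi: "inj_on \<phi> (verts H)" using \<phi> by (auto simp: embeddings_def)
      have "inj_on (t \<circ> \<phi>) (verts H)" using phi ti im[OF \<phi>(1)] by (intro comp_inj_on) auto
      then have "inj_on (T \<phi>) (verts H)" by (auto simp: T_def inj_on_def)
      moreover have "T \<phi> x < n" if "x \<in> verts H" for x
      proof -
        have "\<phi> x \<in> f ` verts H" using im[OF \<phi>(1)] that by blast
        then obtain y where "y \<in> verts H" "\<phi> x = f y" by auto
        then show ?thesis using g(1) that by (auto simp: T_def tf embeddings_def)
      qed
      ultimately have "T \<phi> \<in> embeddings H n"
        by (auto simp: embeddings_def T_def)
      then show "\<psi> \<in> ?B" using eT \<phi> by auto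
    qed
    show "finite ?B" using finite_embeddings[OF H] by simp
  qed
qed

text \<open>Passes from copies to labelled embeddings, which are easy to count. The factor is the
  number of automorphisms of H; it is never computed, because it cancels.\<close>

lemma sum_embeddings_eq:
  fixes h :: "nat set set \<Rightarrow> real"
  assumes H: "simple_graph H" and V: "\<Union>(edges H) = verts H" and "W \<in> copies H n"
  shows "(\<Sum>\<phi>\<in>embeddings H n. h (edge_image H \<phi>))
    = real (card {\<phi>\<in>embeddings H n. edge_image H \<phi> = W}) * (\<Sum>W'\<in>copies H n. h W')"
proof -
  have "(\<Sum>\<phi>\<in>embeddings H n. h (edge_image H \<phi>))
      = (\<Sum>W'\<in>copies H n. \<Sum>\<phi>\<in>{\<phi>\<in>embeddings H n. edge_image H \<phi> = W'}. h (edge_image H \<phi>))"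
    unfolding copies_def by (rule sum.image_gen[OF finite_embeddings[OF H]])
  also have "\<dots> = (\<Sum>W'\<in>copies H n. real (card {\<phi>\<in>embeddings H n. edge_image H \<phi> = W}) * h W')"
  proof (rule sum.cong[OF refl])
    fix W' assume "W' \<in> copies H n"
    then have "card {\<phi>\<in>embeddings H n. edge_image H \<phi> = W'} = card {\<phi>\<in>embeddings H n. edge_image H \<phi> = W}"
      using copies_multiplicity[OF H V] assms(3) by (simp add: order_antisym)
    then show "(\<Sum>\<phi>\<in>{\<phi>\<in>embeddings H n. edge_image H \<phi> = W'}. h (edge_image H \<phi>))
        = real (card {\<phi>\<in>embeddings H n. edge_image H \<phi> = W}) * h W'"
      by simp
  qed
  finally show ?thesis by (simp add: sum_distrib_left)
qed

text \<open>Group by the set \<open>A\<close> of vertices mapped into the overlap: at most 2^v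
  choices of \<open>A\<close>, at most v^v ways to map \<open>A\<close> into the vertices of
  \<open>W\<close>, and a factor n for each other vertex. The weight supplies the missing factors n
  for \<open>A\<close>.\<close>

lemma sum_overlap_embeddings_le:
  assumes H: "simple_graph H" and W: "W \<in> copies H n" and n: "n > 0"
  defines "v \<equiv> card (verts H)"
  shows "(\<Sum>\<phi>\<in>embeddings H n. n ^ card (\<Union>(edge_image H \<phi> \<inter> W))) \<le> n ^ v * (2 * v) ^ v"
proof -
  let ?V = "verts H"
  have fV: "finite ?V" "v > 0" using simple_graphD(1,2)[OF H] by (auto simp: v_def card_gt_0_iff)
  obtain f where f: "f \<in> embeddings H n" "edge_image H f = W" using W unfolding copies_def by auto
  have UW: "\<Union>W \<subseteq> f ` ?V" using f simple_graphD(4)[OF H] by (fastforce simp: edge_image_def)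
  then have UWn: "\<Union>W \<subseteq> {..<n}" using f(1) by (auto simp: embeddings_def)
  have finUW: "finite (\<Union>W)" using UWn finite_subset by blast
  have cUW: "card (\<Union>W) \<le> v"
    using UW fV unfolding v_def by (meson card_image_le card_mono finite_imageI order.trans)
  have 1: "n ^ card (\<Union>(edge_image H \<phi> \<inter> W)) \<le> (\<Sum>A\<in>Pow ?V. if \<phi> ` A \<subseteq> \<Union>W then n ^ card A else 0)"
    if \<phi>: "\<phi> \<in> embeddings H n" for \<phi>
  proof -
    let ?U = "\<Union>(edge_image H \<phi> \<inter> W)"
    define A where "A = {x\<in>?V. \<phi> x \<in> ?U}"
    have "?U \<subseteq> \<phi> ` ?V" using simple_graphD(4)[OF H] by (fastforce simp: edge_image_def)
    then have A: "\<phi> ` A = ?U" unfolding A_def by (intro equalityI subsetI) (blast | auto)+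
    have "inj_on \<phi> A" using \<phi> unfolding A_def embeddings_def by (auto intro: inj_on_subset)
    then have "card ?U = card A" using A card_image by metis
    moreover have "(if \<phi> ` A \<subseteq> \<Union>W then n ^ card A else 0) \<le> (\<Sum>A\<in>Pow ?V. if \<phi> ` A \<subseteq> \<Union>W then n ^ card A else 0)"
      using fV by (intro member_le_sum) (auto simp: A_def)
    moreover have "\<phi> ` A \<subseteq> \<Union>W" unfolding A by auto
    ultimately show ?thesis by simp
  qed
  have "(\<Sum>\<phi>\<in>embeddings H n. n ^ card (\<Union>(edge_image H \<phi> \<inter> W)))
      \<le> (\<Sum>\<phi>\<in>embeddings H n. \<Sum>A\<in>Pow ?V. if \<phi> ` A \<subseteq> \<Union>W then n ^ card A else 0)"
    by (intro sum_mono 1)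
  also have "\<dots> = (\<Sum>A\<in>Pow ?V. \<Sum>\<phi>\<in>embeddings H n. if \<phi> ` A \<subseteq> \<Union>W then n ^ card A else 0)"
    by (rule sum.swap)
  also have "\<dots> \<le> (\<Sum>A\<in>Pow ?V. n ^ v * v ^ v)"
  proof (rule sum_mono)
    fix A assume "A \<in> Pow ?V"
    then have A: "A \<subseteq> ?V" "card A \<le> v" using fV unfolding v_def by (auto intro: card_mono)
    have finA: "finite A" using A fV finite_subset by blast
    let ?P = "Pi\<^sub>E ?V (\<lambda>x. if x \<in> A then \<Union>W else {..<n})"
    have finP: "finite ?P" using fV finUW by (intro finite_PiE) auto
    have "(\<Sum>\<phi>\<in>embeddings H n. if \<phi> ` A \<subseteq> \<Union>W then n ^ card A else 0)
       = card {\<phi>\<in>embeddings H n. \<phi> ` A \<subseteq> \<Union>W} * n ^ card A"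
      using finite_embeddings[OF H] by (simp add: sum.If_cases Int_def)
    also have "\<dots> \<le> card ?P * n ^ card A"
    proof (intro mult_le_mono1 card_mono finP subsetI)
      fix \<phi> assume \<phi>: "\<phi> \<in> {\<phi>\<in>embeddings H n. \<phi> ` A \<subseteq> \<Union>W}"
      show "\<phi> \<in> ?P"
      proof (rule PiE_I)
        show "\<phi> x \<in> (if x \<in> A then \<Union>W else {..<n})" if "x \<in> ?V" for x
        proof (cases "x \<in> A")
          case True
          then have "\<phi> x \<in> \<phi> ` A" by (rule imageI)
          then show ?thesis using \<phi> True by (simp only: if_True) blast
        next
          case False
          then show ?thesis using that \<phi> by (auto simp: embeddings_def)
        qed
        show "\<phi> x = undefined" if "x \<notin> ?V" for x
          using that \<phi> by (auto simp: embeddings_def PiE_def extensional_def)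
      qed
    qed
    also have "card ?P = (\<Prod>x\<in>?V. if x \<in> A then card (\<Union>W) else n)"
      using fV by (subst card_PiE) (auto intro!: prod.cong)
    also have "\<dots> = card (\<Union>W) ^ card A * n ^ (v - card A)"
      using fV A finA by (simp add: prod.If_cases Int_absorb1 Diff_eq[symmetric] card_Diff_subset v_def)
    also have "card (\<Union>W) ^ card A * n ^ (v - card A) * n ^ card A = card (\<Union>W) ^ card A * n ^ v"
      using A by (simp add: mult.assoc flip: power_add)
    also have "\<dots> \<le> v ^ v * n ^ v"
      using cUW A fV by (intro mult_le_mono1 order.trans[OF power_mono power_increasing]) auto
    finally show "(\<Sum>\<phi>\<in>embeddings H n. if \<phi> ` A \<subseteq> \<Union>W then n ^ card A else 0) \<le> n ^ v * v ^ v"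
      by (simp add: mult.commute)
  qed
  also have "\<dots> = n ^ v * (2 * v) ^ v" using fV by (simp add: card_Pow power_mult_distrib v_def)
  finally show ?thesis .
qed

text \<open>\<open>n ^ v\<close> is at most twice the number of embeddings, which is
  \<open>a\<close> times the number of copies; the multiplicity \<open>a\<close> then
  cancels.\<close>

lemma sum_overlap_copies_le:
  assumes H: "simple_graph H" and V: "\<Union>(edges H) = verts H" and W: "W \<in> copies H n"
    and n: "2 * (card (verts H))\<^sup>2 \<le> n"
  defines "v \<equiv> card (verts H)"
  shows "(\<Sum>W'\<in>copies H n. real n ^ card (\<Union>(W' \<inter> W))) \<le> 2 * real ((2 * v) ^ v) * real (card (copies H n))"
proof -
  define a where "a = real (card {\<phi>\<in>embeddings H n. edge_image H \<phi> = W})"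
  have "v > 0" using simple_graphD(1,2)[OF H] by (simp add: v_def card_gt_0_iff)
  then have n0: "n > 0" using n unfolding v_def[symmetric] by (metis gr_zeroI le_zero_eq mult_eq_0_iff power_eq_0_iff zero_neq_numeral less_numeral_extra(3))
  have "a > 0" unfolding a_def using W finite_embeddings[OF H] by (auto simp: copies_def card_gt_0_iff)
  have "a * real (card (copies H n)) = real (card (embeddings H n))"
    using sum_embeddings_eq[OF H V W, of "\<lambda>_. 1"] unfolding a_def by simp
  then have nv: "real n ^ v \<le> 2 * a * real (card (copies H n))"
    using card_embeddings_ge[OF H n] unfolding v_def by simp
  have "a * (\<Sum>W'\<in>copies H n. real n ^ card (\<Union>(W' \<inter> W)))
      = real (\<Sum>\<phi>\<in>embeddings H n. n ^ card (\<Union>(edge_image H \<phi> \<inter> W)))"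
    using sum_embeddings_eq[OF H V W, of "\<lambda>W'. real n ^ card (\<Union>(W' \<inter> W))"] unfolding a_def by simp
  also have "\<dots> \<le> real (n ^ v * (2 * v) ^ v)"
    using sum_overlap_embeddings_le[OF H W n0] unfolding v_def by (simp only: of_nat_le_iff)
  also have "\<dots> = real n ^ v * real ((2 * v) ^ v)" by simp
  also have "\<dots> \<le> (2 * a * real (card (copies H n))) * real ((2 * v) ^ v)"
    by (intro mult_right_mono nv) simp
  finally have "a * (\<Sum>W'\<in>copies H n. real n ^ card (\<Union>(W' \<inter> W)))
      \<le> a * (2 * real ((2 * v) ^ v) * real (card (copies H n)))" by (simp only: mult_ac)
  then show ?thesis using \<open>a > 0\<close> by (simp only: mult_le_cancel_left_pos)
qed

section \<open>Strict balance and overlapping copies\<close>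

lemma strictly_balanced_density:
  assumes H: "simple_graph H" "strictly_balanced H" and F: "F \<subseteq> edges H" "F \<noteq> {}" and K: "(\<Union>F, F) \<noteq> H"
  shows "card F * card (verts H) < card (edges H) * card (\<Union>F)"
proof -
  have UF: "\<Union>F \<subseteq> verts H" "\<Union>F \<noteq> {}" using F simple_graphD(4)[OF H(1)] by fastforce+
  have sub: "subgraph (\<Union>F, F) H" by (rule simple_graph_subset[OF H(1) UF F(1)]) simp
  have "average_degree (\<Union>F, F) < average_degree H"
    using H(2) sub K unfolding strictly_balanced_def by blast
  moreover have "simple_graph (\<Union>F, F)" using sub by (simp add: subgraph_def)
  ultimately have "real (card F) / real (card (\<Union>F)) < real (card (edges H)) / real (card (verts H))"
    using average_degree_eq[of "(\<Union>F, F)"] average_degree_eq[OF H(1)] by simp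
  moreover have "card (\<Union>F) > 0" "card (verts H) > 0"
    using UF simple_graphD(1)[OF H(1)] by (auto simp: card_gt_0_iff intro: finite_subset)
  ultimately have "real (card F * card (verts H)) < real (card (edges H) * card (\<Union>F))"
    by (simp add: field_simps)
  then show ?thesis by (simp only: of_nat_less_iff)
qed

text \<open>Deleting isolated vertices would keep all edges and raise the average degree.\<close>

lemma strictly_balanced_no_isolated:
  assumes H: "simple_graph H" "strictly_balanced H" and "edges H \<noteq> {}"
  shows "\<Union>(edges H) = verts H"
proof (rule ccontr)
  assume a: "\<Union>(edges H) \<noteq> verts H"
  then have "(\<Union>(edges H), edges H) \<noteq> H" by (metis fst_conv)
  from strictly_balanced_density[OF H order.refl assms(3) this]
  have "card (verts H) < card (\<Union>(edges H))" by simp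
  moreover have "card (\<Union>(edges H)) \<le> card (verts H)"
    using simple_graphD[OF H(1)] by (intro card_mono) auto
  ultimately show False by simp
qed

text \<open>The overlap is pulled back along an embedding onto \<open>W\<close> to an edge set
  \<open>F\<close> of H. It is a proper subset because copies have equal size, so containment of one
  in the other would make them equal.\<close>

lemma strictly_balanced_overlap:
  assumes H: "simple_graph H" "strictly_balanced H" and W: "W \<in> copies H n" "W' \<in> copies H n"
    and "W' \<noteq> W" "W' \<inter> W \<noteq> {}"
  shows "card (W' \<inter> W) * card (verts H) < card (edges H) * card (\<Union>(W' \<inter> W))" "card (W' \<inter> W) < card (edges H)"
proof -
  obtain f where f: "f \<in> embeddings H n" "edge_image H f = W" using W unfolding copies_def by auto
  define F where "F = {e\<in>edges H. f ` e \<in> W'}"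
  have F: "F \<subseteq> edges H" unfolding F_def by auto
  have im: "(`) f ` F = W' \<inter> W" using f(2) unfolding F_def edge_image_def by auto
  have c: "card (W' \<inter> W) = card F"
    unfolding im[symmetric] by (rule card_image) (rule inj_on_subset[OF inj_on_edge_image[OF H(1) f(1)] F])
  have UF: "\<Union>F \<subseteq> verts H" using F simple_graphD(4)[OF H(1)] by fastforce
  have "inj_on f (\<Union>F)" using f(1) UF by (auto simp: embeddings_def intro: inj_on_subset)
  moreover have "\<Union>(W' \<inter> W) = f ` \<Union>F" unfolding im[symmetric] by auto
  ultimately have cU: "card (\<Union>(W' \<inter> W)) = card (\<Union>F)" by (simp add: card_image)
  have "F \<noteq> edges H"
  proof
    assume "F = edges H"
    then have "W \<subseteq> W'" using im f(2) unfolding edge_image_def by auto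
    moreover have "card W = card W'"
      using W card_edge_image[OF H(1)] unfolding copies_def by auto
    moreover have "finite W'" using W(2) simple_graphD(3)[OF H(1)] by (auto simp: copies_def edge_image_def)
    ultimately show False using \<open>W' \<noteq> W\<close> card_subset_eq by metis
  qed
  then show "card (W' \<inter> W) < card (edges H)"
    unfolding c using F simple_graphD(3)[OF H(1)] by (intro psubset_card_mono) auto
  have "(\<Union>F, F) \<noteq> H" using \<open>F \<noteq> edges H\<close> by auto
  moreover have "F \<noteq> {}" using im \<open>W' \<inter> W \<noteq> {}\<close> by auto
  ultimately show "card (W' \<inter> W) * card (verts H) < card (edges H) * card (\<Union>(W' \<inter> W))"
    unfolding c cU using strictly_balanced_density[OF H F] by blast
qed

text \<open>Every set of v vertices carries a copy, so there are at least n choose v of them. The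
  crude bound suffices for its purpose, excluding p > 1/2.\<close>

lemma card_copies_ge:
  assumes H: "simple_graph H" and V: "\<Union>(edges H) = verts H" and n: "card (verts H) \<le> n"
  shows "real n / real (card (verts H)) \<le> real (card (copies H n))"
proof -
  define v where "v = card (verts H)"
  have v: "0 < v" "finite (verts H)" using simple_graphD(1,2)[OF H] by (auto simp: v_def card_gt_0_iff)
  have "{S. S \<subseteq> {..<n} \<and> card S = v} \<subseteq> Union ` copies H n"
  proof
    fix S assume "S \<in> {S. S \<subseteq> {..<n} \<and> card S = v}"
    then have S: "S \<subseteq> {..<n}" "card S = card (verts H)" "finite S" by (auto simp: v_def intro: finite_subset)
    then obtain f where f: "bij_betw f (verts H) S" using finite_same_card_bij[OF v(2) S(3)] by auto
    let ?f = "restrict f (verts H)"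
    have b: "bij_betw ?f (verts H) S" by (rule bij_betw_cong[THEN iffD1, OF _ f]) simp
    have "?f \<in> verts H \<rightarrow>\<^sub>E {..<n}"
      using bij_betw_apply[OF f] S(1) by (intro restrict_PiE[THEN iffD2]) blast
    then have "?f \<in> embeddings H n" using bij_betw_imp_inj_on[OF b] by (simp add: embeddings_def)
    moreover have "\<Union>(edge_image H ?f) = ?f ` verts H" unfolding edge_image_def V[symmetric] by auto
    ultimately show "S \<in> Union ` copies H n" using b by (auto simp: copies_def bij_betw_def image_iff)
  qed
  moreover have fc: "finite (copies H n)" unfolding copies_def using finite_embeddings[OF H] by simp
  ultimately have "card {S. S \<subseteq> {..<n} \<and> card S = v} \<le> card (copies H n)"
    by (meson card_image_le card_mono finite_imageI order.trans)
  then have "n choose v \<le> card (copies H n)" using n_subsets[of "{..<n}" v] by simp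
  moreover have "(real n / real v) ^ v \<le> real (n choose v)"
    using binomial_ge_n_over_k_pow_k[of v n, where 'a=real] n v_def by simp
  moreover have "real n / real v \<le> (real n / real v) ^ v"
    using n v power_increasing[of 1 v "real n / real v"] by (simp add: v_def)
  ultimately show ?thesis unfolding v_def by (meson of_nat_le_iff order.trans)
qed

lemma card_copies_le:
  assumes H: "simple_graph H"
  shows "card (copies H n) \<le> n ^ card (verts H)"
proof -
  have "card (copies H n) \<le> card (embeddings H n)"
    unfolding copies_def by (rule card_image_le[OF finite_embeddings[OF H]])
  also have "\<dots> \<le> card (verts H \<rightarrow>\<^sub>E {..<n})"
    unfolding embeddings_def using simple_graphD(1)[OF H] by (intro card_mono finite_PiE) auto
  also have "\<dots> = n ^ card (verts H)" using simple_graphD(1)[OF H] by (simp add: card_PiE)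
  finally show ?thesis .
qed

section \<open>Short strictly balanced graphs\<close>

text \<open>With \<open>N\<close> copies, \<open>N * \<Delta> W\<close> is compared with the sum of
  n^s over all copies, s being the number of vertices in the overlap; that sum again carries a
  factor \<open>N\<close>, which cancels. The maximum with 1 is there because the mean may be below
  1.\<close>

lemma Delta_copies_le:
  assumes H: "simple_graph H" "strictly_balanced H" and E: "edges H \<noteq> {}" and p: "0 \<le> p" "p \<le> 1"
    and n: "2 * (card (verts H))\<^sup>2 \<le> n" and W: "W \<in> copies H n"
  defines "l \<equiv> card (edges H)" and "v \<equiv> card (verts H)"
  shows "uniform_family.\<Delta> (copies H n) p W
    \<le> max (real (card (copies H n)) * p ^ l) 1 * (2 * real ((2 * v) ^ v) * n powr (- 1 / l))"
proof -
  interpret uniform_family "potential_edges n" "copies H n" l p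
    unfolding l_def by (rule uniform_family_copies[OF H(1) p])
  define N where "N = real (card (copies H n))"
  define M where "M = max (N * p ^ l) 1"
  define x where "x = n powr (- 1 / l)"
  note V = strictly_balanced_no_isolated[OF H E]
  have l: "l > 0" using E simple_graphD(3)[OF H(1)] by (simp add: l_def card_gt_0_iff)
  have v: "v > 0" using simple_graphD(1,2)[OF H(1)] by (simp add: v_def card_gt_0_iff)
  have n0: "n > 0" using n v unfolding v_def[symmetric] by (cases "n = 0") auto
  have N: "N > 0" using W finite_family by (auto simp: N_def card_gt_0_iff)
  have M: "M \<ge> 1" "N * p ^ l \<le> M" unfolding M_def by auto
  have x0: "x > 0" using n0 by (simp add: x_def)
  have "x ^ l = n powr (- 1 / l * l)" using x0 by (simp add: x_def powr_powr flip: powr_realpow)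
  then have x: "x > 0" "x ^ l = 1 / n" using n0 l x0 by (simp_all add: powr_minus_divide)
  have 1: "N * p ^ card (W' - W) \<le> M * x * real n ^ card (\<Union>(W' \<inter> W))"
    if W': "W' \<in> copies H n" "W' \<noteq> W" "W' \<inter> W \<noteq> {}" for W'
  proof -
    define f where "f = card (W' \<inter> W)"
    define s where "s = card (\<Union>(W' \<inter> W))"
    have "f * v < l * s" "f < l"
      using strictly_balanced_overlap[OF H W W'] unfolding f_def s_def l_def v_def by auto
    moreover from this have fs1: "l * s \<ge> 1" by linarith
    ultimately have fs: "v * f \<le> l * s - 1" "l * s \<ge> 1" by (simp_all add: mult.commute)
    have finW: "finite W'" using family[OF W'(1)] finite_ground finite_subset by blast
    have d: "card (W' - W) = l - f"
      using card_Diff_subset_Int[of W' W] finW card_member[OF W'(1)] by (simp add: f_def)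
    \<comment> \<open>Taking l-th powers lets \<open>p\<close> enter only through the mean
      \<open>N * p ^ l\<close>; what remains is \<open>N ^ f\<close>, for which
      \<open>N \<le> n ^ v\<close> and strict balance suffice.\<close>
    have "(N * p ^ (l - f)) ^ l = N ^ (l - f) * N ^ f * (p ^ l) ^ (l - f)"
      using \<open>f < l\<close> by (simp add: power_mult_distrib mult.commute flip: power_add power_mult)
    also have "\<dots> = (N * p ^ l) ^ (l - f) * N ^ f" by (simp add: power_mult_distrib)
    also have "\<dots> \<le> M ^ (l - f) * (real n ^ v) ^ f"
    proof (intro mult_mono power_mono)
      show "N \<le> real n ^ v"
        using card_copies_le[OF H(1), of n] unfolding N_def v_def by (metis of_nat_le_iff of_nat_power)
    qed (use M N p in auto)
    also have "\<dots> \<le> M ^ l * real n ^ (l * s - 1)"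
      unfolding power_mult[symmetric] using M n0 fs by (intro mult_mono power_increasing) auto
    also have "\<dots> = (M * x * real n ^ s) ^ l"
      unfolding power_mult_distrib x(2) using fs n0
      by (simp add: power_mult[symmetric] power_diff mult.commute[of s l])
    finally have "N * p ^ (l - f) \<le> M * x * real n ^ s"
      by (rule power_le_imp_le_base[of _ "l - 1" _, simplified Suc_diff_1[OF l]])
         (use M x in auto)
    then show ?thesis unfolding d s_def .
  qed
  have "N * \<Delta> W = (\<Sum>W'\<in>{W'\<in>copies H n. W' \<noteq> W \<and> W' \<inter> W \<noteq> {}}. N * p ^ card (W' - W))"
    unfolding \<Delta>_def by (simp add: sum_distrib_left)
  also have "\<dots> \<le> (\<Sum>W'\<in>{W'\<in>copies H n. W' \<noteq> W \<and> W' \<inter> W \<noteq> {}}. M * x * real n ^ card (\<Union>(W' \<inter> W)))"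
    by (intro sum_mono 1) auto
  also have "\<dots> \<le> (\<Sum>W'\<in>copies H n. M * x * real n ^ card (\<Union>(W' \<inter> W)))"
    using M x finite_family by (intro sum_mono2) auto
  also have "\<dots> \<le> M * x * (2 * real ((2 * v) ^ v) * N)"
    unfolding sum_distrib_left[symmetric] N_def v_def
    using M x by (intro mult_left_mono sum_overlap_copies_le[OF H(1) V W n]) auto
  finally have "N * \<Delta> W \<le> N * (M * (2 * real ((2 * v) ^ v) * x))" by (simp only: mult_ac)
  then show ?thesis using N unfolding N_def[symmetric] M_def[symmetric] x_def[symmetric]
    by (simp only: mult_le_cancel_left_pos)
qed

lemma card_Union_edges_le:
  assumes "simple_graph H"
  shows "card (\<Union>(edges H)) \<le> 2 * card (edges H)"
proof -
  have "card (\<Union>(edges H)) \<le> (\<Sum>e\<in>edges H. card e)"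
    by (rule card_Union_le_sum_card)
  also have "\<dots> = (\<Sum>e\<in>edges H. 2)" using simple_graphD(4)[OF assms] by (intro sum.cong) auto
  finally show ?thesis by simp
qed

text \<open>The upper limit on \<open>l\<close> enters here. From \<open>v \<le> 2 * l\<close> the
  first factor is at most \<open>(16 * l^2) ^ l\<close>, and \<open>L\<close> makes the power of n
  at most \<open>(1 / ln n) ^ l\<close>. Since 16 l^2 / ln n is at most 16 / ln (ln n), the constant
  32 gives the ratio 1/2.\<close>

lemma overlap_factor_le:
  fixes l v n :: nat
  assumes l: "l \<ge> 1" and v: "v \<le> 2 * l" "v \<ge> 1" and n: "n \<ge> 1"
    and L: "real l ^ 2 * ln (ln n) \<le> ln n" and LL: "32 \<le> ln (ln n)" and L0: "ln n > 0"
  shows "2 * real ((2 * v) ^ v) * n powr (- 1 / l) \<le> 2 * (1 / 2) ^ l"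
proof -
  define L where "L = ln (real n)"
  have L': "L > 0" "real l ^ 2 * ln L \<le> L" "32 \<le> ln L" using assms by (auto simp: L_def)
  have "2 * real v \<le> 4 * real l" using v by simp
  then have "real ((2 * v) ^ v) \<le> (4 * real l) ^ v" unfolding of_nat_power by (intro power_mono) auto
  also have "\<dots> \<le> (4 * real l) ^ (2 * l)" using l v by (intro power_increasing) auto
  also have "\<dots> = (16 * real l ^ 2) ^ l" by (simp add: power_mult power_mult_distrib)
  finally have 1: "real ((2 * v) ^ v) \<le> (16 * real l ^ 2) ^ l" .
  have "real l * ln L \<le> L / real l" using L'(2) l by (simp add: field_simps power2_eq_square)
  then have "n powr (- 1 / l) \<le> exp (- (real l * ln L))"
    using n by (simp add: powr_def L_def)
  also have "\<dots> = (1 / L) ^ l"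
    using L' exp_of_nat_mult[of l "- ln L"] by (simp add: exp_minus field_simps)
  finally have 2: "n powr (- 1 / l) \<le> (1 / L) ^ l" .
  have "real l ^ 2 * 32 \<le> real l ^ 2 * ln L" using L' by (intro mult_left_mono) auto
  then have 3: "16 * real l ^ 2 * (1 / L) \<le> 1 / 2" using L' by (simp add: field_simps)
  have "real ((2 * v) ^ v) * n powr (- 1 / l) \<le> (16 * real l ^ 2) ^ l * (1 / L) ^ l"
    by (intro mult_mono 1 2) auto
  also have "\<dots> = (16 * real l ^ 2 * (1 / L)) ^ l" by (simp only: power_mult_distrib)
  also have "\<dots> \<le> (1 / 2) ^ l" using 3 L' by (intro power_mono) auto
  finally show ?thesis by simp
qed

text \<open>For the mean m, nondegeneracy and the second moment give c m \<le> 1 + max m 1 * (c /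
  2), where the last term is the correlation term, small by \<open>big(2)\<close>. Absorbing it
  yields m \<le> 2 / c, and this bound turns the estimate of \<open>\<Delta>\<close> into one free
  of m.\<close>

lemma copies_Delta_bound:
  fixes H :: "'b ugraph" and n :: nat
  assumes H: "simple_graph H" "strictly_balanced H" and p: "0 \<le> p" "p \<le> 1"
  defines "l \<equiv> card (edges H)"
  assumes l: "l \<ge> 1" and L: "real l ^ 2 * ln (ln n) \<le> ln n" and LL: "32 \<le> ln (ln n)" and L0: "ln n > 0"
    and c: "0 < c" "c \<le> ev (potential_edges n) p (\<lambda>w. of_bool (covered (copies H n) w))"
      "ev (potential_edges n) p (\<lambda>w. of_bool (covered (copies H n) w)) \<le> 1 - c"
    and big: "2 / c < 2 ^ l" "4 * (1 / 2) ^ l \<le> c"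
  shows "p \<le> 1 / 2" "\<And>W. W \<in> copies H n \<Longrightarrow> uniform_family.\<Delta> (copies H n) p W \<le> 4 / c * (1 / 2) ^ l"
proof -
  interpret uniform_family "potential_edges n" "copies H n" l p
    unfolding l_def by (rule uniform_family_copies[OF H(1) p])
  define v where "v = card (verts H)"
  define m where "m = real (card (copies H n)) * p ^ l"
  define P where "P = ev (potential_edges n) p (\<lambda>w. of_bool (covered (copies H n) w))"
  have E: "edges H \<noteq> {}" using l by (auto simp: l_def)
  note V = strictly_balanced_no_isolated[OF H E]
  have v: "v \<ge> 1" using simple_graphD(1,2)[OF H(1)] by (simp add: v_def Suc_le_eq card_gt_0_iff)
  have v2: "v \<le> 2 * l" using card_Union_edges_le[OF H(1)] unfolding V l_def v_def .
  have n: "n \<ge> 1" using L0 by (cases n) auto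
  have nexp: "real n = exp (ln n)" using n by simp
  have "real l ^ 2 * 32 \<le> real l ^ 2 * ln (ln n)" using LL by (intro mult_left_mono) auto
  then have l32: "32 * real l ^ 2 \<le> ln n" using L by simp
  have "ln n \<le> real n" using ln_le_minus_one[of "real n"] n by simp
  then have "32 * real l ^ 2 \<le> real n" using l32 by simp
  moreover have "real v ^ 2 \<le> (2 * real l) ^ 2" using v2 by (intro power_mono) auto
  ultimately have "real (2 * v ^ 2) \<le> real n" by (simp add: power_mult_distrib)
  then have nv: "2 * (card (verts H))\<^sup>2 \<le> n" unfolding v_def by (simp only: of_nat_le_iff)
  have R: "\<Delta> W \<le> max m 1 * (2 * (1 / 2) ^ l)" if W: "W \<in> copies H n" for W
  proof -
    have "\<Delta> W \<le> max m 1 * (2 * real ((2 * v) ^ v) * n powr (- 1 / l))"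
      unfolding m_def v_def l_def by (rule Delta_copies_le[OF H E p nv W])
    also have "\<dots> \<le> max m 1 * (2 * (1 / 2) ^ l)"
      by (intro mult_left_mono overlap_factor_le[OF l v2 v n L LL L0]) auto
    finally show ?thesis .
  qed
  have "c \<le> m" using c(2) covered_prob_le unfolding m_def by linarith
  then have "m > 0" using c by simp
  have "(1 - P) * m \<le> 1 + max m 1 * (2 * (1 / 2) ^ l)"
    using uncovered_prob_le[OF _ R] \<open>m > 0\<close> unfolding m_def P_def by simp
  moreover have "c * m \<le> (1 - P) * m" using c(3) \<open>m > 0\<close> unfolding P_def by (intro mult_right_mono) auto
  moreover have "max m 1 * (2 * (1 / 2) ^ l) \<le> max m 1 * (c / 2)" using big(2) by (intro mult_left_mono) auto
  ultimately have cm: "c * m \<le> 1 + max m 1 * (c / 2)" by linarith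
  have c2: "c \<le> 1 / 2" using c by linarith
  have m: "max m 1 \<le> 2 / c"
  proof (cases "m \<ge> 1")
    case True
    then have "max m 1 = m" by simp
    then have "c * m \<le> 1 + m * (c / 2)" using cm by simp
    then have "m * c \<le> 2" by (simp add: algebra_simps)
    then show ?thesis using True c(1) c2 by (simp add: field_simps)
  qed (use c(1) c2 in \<open>auto simp: field_simps\<close>)
  show "\<Delta> W \<le> 4 / c * (1 / 2) ^ l" if "W \<in> copies H n" for W
  proof -
    have "max m 1 * (2 * (1 / 2) ^ l) \<le> 2 / c * (2 * (1 / 2) ^ l)" using m by (intro mult_right_mono) auto
    then show ?thesis using R[OF that] by simp
  qed
  show "p \<le> 1 / 2"
  proof (rule ccontr)
    \<comment> \<open>Then m would be at least n / (v 2^l), so m \<le> 2 / c < 2^l would force n < v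
      4^l. But n is at least exp (32 l), as 32 l^2 \<le> ln n.\<close>
    assume "\<not> p \<le> 1 / 2"
    then have "(1 / 2) ^ l \<le> p ^ l" by (intro power_mono) auto
    moreover have "card (verts H) \<le> n"
    proof -
      have "v \<le> 2 * v\<^sup>2" by (simp add: power2_eq_square)
      then show ?thesis using nv unfolding v_def by linarith
    qed
    from card_copies_ge[OF H(1) V this] have "real n / real v \<le> real (card (copies H n))" unfolding v_def .
    ultimately have "real n / real v * (1 / 2) ^ l \<le> m" unfolding m_def using p by (intro mult_mono) auto
    also have "\<dots> \<le> 2 / c" using m by simp
    also have "\<dots> < 2 ^ l" by (rule big)
    finally have "real n < real v * 4 ^ l"
      using v by (simp add: field_simps flip: power_mult_distrib)
    also have "\<dots> \<le> 2 * 2 ^ l * 4 ^ l"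
    proof (intro mult_right_mono)
      have "real l \<le> 2 ^ l" using of_nat_less_two_power[of l, where 'a=real] by linarith
      then show "real v \<le> 2 * 2 ^ l" using v2 by linarith
    qed auto
    also have "\<dots> \<le> (2::real) ^ l * 2 ^ l * 4 ^ l" using l power_increasing[of 1 l "2::real"] by (intro mult_right_mono) auto
    also have "\<dots> = 16 ^ l" by (simp flip: power_mult_distrib)
    also have "\<dots> \<le> exp 32 ^ l"
      using exp_ge_add_one_self[of "32::real"] by (intro power_mono) auto
    also have "\<dots> = exp (32 * real l)" by (simp flip: exp_of_nat_mult add: mult.commute)
    also have "\<dots> \<le> exp (ln n)"
    proof -
      have "real l \<le> real l ^ 2" using l by (simp add: power2_eq_square)
      then have "32 * real l \<le> ln n" using l32 by linarith
      then show ?thesis by simp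
    qed
    finally show False using nexp by simp
  qed
qed

text \<open>The configuration in which exactly \<open>W\<close> is open contains a copy inside
  \<open>W\<close>; that copy already forces the event, so by minimality it is \<open>W\<close>.
  Bounds uniform over copies thus bound the maximum over witnesses.\<close>

lemma one_witness_in_copies:
  assumes "simple_graph (H n)" "W \<in> one_witnesses (potential_edges n) (copy_indicator H n)"
  shows "W \<in> copies (H n) n"
proof -
  have W: "W \<subseteq> potential_edges n" "forces_one (potential_edges n) (copy_indicator H n) W"
    "\<And>W'. W' \<subset> W \<Longrightarrow> \<not> forces_one (potential_edges n) (copy_indicator H n) W'"
    using assms(2) unfolding one_witnesses_def by auto
  have "(\<lambda>e. e \<in> W) \<in> configs (potential_edges n)"
    using W(1) by (auto simp: configs_def PiE_dflt_def)
  then have "copy_indicator H n (\<lambda>e. e \<in> W)" using W(2) unfolding forces_one_def by auto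
  then obtain W' where W': "W' \<in> copies (H n) n" "W' \<subseteq> W"
    by (auto simp: copy_indicator_iff_covered[of H n, OF assms(1)] covered_def)
  have "forces_one (potential_edges n) (copy_indicator H n) W'"
    using W'(1) by (auto simp: forces_one_def copy_indicator_iff_covered[of H n, OF assms(1)] covered_def)
  then have "W' = W" using W(3) W'(2) by auto
  then show ?thesis using W'(1) by simp
qed

text \<open>Needed to attain the \<open>Max\<close> in the definition of strong noise
  sensitivity.\<close>

lemma one_witnesses_nonempty:
  assumes "simple_graph (H n)" "copies (H n) n \<noteq> {}"
  shows "one_witnesses (potential_edges n) (copy_indicator H n) \<noteq> {}"
proof -
  let ?F = "{W. W \<subseteq> potential_edges n \<and> forces_one (potential_edges n) (copy_indicator H n) W}"
  obtain W where W: "W \<in> copies (H n) n" using assms(2) by auto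
  then have "W \<in> ?F"
    using edge_image_subset[OF assms(1)]
    by (auto simp: copies_def forces_one_def copy_indicator_iff_covered[of H n, OF assms(1)] covered_def)
  moreover have "finite ?F" using finite_potential_edges by auto
  ultimately obtain M where M: "M \<in> ?F" "\<And>W'. W' \<in> ?F \<Longrightarrow> W' \<subseteq> M \<Longrightarrow> M = W'"
    using finite_has_minimal[of ?F] by auto
  then have "M \<in> one_witnesses (potential_edges n) (copy_indicator H n)"
    unfolding one_witnesses_def by blast
  then show ?thesis by auto
qed

lemma filterlim_at_top_of_one_smallo:
  assumes "(\<lambda>_. 1) \<in> o(\<lambda>n. real (l n))"
  shows "filterlim l at_top sequentially"
  unfolding filterlim_at_top
proof
  fix B :: nat
  have "\<forall>\<^sub>F n in sequentially. norm (1::real) \<le> 1 / (real B + 1) * norm (real (l n))"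
    by (rule landau_o.smallD[OF assms]) simp
  then show "\<forall>\<^sub>F n in sequentially. B \<le> l n"
  proof eventually_elim
    case (elim n)
    then have "real B + 1 \<le> real (l n)" by (simp add: field_simps)
    then show ?case by linarith
  qed
qed

text \<open>Harris' inequality makes both differences nonnegative. From above both are at most
  \<open>(1 - \<epsilon> / 2) ^ l + 4 / c * (1 / 2) ^ l\<close>, which depends on n only through the
  number of edges and vanishes as that number grows.\<close>

theorem strictly_balanced_noise_sensitive:
  fixes H :: "nat \<Rightarrow> 'b ugraph" and p :: "nat \<Rightarrow> real"
  assumes H: "\<And>n. simple_graph (H n)" "\<And>n. strictly_balanced (H n)" and p: "\<And>n. 0 \<le> p n \<and> p n \<le> 1"
    and nd: "nondegenerate potential_edges p (copy_indicator H)"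
    and lo: "(\<lambda>_. 1) \<in> o(\<lambda>n. real (card (edges (H n))))"
    and hi: "\<forall>\<^sub>F n in sequentially.
           real (card (edges (H n))) \<le> (ln (real n) / ln (ln (real n))) powr (1/2)"
  shows "noise_sensitive potential_edges p (copy_indicator H)"
    and "one_strongly_noise_sensitive potential_edges p (copy_indicator H)"
proof -
  define l where "l n = card (edges (H n))" for n
  define P where "P n = ev (potential_edges n) (p n) (\<lambda>w. of_bool (covered (copies (H n) n) w))" for n
  have prob: "\<P>(\<omega> in measure_pmf (bernoulli_product (potential_edges n) (p n)). copy_indicator H n \<omega>) = P n" for n
    unfolding P_def copy_indicator_iff_covered[OF H(1)] by (rule prob_eq_ev)
  obtain c where c: "c > 0" "\<forall>\<^sub>F n in sequentially. c \<le> P n \<and> P n \<le> 1 - c"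
    using nd unfolding nondegenerate_def prob by auto
  have linf: "filterlim l at_top sequentially"
    unfolding l_def by (rule filterlim_at_top_of_one_smallo[OF lo])
  have lge: "\<forall>\<^sub>F n in sequentially. B \<le> l n" for B
    using linf by (simp add: filterlim_at_top)
  have geom: "(\<lambda>n. r ^ l n) \<longlonglongrightarrow> 0" if "0 \<le> r" "r < 1" for r :: real
    by (rule filterlim_compose[OF LIMSEQ_power_zero linf]) (use that in simp)
  have LL: "\<forall>\<^sub>F n in sequentially. 32 \<le> ln (ln (real n))" "\<forall>\<^sub>F n in sequentially. 0 < ln (real n)"
    by real_asymp+
  have b1: "\<forall>\<^sub>F n in sequentially. 4 * (1 / 2) ^ l n < c"
    using c(1) by (intro order_tendstoD(2)[OF tendsto_mult_right_zero[OF geom]]) auto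
  then have b2: "\<forall>\<^sub>F n in sequentially. 2 / c < 2 ^ l n"
  proof eventually_elim
    case (elim n)
    then have "4 < c * 2 ^ l n" by (simp add: field_simps)
    then show ?case using c(1) by (simp add: field_simps)
  qed
  have good: "\<forall>\<^sub>F n in sequentially. c \<le> P n \<and> p n \<le> 1 / 2 \<and>
      (\<forall>W\<in>copies (H n) n. uniform_family.\<Delta> (copies (H n) n) (p n) W \<le> 4 / c * (1 / 2) ^ l n)"
    using c(2) LL lge[of 1] b1 b2 hi
  proof eventually_elim
    case (elim n)
    have 1: "real (l n) ^ 2 * ln (ln n) \<le> ln n"
    proof -
      have q0: "0 \<le> ln n / ln (ln n)" using elim by (intro divide_nonneg_nonneg) linarith+
      then have "real (l n) \<le> sqrt (ln n / ln (ln n))" using elim by (simp add: powr_half_sqrt l_def)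
      then have "real (l n) ^ 2 \<le> sqrt (ln n / ln (ln n)) ^ 2" by (intro power_mono) auto
      also have "\<dots> = ln n / ln (ln n)" using q0 by (rule real_sqrt_pow2)
      finally show ?thesis using elim pos_le_divide_eq[of "ln (ln n)" "real (l n) ^ 2" "ln n"] by linarith
    qed
    show ?case
      using copies_Delta_bound[OF H(1,2), of "p n" n n c] p[of n] elim 1 c(1)
      unfolding P_def l_def by auto
  qed
  have main: "\<forall>\<^sub>F n in sequentially. c \<le> P n \<and>
      P n * P n \<le> nev (potential_edges n) (p n) \<epsilon> (\<lambda>a b. of_bool (covered (copies (H n) n) a) * of_bool (covered (copies (H n) n) b)) \<and>
      nev (potential_edges n) (p n) \<epsilon> (\<lambda>a b. of_bool (covered (copies (H n) n) a) * of_bool (covered (copies (H n) n) b))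
        \<le> P n * (P n + ((1 - \<epsilon> / 2) ^ l n + 4 / c * (1 / 2) ^ l n)) \<and>
      (\<forall>W\<in>copies (H n) n. 0 < p n ^ l n \<and> nev (potential_edges n) (p n) \<epsilon> (\<lambda>a b. of_bool (\<forall>e\<in>W. a e)) = p n ^ l n \<and>
        p n ^ l n * P n \<le> nev (potential_edges n) (p n) \<epsilon> (\<lambda>a b. of_bool (\<forall>e\<in>W. a e) * of_bool (covered (copies (H n) n) b)) \<and>
        nev (potential_edges n) (p n) \<epsilon> (\<lambda>a b. of_bool (\<forall>e\<in>W. a e) * of_bool (covered (copies (H n) n) b))
          \<le> p n ^ l n * (P n + ((1 - \<epsilon> / 2) ^ l n + 4 / c * (1 / 2) ^ l n)))"
    if eps: "0 < \<epsilon>" "\<epsilon> < 1" for \<epsilon>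
    using good
  proof eventually_elim
    case (elim n)
    interpret uniform_family "potential_edges n" "copies (H n) n" "l n" "p n"
      unfolding l_def using p by (intro uniform_family_copies H) auto
    have e: "0 \<le> \<epsilon>" "\<epsilon> \<le> 1" using eps by auto
    have P0: "0 < P n" using elim c by auto
    \<comment> \<open>As \<open>p n \<le> 1 / 2\<close>, a resampled edge is closed with probability
      at least 1/2, so an open edge survives with probability at most
      \<open>1 - \<epsilon> / 2\<close>.\<close>
    have "\<epsilon> * p n \<le> \<epsilon> * (1 / 2)" using elim eps by (intro mult_left_mono) auto
    moreover have "0 \<le> \<epsilon> * p n" using eps p_ge by simp
    ultimately have q: "(1 - \<epsilon> + \<epsilon> * p n) ^ l n \<le> (1 - \<epsilon> / 2) ^ l n"
      using eps by (intro power_mono) linarith+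
    have u1: "nev (potential_edges n) (p n) \<epsilon> (\<lambda>a b. of_bool (covered (copies (H n) n) a) * of_bool (covered (copies (H n) n) b))
      \<le> P n * ((1 - \<epsilon> + \<epsilon> * p n) ^ l n + P n + 4 / c * (1 / 2) ^ l n)"
      unfolding P_def using elim by (intro nev_covered_le e) auto
    have u2: "nev (potential_edges n) (p n) \<epsilon> (\<lambda>a b. of_bool (\<forall>e\<in>W. a e) * of_bool (covered (copies (H n) n) b))
          \<le> p n ^ l n * ((1 - \<epsilon> + \<epsilon> * p n) ^ l n + P n + \<Delta> W)" if "W \<in> copies (H n) n" for W
      unfolding P_def by (rule nev_one_witness_le[OF that e])
    \<comment> \<open>The first moment bound makes the conditioning event "W is open" have positive
      probability.\<close>
    have "0 < real (card (copies (H n) n)) * p n ^ l n" using P0 covered_prob_le unfolding P_def by linarith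
    then have p0: "0 < p n ^ l n" by (simp add: zero_less_mult_iff)
    show ?case
    proof (intro conjI ballI)
      show "c \<le> P n" using elim by simp
      show "P n * P n \<le> nev (potential_edges n) (p n) \<epsilon> (\<lambda>a b. of_bool (covered (copies (H n) n) a) * of_bool (covered (copies (H n) n) b))"
        unfolding P_def by (rule nev_harris[OF finite_ground p_ge p_le e mono_covered mono_covered])
      show "nev (potential_edges n) (p n) \<epsilon> (\<lambda>a b. of_bool (covered (copies (H n) n) a) * of_bool (covered (copies (H n) n) b))
        \<le> P n * (P n + ((1 - \<epsilon> / 2) ^ l n + 4 / c * (1 / 2) ^ l n))"
        by (rule order.trans[OF u1]) (use q P0 in \<open>auto intro!: mult_left_mono\<close>)
      fix W assume W: "W \<in> copies (H n) n"
      show "0 < p n ^ l n" by fact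
      show "nev (potential_edges n) (p n) \<epsilon> (\<lambda>a b. of_bool (\<forall>e\<in>W. a e)) = p n ^ l n"
        unfolding nev_fst[OF finite_ground p_ge p_le e]
        using ev_all[OF finite_ground family[OF W] p_ge p_le] card_member[OF W] by simp
      show "p n ^ l n * P n \<le> nev (potential_edges n) (p n) \<epsilon> (\<lambda>a b. of_bool (\<forall>e\<in>W. a e) * of_bool (covered (copies (H n) n) b))"
        unfolding P_def by (rule nev_one_witness_ge[OF W e])
      show "nev (potential_edges n) (p n) \<epsilon> (\<lambda>a b. of_bool (\<forall>e\<in>W. a e) * of_bool (covered (copies (H n) n) b))
          \<le> p n ^ l n * (P n + ((1 - \<epsilon> / 2) ^ l n + 4 / c * (1 / 2) ^ l n))"
        by (rule order.trans[OF u2[OF W]]) (use q p0 elim W in \<open>auto intro!: mult_left_mono add_mono\<close>)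
    qed
  qed
  have lim: "(\<lambda>n. (1 - \<epsilon> / 2) ^ l n + 4 / c * (1 / 2) ^ l n) \<longlonglongrightarrow> 0" if eps: "0 < \<epsilon>" "\<epsilon> < 1" for \<epsilon> :: real
    using tendsto_add[OF geom[of "1 - \<epsilon> / 2"] tendsto_mult_right_zero[OF geom[of "1 / 2"], of "4 / c"]] eps by simp
  show "noise_sensitive potential_edges p (copy_indicator H)"
    unfolding noise_sensitive_def
  proof
    fix \<epsilon> :: real assume "\<epsilon> \<in> {0<..<1}"
    then have eps: "0 < \<epsilon>" "\<epsilon> < 1" by auto
    let ?N = "\<lambda>n. nev (potential_edges n) (p n) \<epsilon> (\<lambda>a b. of_bool (covered (copies (H n) n) a) * of_bool (covered (copies (H n) n) b))"
    have eq: "\<P>(x in measure_pmf (noise_pair (potential_edges n) (p n) \<epsilon>). copy_indicator H n (snd x) \<bar> copy_indicator H n (fst x))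
      = ?N n / P n" for n
      using cond_prob_noise_pair_eq[of "potential_edges n" "p n" \<epsilon> "copy_indicator H n"] p eps
      by (simp add: copy_indicator_iff_covered[OF H(1)] finite_potential_edges P_def)
    show "(\<lambda>n. \<P>(x in measure_pmf (noise_pair (potential_edges n) (p n) \<epsilon>). copy_indicator H n (snd x) \<bar> copy_indicator H n (fst x))
             - \<P>(\<omega> in measure_pmf (bernoulli_product (potential_edges n) (p n)). copy_indicator H n \<omega>)) \<longlonglongrightarrow> 0"
      unfolding eq prob
    proof (rule real_tendsto_sandwich[OF _ _ tendsto_const lim[OF eps]])
      show "\<forall>\<^sub>F n in sequentially. 0 \<le> ?N n / P n - P n"
        using main[OF eps] by eventually_elim (use c(1) in \<open>auto simp: field_simps\<close>)
      show "\<forall>\<^sub>F n in sequentially. ?N n / P n - P n \<le> (1 - \<epsilon> / 2) ^ l n + 4 / c * (1 / 2) ^ l n"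
        using main[OF eps]
      proof eventually_elim
        case (elim n)
        then have "?N n / P n \<le> P n + ((1 - \<epsilon> / 2) ^ l n + 4 / c * (1 / 2) ^ l n)"
          using c(1) by (simp add: pos_divide_le_eq mult.commute)
        then show ?case by simp
      qed
    qed
  qed
  show "one_strongly_noise_sensitive potential_edges p (copy_indicator H)"
    unfolding one_strongly_noise_sensitive_def
  proof
    fix \<epsilon> :: real assume "\<epsilon> \<in> {0<..<1}"
    then have eps: "0 < \<epsilon>" "\<epsilon> < 1" by auto
    let ?C = "\<lambda>n W. \<P>(x in measure_pmf (noise_pair (potential_edges n) (p n) \<epsilon>). copy_indicator H n (snd x) \<bar> \<forall>e\<in>W. fst x e)"
    let ?M = "\<lambda>n. Max (?C n ` one_witnesses (potential_edges n) (copy_indicator H n))"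
    have eq: "?C n W = nev (potential_edges n) (p n) \<epsilon> (\<lambda>a b. of_bool (\<forall>e\<in>W. a e) * of_bool (covered (copies (H n) n) b))
        / nev (potential_edges n) (p n) \<epsilon> (\<lambda>a b. of_bool (\<forall>e\<in>W. a e))" for n W
      unfolding cond_prob_def prob_noise_pair_eq_nev[of _ _ _ "\<lambda>a b. copy_indicator H n b \<and> (\<forall>e\<in>W. a e)"]
        prob_noise_pair_eq_nev[of _ _ _ "\<lambda>a b. \<forall>e\<in>W. a e"]
      by (simp add: copy_indicator_iff_covered[OF H(1)] of_bool_conj mult.commute)
    have bnd: "\<forall>\<^sub>F n in sequentially. P n \<le> ?M n \<and> ?M n \<le> P n + ((1 - \<epsilon> / 2) ^ l n + 4 / c * (1 / 2) ^ l n)"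
      using main[OF eps]
    proof eventually_elim
      case (elim n)
      have "P n > 0" using elim c by auto
      then have "copies (H n) n \<noteq> {}" unfolding P_def covered_def by auto
      note ne = one_witnesses_nonempty[of H n, OF H(1) this]
      have fin: "finite (one_witnesses (potential_edges n) (copy_indicator H n))"
        using finite_potential_edges[of n] by (auto simp: one_witnesses_def)
      have b: "P n \<le> ?C n W" "?C n W \<le> P n + ((1 - \<epsilon> / 2) ^ l n + 4 / c * (1 / 2) ^ l n)"
        if "W \<in> one_witnesses (potential_edges n) (copy_indicator H n)" for W
      proof -
        have W: "W \<in> copies (H n) n" by (rule one_witness_in_copies[of H n, OF H(1) that])
        show "P n \<le> ?C n W" "?C n W \<le> P n + ((1 - \<epsilon> / 2) ^ l n + 4 / c * (1 / 2) ^ l n)"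
          unfolding eq using elim W by (simp_all add: pos_divide_le_eq pos_le_divide_eq mult.commute)
      qed
      have "?M n \<in> ?C n ` one_witnesses (potential_edges n) (copy_indicator H n)"
        using ne fin by (intro Max_in) auto
      then show ?case using b by auto
    qed
    show "(\<lambda>n. ?M n - \<P>(\<omega> in measure_pmf (bernoulli_product (potential_edges n) (p n)). copy_indicator H n \<omega>)) \<longlonglongrightarrow> 0"
      unfolding prob
    proof (rule real_tendsto_sandwich[OF _ _ tendsto_const lim[OF eps]])
      show "\<forall>\<^sub>F n in sequentially. 0 \<le> ?M n - P n" using bnd by eventually_elim simp
      show "\<forall>\<^sub>F n in sequentially. ?M n - P n \<le> (1 - \<epsilon> / 2) ^ l n + 4 / c * (1 / 2) ^ l n"
        using bnd by eventually_elim simp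
    qed
  qed
qed

section \<open>Noise-stable correlations\<close>

text \<open>Apply \<open>nev_square_ge\<close> to \<open>f - \<kappa> * g\<close> and expand: the
  mixed terms contribute at least 2 \<kappa>^2, while the term in \<open>g\<close> alone costs at
  most \<kappa>^2 because \<open>g\<close> lies between 0 and 1.\<close>

lemma nev_covariance_ge:
  fixes f g :: "('a \<Rightarrow> bool) \<Rightarrow> real"
  assumes par: "finite \<Lambda>" "0 \<le> p" "p \<le> 1" "0 \<le> \<epsilon>" "\<epsilon> \<le> 1"
    and g: "\<And>w. 0 \<le> g w" "\<And>w. g w \<le> 1" and \<kappa>: "0 \<le> \<kappa>"
    and cov: "ev \<Lambda> p f * ev \<Lambda> p g + \<kappa> \<le> nev \<Lambda> p \<epsilon> (\<lambda>a b. f a * g b)"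
  shows "(ev \<Lambda> p f)\<^sup>2 + \<kappa>\<^sup>2 \<le> nev \<Lambda> p \<epsilon> (\<lambda>a b. f a * f b)"
proof -
  let ?N = "\<lambda>f g. nev \<Lambda> p \<epsilon> (\<lambda>a b. f a * g b)"
  have "(ev \<Lambda> p f - \<kappa> * ev \<Lambda> p g)\<^sup>2 \<le> ?N (\<lambda>w. f w - \<kappa> * g w) (\<lambda>w. f w - \<kappa> * g w)"
    using nev_square_ge[OF par, of "\<lambda>w. f w - \<kappa> * g w"] by (simp add: ev_diff par(1) ev_cmult)
  also have "(\<lambda>a b. (f a - \<kappa> * g a) * (f b - \<kappa> * g b))
      = (\<lambda>a b. f a * f b - \<kappa> * (f a * g b) - \<kappa> * (g a * f b) + \<kappa> * \<kappa> * (g a * g b))"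
    by (simp add: algebra_simps)
  also have "nev \<Lambda> p \<epsilon> \<dots> = ?N f f - \<kappa> * ?N f g - \<kappa> * ?N g f + \<kappa> * \<kappa> * ?N g g"
    by (simp only: nev_add[OF par(1)] nev_diff[OF par(1)] nev_cmult)
  also have "?N g f = ?N f g"
    using nev_commute[OF par, of "\<lambda>a b. f a * g b"] by (simp add: mult.commute)
  finally have "(ev \<Lambda> p f - \<kappa> * ev \<Lambda> p g)\<^sup>2 \<le> ?N f f - \<kappa> * ?N f g - \<kappa> * ?N f g + \<kappa> * \<kappa> * ?N g g" .
  moreover have "\<kappa> * \<kappa> * ?N g g \<le> \<kappa> * \<kappa> * 1"
  proof (rule mult_left_mono)
    have "?N g g \<le> nev \<Lambda> p \<epsilon> (\<lambda>a b. 1)"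
      by (rule nev_mono[OF par(1)]) (use mult_mono[of "g _" 1 "g _" 1] g in auto)
    then show "?N g g \<le> 1" by simp
  qed simp
  moreover have "\<kappa> * (ev \<Lambda> p f * ev \<Lambda> p g + \<kappa>) \<le> \<kappa> * ?N f g" by (rule mult_left_mono[OF cov \<kappa>])
  moreover have "0 \<le> (\<kappa> * ev \<Lambda> p g)\<^sup>2" by simp
  ultimately show ?thesis by (simp add: power2_eq_square algebra_simps)
qed

context uniform_family
begin

text \<open>The events that a given member is not fully open are decreasing, hence positively
  correlated, and the product of their probabilities is a lower bound.\<close>

lemma uncovered_prob_ge: "(1 - p ^ l) ^ card \<C> \<le> 1 - ev \<Lambda> p (\<lambda>w. of_bool (covered \<C> w))"
proof -
  have "(1 - p ^ l) ^ card \<S> \<le> ev \<Lambda> p (\<lambda>w. of_bool (\<not> covered \<S> w))" if "\<S> \<subseteq> \<C>" for \<S>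
    using finite_subset[OF that finite_family] that
  proof (induction \<S> rule: finite_induct)
    case empty
    show ?case by (simp add: covered_def)
  next
    case (insert W \<S>)
    have W: "W \<in> \<C>" using insert by auto
    \<comment> \<open>Subtracting 1 gives the negated indicators of failure: both functions are
      increasing, and the signs cancel in their product.\<close>
    let ?F = "\<lambda>w. of_bool (\<forall>e\<in>W. w e) - 1 :: real" and ?G = "\<lambda>w. of_bool (covered \<S> w) - 1 :: real"
    have m: "mono ?F" "mono ?G" using mono_all[of W] mono_covered[of \<S>] by (simp_all add: mono_def)
    have e1: "ev \<Lambda> p ?F = p ^ l - 1"
      using ev_all[OF finite_ground family[OF W] p_ge p_le] card_member[OF W]
      by (simp add: ev_diff finite_ground)
    have e2: "ev \<Lambda> p ?G = - ev \<Lambda> p (\<lambda>w. of_bool (\<not> covered \<S> w))"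
      using ev_diff[OF finite_ground, of p "\<lambda>w. 1" "\<lambda>w. of_bool (covered \<S> w)"]
      by (simp add: ev_diff finite_ground of_bool_not_iff)
    have "(1 - p ^ l) ^ card (insert W \<S>) = (1 - p ^ l) * (1 - p ^ l) ^ card \<S>" using insert by simp
    also have "\<dots> \<le> (1 - p ^ l) * ev \<Lambda> p (\<lambda>w. of_bool (\<not> covered \<S> w))"
      using insert p_ge p_le by (intro mult_left_mono) (auto simp: power_le_one)
    also have "\<dots> = ev \<Lambda> p ?F * ev \<Lambda> p ?G" unfolding e1 e2 by (simp add: algebra_simps)
    also have "\<dots> \<le> ev \<Lambda> p (\<lambda>w. ?F w * ?G w)" by (rule harris[OF finite_ground p_ge p_le m])
    also have "(\<lambda>w. ?F w * ?G w) = (\<lambda>w. of_bool (\<not> covered (insert W \<S>) w))"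
      by (auto simp: covered_def fun_eq_iff)
    finally show ?case .
  qed
  from this[OF order.refl] show ?thesis
    by (simp add: of_bool_not_iff ev_diff finite_ground)
qed

text \<open>If the event is lost, some open member has lost a coordinate. Bernoulli's inequality
  bounds the conditional probability of this by \<open>l * \<epsilon>\<close>, which is useful when
  \<open>l\<close> stays bounded.\<close>

lemma nev_covered_lost_le:
  assumes eps: "0 \<le> \<epsilon>" "\<epsilon> \<le> 1"
  shows "nev \<Lambda> p \<epsilon> (\<lambda>a b. of_bool (covered \<C> a) * (1 - of_bool (covered \<C> b)))
    \<le> real (card \<C>) * p ^ l * (real l * \<epsilon>)"
proof -
  let ?q = "1 - \<epsilon> + \<epsilon> * p"
  have "nev \<Lambda> p \<epsilon> (\<lambda>a b. of_bool (covered \<C> a) * (1 - of_bool (covered \<C> b)))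
    \<le> nev \<Lambda> p \<epsilon> (\<lambda>a b. \<Sum>W\<in>\<C>. of_bool (\<forall>e\<in>W. a e) - of_bool ((\<forall>e\<in>W. a e) \<and> (\<forall>e\<in>W. b e)))"
  proof (rule nev_mono[OF finite_ground])
    fix a b :: "'a \<Rightarrow> bool"
    let ?h = "\<lambda>W. of_bool (\<forall>e\<in>W. a e) - of_bool ((\<forall>e\<in>W. a e) \<and> (\<forall>e\<in>W. b e)) :: real"
    have h: "0 \<le> ?h W" for W by (simp add: of_bool_def)
    show "of_bool (covered \<C> a) * (1 - of_bool (covered \<C> b)) \<le> (\<Sum>W\<in>\<C>. ?h W)"
    proof (cases "covered \<C> a \<and> \<not> covered \<C> b")
      case True
      then obtain W where W: "W \<in> \<C>" "\<forall>e\<in>W. a e" "\<not> (\<forall>e\<in>W. b e)" unfolding covered_def by blast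
      have "?h W \<le> (\<Sum>W\<in>\<C>. ?h W)" by (rule member_le_sum[OF W(1) h finite_family])
      moreover have "?h W = 1" using W by simp
      ultimately show ?thesis using True by simp
    next
      case False
      then have "of_bool (covered \<C> a) * (1 - of_bool (covered \<C> b)) = (0::real)" by auto
      then show ?thesis using sum_nonneg[of \<C> ?h] h by simp
    qed
  qed
  also have "\<dots> = (\<Sum>W\<in>\<C>. p ^ l - (p * ?q) ^ l)"
  proof (simp only: nev_sum[OF finite_ground] nev_diff[OF finite_ground], rule sum.cong[OF refl])
    fix W assume W: "W \<in> \<C>"
    note i = nev_indep[OF finite_ground family[OF W] p_ge p_le eps, of "\<lambda>a b. 1", OF refl]
    show "nev \<Lambda> p \<epsilon> (\<lambda>a b. of_bool (\<forall>e\<in>W. a e)) - nev \<Lambda> p \<epsilon> (\<lambda>a b. of_bool ((\<forall>e\<in>W. a e) \<and> (\<forall>e\<in>W. b e)))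
      = p ^ l - (p * ?q) ^ l"
      using i by (simp only: mult_1_right nev_const card_member[OF W])
  qed
  also have "\<dots> = real (card \<C>) * p ^ l * (1 - ?q ^ l)"
    unfolding power_mult_distrib sum_constant right_diff_distrib mult_1_right mult.assoc ..
  also have "\<dots> \<le> real (card \<C>) * p ^ l * (real l * \<epsilon>)"
  proof (intro mult_left_mono)
    have "1 + real l * (- \<epsilon>) \<le> (1 + - \<epsilon>) ^ l" using eps by (intro Bernoulli_inequality) auto
    also have "\<dots> \<le> ?q ^ l" using eps p_ge by (intro power_mono) auto
    finally show "1 - ?q ^ l \<le> real l * \<epsilon>" by simp
  qed (use p_ge in auto)
  finally show ?thesis .
qed

end

section \<open>Weighted closed walks\<close>

lemma sum_PiE_lessThan_Suc:
  fixes F :: "(nat \<Rightarrow> 'a) \<Rightarrow> real"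
  shows "(\<Sum>\<psi>\<in>{..<Suc m} \<rightarrow>\<^sub>E S. F \<psi>) = (\<Sum>\<psi>\<in>{..<m} \<rightarrow>\<^sub>E S. \<Sum>y\<in>S. F (\<psi>(m := y)))"
proof -
  have "{..<Suc m} \<rightarrow>\<^sub>E S = (\<lambda>(y, g). g(m := y)) ` (S \<times> ({..<m} \<rightarrow>\<^sub>E S))"
    unfolding lessThan_Suc by (rule PiE_insert_eq)
  then have "(\<Sum>\<psi>\<in>{..<Suc m} \<rightarrow>\<^sub>E S. F \<psi>) = (\<Sum>x\<in>S \<times> ({..<m} \<rightarrow>\<^sub>E S). F (case x of (y, g) \<Rightarrow> g(m := y)))"
    using inj_combinator[of m "{..<m}" "\<lambda>_. S"] by (simp add: sum.reindex o_def)
  also have "\<dots> = (\<Sum>y\<in>S. \<Sum>\<psi>\<in>{..<m} \<rightarrow>\<^sub>E S. F (\<psi>(m := y)))"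
    by (simp add: sum.cartesian_product case_prod_beta)
  also have "\<dots> = (\<Sum>\<psi>\<in>{..<m} \<rightarrow>\<^sub>E S. \<Sum>y\<in>S. F (\<psi>(m := y)))" by (rule sum.swap)
  finally show ?thesis .
qed

text \<open>The entry at \<open>x\<close>, \<open>z\<close> of a power of the matrix
  \<open>u\<close>: the total weight of walks of the given length from \<open>x\<close> to
  \<open>z\<close>.\<close>

primrec walk_weight :: "(nat \<Rightarrow> nat \<Rightarrow> real) \<Rightarrow> nat \<Rightarrow> nat \<Rightarrow> nat \<Rightarrow> nat \<Rightarrow> real" where
  "walk_weight u n 0 x z = of_bool (x = z)"
| "walk_weight u n (Suc k) x z = (\<Sum>y<n. u x y * walk_weight u n k y z)"

lemma walk_weight_1: "z < n \<Longrightarrow> walk_weight u n 1 x z = u x z"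
  by (simp add: of_bool_def if_distrib sum.delta cong: if_cong)

text \<open>Summing out the vertices of a closed walk one at a time, starting from the last.\<close>

lemma sum_closed_walks:
  fixes u :: "nat \<Rightarrow> nat \<Rightarrow> real" and T3 :: "nat \<Rightarrow> nat \<Rightarrow> nat \<Rightarrow> real"
  shows "(\<Sum>\<psi>\<in>{..<j + 3} \<rightarrow>\<^sub>E {..<n}. T3 (\<psi> 0) (\<psi> 1) (\<psi> 2) *
      (\<Prod>i<j. u (\<psi> (i + 2)) (\<psi> (i + 3))) * walk_weight u n k (\<psi> (j + 2)) (\<psi> 0))
    = (\<Sum>\<psi>\<in>{..<3::nat} \<rightarrow>\<^sub>E {..<n}. T3 (\<psi> 0) (\<psi> 1) (\<psi> 2) * walk_weight u n (k + j) (\<psi> 2) (\<psi> 0))"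
proof (induction j arbitrary: k)
  case 0
  show ?case by (simp add: numeral_2_eq_2)
next
  case (Suc j)
  have e: "Suc j + 3 = Suc (j + 3)" by simp
  have "(\<Sum>\<psi>\<in>{..<Suc j + 3} \<rightarrow>\<^sub>E {..<n}. T3 (\<psi> 0) (\<psi> 1) (\<psi> 2) *
      (\<Prod>i<Suc j. u (\<psi> (i + 2)) (\<psi> (i + 3))) * walk_weight u n k (\<psi> (Suc j + 2)) (\<psi> 0))
    = (\<Sum>\<psi>\<in>{..<j + 3} \<rightarrow>\<^sub>E {..<n}. \<Sum>y<n. T3 (\<psi> 0) (\<psi> 1) (\<psi> 2) *
      ((\<Prod>i<j. u (\<psi> (i + 2)) (\<psi> (i + 3))) * u (\<psi> (j + 2)) y) * walk_weight u n k y (\<psi> 0))"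
    unfolding e sum_PiE_lessThan_Suc by (intro sum.cong refl) (auto simp: numeral_3_eq_3 intro!: prod.cong)
  also have "\<dots> = (\<Sum>\<psi>\<in>{..<j + 3} \<rightarrow>\<^sub>E {..<n}. T3 (\<psi> 0) (\<psi> 1) (\<psi> 2) *
      (\<Prod>i<j. u (\<psi> (i + 2)) (\<psi> (i + 3))) * walk_weight u n (Suc k) (\<psi> (j + 2)) (\<psi> 0))"
    by (intro sum.cong refl) (simp add: sum_distrib_left mult.assoc)
  also have "\<dots> = (\<Sum>\<psi>\<in>{..<3::nat} \<rightarrow>\<^sub>E {..<n}. T3 (\<psi> 0) (\<psi> 1) (\<psi> 2) * walk_weight u n (Suc k + j) (\<psi> 2) (\<psi> 0))"
    by (rule Suc.IH)
  finally show ?case by simp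
qed

lemma sum_PiE_3:
  fixes T3 :: "nat \<Rightarrow> nat \<Rightarrow> nat \<Rightarrow> real"
  shows "(\<Sum>\<psi>\<in>{..<3::nat} \<rightarrow>\<^sub>E {..<n}. T3 (\<psi> 0) (\<psi> 1) (\<psi> 2)) = (\<Sum>x<n. \<Sum>y<n. \<Sum>z<n. T3 x y z)"
  by (simp add: numeral_3_eq_3 numeral_2_eq_2 sum_PiE_lessThan_Suc)

text \<open>\<open>A\<close> is the adjacency of a fixed copy of \<open>H\<close>. A second copy pays the factor \<open>6 / n\<close> only for
  edges outside the first; since \<open>A\<close> has degree at most 3, walks inside it grow like \<open>3 ^ k\<close>, which is
  negligible against the growth \<open>6 ^ k\<close> of free walks. So no attention to injectivity is needed.\<close>

locale sparse_overlay =
  fixes n N :: nat and A :: "nat \<Rightarrow> nat \<Rightarrow> bool" and U :: "nat set"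
  assumes U: "U \<subseteq> {..<n}" "card U \<le> N"
    and sym: "\<And>x y. A x y \<Longrightarrow> A y x"
    and support: "\<And>x y. A x y \<Longrightarrow> x \<in> U"
    and deg: "\<And>x. card {y\<in>{..<n}. A x y} \<le> 3"
    and N: "5 \<le> N" "2 * N\<^sup>2 \<le> n"
    and triangles: "(\<Sum>x<n. \<Sum>y<n. \<Sum>z<n. of_bool (A x y) * of_bool (A y z) * of_bool (A x z)) \<le> (27 :: real)"
begin

text \<open>An upper bound for the price of an edge. The sum overshoots slightly on edges of the
  first copy, where the price is 1, but it makes products expand linearly.\<close>

definition wt :: "nat \<Rightarrow> nat \<Rightarrow> real" where "wt x y = 6 / n + of_bool (A x y)"

lemma n_pos: "0 < n"
  using N by (cases "n = 0") auto

lemma finite_U: "finite U"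
  using U finite_subset by blast

lemma support2: "A x y \<Longrightarrow> y \<in> U"
  using support sym by blast

lemma degree_sum: "(\<Sum>y<n. of_bool (A x y)) \<le> (3 :: real)"
  using deg[of x] by (simp add: of_bool_def sum.If_cases Int_def)

lemma degree_sum': "(\<Sum>x<n. of_bool (A x y)) \<le> (3 :: real)"
proof -
  have "A x y = A y x" for x using sym by blast
  then show ?thesis using degree_sum[of y] by simp
qed

lemma walk_weight_nonneg: "0 \<le> walk_weight wt n k x z"
  by (induction k arbitrary: x) (auto intro!: sum_nonneg simp: wt_def)

text \<open>\<open>R\<close> and \<open>Q\<close> are column sums of the matrix power, over all
  starting vertices and over those in \<open>U\<close>. A step along \<open>A\<close> ends in
  \<open>U\<close>, so such steps feed \<open>R\<close> only through \<open>Q\<close>, and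
  \<open>Q\<close> receives mass from \<open>R\<close> only with the small factor N / n. Bounding
  row sums directly would give growth 9 per step instead of about 6.\<close>

definition R :: "nat \<Rightarrow> nat \<Rightarrow> real" where "R k z = (\<Sum>x<n. walk_weight wt n k x z)"
definition Q :: "nat \<Rightarrow> nat \<Rightarrow> real" where "Q k z = (\<Sum>x\<in>U. walk_weight wt n k x z)"

lemma R_nonneg: "0 \<le> R k z" and Q_nonneg: "0 \<le> Q k z"
  unfolding R_def Q_def by (auto intro!: sum_nonneg walk_weight_nonneg)

lemma walk_weight_Suc:
  "walk_weight wt n (Suc k) x z = 6 / n * R k z + (\<Sum>y<n. of_bool (A x y) * walk_weight wt n k y z)"
  unfolding R_def by (simp add: wt_def distrib_right sum.distrib sum_distrib_left)

lemma sum_neighbours_le: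
  assumes "S \<subseteq> {..<n}"
  shows "(\<Sum>x\<in>S. \<Sum>y<n. of_bool (A x y) * walk_weight wt n k y z) \<le> 3 * Q k z"
proof -
  have "(\<Sum>x\<in>S. \<Sum>y<n. of_bool (A x y) * walk_weight wt n k y z)
      \<le> (\<Sum>x<n. \<Sum>y<n. of_bool (A x y) * walk_weight wt n k y z)"
    using assms by (intro sum_mono2) (auto intro!: sum_nonneg walk_weight_nonneg)
  also have "\<dots> = (\<Sum>y<n. (\<Sum>x<n. of_bool (A x y)) * walk_weight wt n k y z)"
    unfolding sum_distrib_right by (rule sum.swap)
  also have "\<dots> = (\<Sum>y\<in>U. (\<Sum>x<n. of_bool (A x y)) * walk_weight wt n k y z)"
  proof (rule sum.mono_neutral_right)
    show "\<forall>y\<in>{..<n} - U. (\<Sum>x<n. of_bool (A x y)) * walk_weight wt n k y z = 0"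
      using support2 by (auto intro!: sum.neutral)
  qed (use U in auto)
  also have "\<dots> \<le> (\<Sum>y\<in>U. 3 * walk_weight wt n k y z)"
    by (intro sum_mono mult_right_mono degree_sum' walk_weight_nonneg)
  finally show ?thesis by (simp add: Q_def sum_distrib_left)
qed

lemma R_Suc_le: "R (Suc k) z \<le> 6 * R k z + 3 * Q k z"
proof -
  have "R (Suc k) z = (\<Sum>x<n. 6 / n * R k z + (\<Sum>y<n. of_bool (A x y) * walk_weight wt n k y z))"
    unfolding R_def[of "Suc k"] walk_weight_Suc ..
  also have "\<dots> = 6 * R k z + (\<Sum>x<n. \<Sum>y<n. of_bool (A x y) * walk_weight wt n k y z)"
    using n_pos by (simp add: sum.distrib)
  finally show ?thesis using sum_neighbours_le[of "{..<n}" k z] by simp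
qed

lemma Q_Suc_le: "Q (Suc k) z \<le> 6 * (N / n) * R k z + 3 * Q k z"
proof -
  have "Q (Suc k) z = (\<Sum>x\<in>U. 6 / n * R k z + (\<Sum>y<n. of_bool (A x y) * walk_weight wt n k y z))"
    unfolding Q_def[of "Suc k"] walk_weight_Suc ..
  also have "\<dots> = card U * (6 / n * R k z) + (\<Sum>x\<in>U. \<Sum>y<n. of_bool (A x y) * walk_weight wt n k y z)"
    by (simp add: sum.distrib)
  also have "\<dots> \<le> N * (6 / n * R k z) + 3 * Q k z"
    using U R_nonneg[of k z] n_pos by (intro add_mono mult_right_mono sum_neighbours_le) auto
  finally show ?thesis by (simp add: mult_ac)
qed

text \<open>\<open>R + Q\<close> grows by a factor at most 6 (1 + N / n) per step, the two
  contributions 3 to the coefficient of \<open>Q\<close> adding up to 6. Over at most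
  \<open>N\<close> steps the correction is at most e < 3, since N^2 \<le> n; with the initial value
  2 this gives the factor 6.\<close>

lemma R_le:
  assumes "k \<le> N" "z < n"
  shows "R k z \<le> 6 * 6 ^ k"
proof -
  have "R k z + Q k z \<le> 2 * (6 * (1 + N / n)) ^ k"
  proof (induction k)
    case 0
    have "R 0 z \<le> 1" "Q 0 z \<le> 1"
      unfolding R_def Q_def using finite_U by (auto simp: of_bool_def)
    then show ?case by simp
  next
    case (Suc k)
    have "R (Suc k) z + Q (Suc k) z \<le> 6 * (1 + N / n) * R k z + 6 * Q k z"
      using R_Suc_le[of k z] Q_Suc_le[of k z] by (simp add: algebra_simps)
    also have "\<dots> \<le> 6 * (1 + N / n) * R k z + 6 * (1 + N / n) * Q k z"
      using Q_nonneg[of k z] by (intro add_left_mono mult_right_mono) auto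
    also have "\<dots> = 6 * (1 + N / n) * (R k z + Q k z)" by (simp only: distrib_left)
    also have "\<dots> \<le> 6 * (1 + N / n) * (2 * (6 * (1 + N / n)) ^ k)"
      by (intro mult_left_mono Suc.IH) auto
    finally show ?case by simp
  qed
  then have "R k z \<le> 2 * (6 * (1 + N / n)) ^ k" using Q_nonneg[of k z] by linarith
  also have "\<dots> = 2 * (6 ^ k * (1 + N / n) ^ k)" by (simp only: power_mult_distrib)
  also have "(1 + real N / n) ^ k \<le> exp (N / n) ^ k" by (intro power_mono) auto
  also have "exp (real N / n) ^ k = exp (k * (N / n))" by (simp only: exp_of_nat_mult)
  also have "\<dots> \<le> exp 1"
  proof -
    have "real k * real N \<le> real N * real N" using assms by (intro mult_right_mono) auto
    also have "\<dots> \<le> real n" using N(2) by (simp add: power2_eq_square flip: of_nat_mult)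
    finally show ?thesis using n_pos by (simp add: field_simps)
  qed
  finally have "R k z \<le> 2 * (6 ^ k * exp 1)" by simp
  also have "\<dots> \<le> 2 * (6 ^ k * 3)" using exp_le by (intro mult_left_mono) auto
  finally show ?thesis by simp
qed

text \<open>Walks inside the first copy contribute 3^k. The constant 12 reproduces itself: a free
  step gives 36 and an \<open>A\<close> step 3 * 12, together 12 * 6.\<close>

lemma walk_weight_le:
  assumes "k \<le> N" "z < n"
  shows "walk_weight wt n k x z \<le> 3 ^ k + 12 * 6 ^ k / n"
  using assms(1)
proof (induction k arbitrary: x)
  case 0
  show ?case by simp
next
  case (Suc k)
  have "walk_weight wt n (Suc k) x z
      \<le> 6 / n * (6 * 6 ^ k) + (\<Sum>y<n. of_bool (A x y) * (3 ^ k + 12 * 6 ^ k / n))"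
    unfolding walk_weight_Suc using Suc assms(2)
    by (intro add_mono mult_left_mono sum_mono R_le) auto
  also have "\<dots> = 6 / n * (6 * 6 ^ k) + (\<Sum>y<n. of_bool (A x y)) * (3 ^ k + 12 * 6 ^ k / n)"
    by (simp only: sum_distrib_right)
  also have "\<dots> \<le> 6 / n * (6 * 6 ^ k) + 3 * (3 ^ k + 12 * 6 ^ k / n)"
    by (intro add_left_mono mult_right_mono degree_sum) auto
  also have "\<dots> = 3 ^ Suc k + 12 * 6 ^ Suc k / n" using n_pos by (simp add: field_simps)
  finally show ?case .
qed

lemma adjacent_sum: "(\<Sum>x<n. \<Sum>y<n. of_bool (A x y)) \<le> (3 * N :: real)"
proof -
  have "(\<Sum>x<n. \<Sum>y<n. of_bool (A x y)) = (\<Sum>x\<in>U. \<Sum>y<n. of_bool (A x y) :: real)"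
    using U support by (intro sum.mono_neutral_right) (auto intro!: sum.neutral)
  also have "\<dots> \<le> (\<Sum>x\<in>U. 3)" by (intro sum_mono degree_sum)
  finally show ?thesis using U(2) by simp
qed

lemma path_sum: "(\<Sum>x<n. \<Sum>y<n. \<Sum>z<n. of_bool (A x y) * of_bool (A y z)) \<le> (9 * N :: real)"
proof -
  have "(\<Sum>x<n. \<Sum>y<n. \<Sum>z<n. of_bool (A x y) * of_bool (A y z))
      = (\<Sum>x<n. \<Sum>y<n. of_bool (A x y) * (\<Sum>z<n. of_bool (A y z)) :: real)"
    unfolding sum_distrib_left ..
  also have "\<dots> \<le> (\<Sum>x<n. \<Sum>y<n. of_bool (A x y) * 3)"
    by (intro sum_mono mult_left_mono degree_sum) auto
  also have "\<dots> = 3 * (\<Sum>x<n. \<Sum>y<n. of_bool (A x y))" by (simp add: sum_distrib_left mult.commute)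
  finally show ?thesis using adjacent_sum by simp
qed

text \<open>Expand by the number of sides taken from \<open>A\<close>: none gives 6^3, three give at
  most 27, and one or two give 81 * 6 N / n together, at most 48.6 because 10 N \<le> n.\<close>

lemma triangle_weight_le: "(\<Sum>x<n. \<Sum>y<n. \<Sum>z<n. wt x y * wt y z * wt x z) \<le> 300"
proof -
  define p where "p = 6 / real n"
  have np: "n * p = 6" using n_pos by (simp add: p_def)
  let ?a = "\<lambda>x y. of_bool (A x y) :: real"
  let ?S = "\<lambda>f :: nat \<Rightarrow> nat \<Rightarrow> nat \<Rightarrow> real. \<Sum>x<n. \<Sum>y<n. \<Sum>z<n. f x y z"
  have c1: "?S (\<lambda>x y z. ?a y z) = n * (\<Sum>x<n. \<Sum>y<n. ?a x y)"
    by (simp only: sum_constant card_lessThan)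
  have c2: "?S (\<lambda>x y z. ?a x y) = n * (\<Sum>x<n. \<Sum>y<n. ?a x y)"
    by (simp only: sum_constant card_lessThan sum_distrib_left)
  have c3: "?S (\<lambda>x y z. ?a x z) = n * (\<Sum>x<n. \<Sum>y<n. ?a x y)"
    by (simp only: sum_constant card_lessThan sum_distrib_left)
  have asym: "A x y = A y x" for x y using sym by blast
  have d2: "?S (\<lambda>x y z. ?a x y * ?a x z) = ?S (\<lambda>x y z. ?a x y * ?a y z)"
    by (subst sum.swap) (intro sum.cong refl, subst asym, rule refl)
  have d3: "?S (\<lambda>x y z. ?a y z * ?a x z) = ?S (\<lambda>x y z. ?a x y * ?a y z)"
  proof -
    have "?S (\<lambda>x y z. ?a y z * ?a x z) = (\<Sum>x<n. \<Sum>z<n. \<Sum>y<n. ?a y z * ?a x z)"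
      by (intro sum.cong refl sum.swap)
    also have "\<dots> = ?S (\<lambda>x y z. ?a x y * ?a y z)"
    proof (intro sum.cong refl)
      fix x z y
      show "?a y z * ?a x z = ?a x z * ?a z y" unfolding asym[of y z] by (rule mult.commute)
    qed
    finally show ?thesis .
  qed
  have "?S (\<lambda>x y z. wt x y * wt y z * wt x z) = ?S (\<lambda>x y z. p * p * p + p * p * ?a x y + p * p * ?a y z + p * p * ?a x z
      + p * (?a x y * ?a y z) + p * (?a x y * ?a x z) + p * (?a y z * ?a x z) + ?a x y * ?a y z * ?a x z)"
    unfolding wt_def p_def[symmetric] by (intro sum.cong refl) (simp add: algebra_simps)
  also have "\<dots> = ?S (\<lambda>x y z. p * p * p) + p * p * ?S (\<lambda>x y z. ?a x y) + p * p * ?S (\<lambda>x y z. ?a y z)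
      + p * p * ?S (\<lambda>x y z. ?a x z) + p * ?S (\<lambda>x y z. ?a x y * ?a y z) + p * ?S (\<lambda>x y z. ?a x y * ?a x z)
      + p * ?S (\<lambda>x y z. ?a y z * ?a x z) + ?S (\<lambda>x y z. ?a x y * ?a y z * ?a x z)"
    unfolding sum.distrib sum_distrib_left ..
  also have "\<dots> = (n * p) ^ 3 + 3 * ((n * p) * p * (\<Sum>x<n. \<Sum>y<n. ?a x y)) + 3 * (p * ?S (\<lambda>x y z. ?a x y * ?a y z))
      + ?S (\<lambda>x y z. ?a x y * ?a y z * ?a x z)"
    unfolding c1 c2 c3 d2 d3 by (simp add: power3_eq_cube)
  also have "\<dots> \<le> 6 ^ 3 + 3 * (6 * p * (3 * N)) + 3 * (p * (9 * N)) + 27"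
    unfolding np using n_pos
    by (intro add_mono mult_left_mono adjacent_sum path_sum triangles order.refl) (auto simp: p_def)
  also have "\<dots> = 243 + 81 * (p * N)" by simp
  also have "p * N \<le> 6 / 10"
  proof -
    have "5 * N \<le> N * N" using N(1) by (rule mult_right_mono) simp
    then have "10 * N \<le> n" using N(2) unfolding power2_eq_square by linarith
    then have "10 * real N \<le> real n" by (metis of_nat_le_iff of_nat_mult of_nat_numeral)
    then show ?thesis using n_pos by (simp add: p_def field_simps)
  qed
  finally show ?thesis by simp
qed

text \<open>Beyond the triangle on 0, 1, 2 the walk has \<open>j + 1\<close> steps from 2 back to 0.
  By \<open>exp\<close> the contribution 3^(j+1) is at most 6^(j+1) / n, whence 13 = 1 + 12 and 3900
  = 300 * 13.\<close>

lemma closed_walk_weight_le: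
  assumes j: "j + 3 = N" and exp: "real n * 3 ^ (j + 1) \<le> 6 ^ (j + 1)"
  shows "(\<Sum>\<psi>\<in>{..<N} \<rightarrow>\<^sub>E {..<n}. (wt (\<psi> 0) (\<psi> 1) * wt (\<psi> 1) (\<psi> 2) * wt (\<psi> 0) (\<psi> 2)) *
      (\<Prod>i<j. wt (\<psi> (i + 2)) (\<psi> (i + 3))) * wt (\<psi> (j + 2)) (\<psi> 0)) \<le> 3900 * 6 ^ (j + 1) / n"
proof -
  let ?T = "\<lambda>x y z. wt x y * wt y z * wt x z"
  have wt0: "0 \<le> wt x y" for x y by (simp add: wt_def)
  have "(\<Sum>\<psi>\<in>{..<N} \<rightarrow>\<^sub>E {..<n}. ?T (\<psi> 0) (\<psi> 1) (\<psi> 2) *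
      (\<Prod>i<j. wt (\<psi> (i + 2)) (\<psi> (i + 3))) * wt (\<psi> (j + 2)) (\<psi> 0))
    = (\<Sum>\<psi>\<in>{..<j + 3} \<rightarrow>\<^sub>E {..<n}. ?T (\<psi> 0) (\<psi> 1) (\<psi> 2) *
      (\<Prod>i<j. wt (\<psi> (i + 2)) (\<psi> (i + 3))) * walk_weight wt n 1 (\<psi> (j + 2)) (\<psi> 0))"
    unfolding j
  proof (rule sum.cong[OF refl])
    fix \<psi> assume "\<psi> \<in> {..<N} \<rightarrow>\<^sub>E {..<n}"
    then have "\<psi> 0 < n" using N(1) by (auto simp: PiE_iff)
    then show "?T (\<psi> 0) (\<psi> 1) (\<psi> 2) * (\<Prod>i<j. wt (\<psi> (i + 2)) (\<psi> (i + 3))) * wt (\<psi> (j + 2)) (\<psi> 0)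
      = ?T (\<psi> 0) (\<psi> 1) (\<psi> 2) * (\<Prod>i<j. wt (\<psi> (i + 2)) (\<psi> (i + 3))) * walk_weight wt n 1 (\<psi> (j + 2)) (\<psi> 0)"
      by (simp only: walk_weight_1)
  qed
  also have "\<dots> = (\<Sum>\<psi>\<in>{..<3::nat} \<rightarrow>\<^sub>E {..<n}. ?T (\<psi> 0) (\<psi> 1) (\<psi> 2) * walk_weight wt n (1 + j) (\<psi> 2) (\<psi> 0))"
    by (rule sum_closed_walks)
  also have "\<dots> \<le> (\<Sum>\<psi>\<in>{..<3::nat} \<rightarrow>\<^sub>E {..<n}. ?T (\<psi> 0) (\<psi> 1) (\<psi> 2) * (13 * 6 ^ (j + 1) / n))"
  proof (intro sum_mono mult_left_mono)
    fix \<psi> assume "\<psi> \<in> {..<3::nat} \<rightarrow>\<^sub>E {..<n}"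
    then have "\<psi> 0 < n" by (auto simp: PiE_iff)
    then have "walk_weight wt n (1 + j) (\<psi> 2) (\<psi> 0) \<le> 3 ^ (1 + j) + 12 * 6 ^ (1 + j) / n"
      using j by (intro walk_weight_le) auto
    also have "(3::real) ^ (1 + j) \<le> 6 ^ (1 + j) / n" using exp n_pos by (simp add: field_simps)
    finally show "walk_weight wt n (1 + j) (\<psi> 2) (\<psi> 0) \<le> 13 * 6 ^ (j + 1) / n"
      by (simp add: add.commute field_simps)
  qed (use wt0 in auto)
  also have "\<dots> = (\<Sum>x<n. \<Sum>y<n. \<Sum>z<n. ?T x y z) * (13 * 6 ^ (j + 1) / n)"
    unfolding sum_distrib_right[symmetric] sum_PiE_3[of ?T n] ..
  also have "\<dots> \<le> 300 * (13 * 6 ^ (j + 1) / n)"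
    by (intro mult_right_mono triangle_weight_le) auto
  finally show ?thesis by simp
qed

end

section \<open>Cycles with a chord\<close>

definition cyc_next :: "nat \<Rightarrow> nat \<Rightarrow> nat" where
  "cyc_next N i = (if Suc i = N then 0 else Suc i)"

definition chorded_cycle :: "nat \<Rightarrow> nat ugraph" where
  "chorded_cycle N = ({..<N}, insert {0, 2} ((\<lambda>i. {i, cyc_next N i}) ` {..<N}))"

lemma verts_chorded_cycle [simp]: "verts (chorded_cycle N) = {..<N}"
  by (simp add: chorded_cycle_def)

lemma inj_on_cycle_edges:
  assumes "5 \<le> N"
  shows "inj_on (\<lambda>i. {i, cyc_next N i}) {..<N}"
  using assms by (auto simp: inj_on_def cyc_next_def doubleton_eq_iff split: if_splits)

lemma chord_not_cycle_edge:
  assumes "5 \<le> N"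
  shows "{0, 2} \<notin> (\<lambda>i. {i, cyc_next N i}) ` {..<N}"
  using assms by (auto simp: cyc_next_def doubleton_eq_iff split: if_splits)

lemma card_edges_chorded_cycle: "5 \<le> N \<Longrightarrow> card (edges (chorded_cycle N)) = N + 1"
  using chord_not_cycle_edge card_image[OF inj_on_cycle_edges] by (simp add: chorded_cycle_def)

lemma simple_graph_chorded_cycle:
  assumes "5 \<le> N"
  shows "simple_graph (chorded_cycle N)"
proof -
  have "{i, cyc_next N i} \<in> nsets {..<N} 2" if "i < N" for i
    using that assms by (auto simp: nsets_def cyc_next_def)
  moreover have "{0, 2} \<in> nsets {..<N} 2" using assms by (auto simp: nsets_def)
  moreover have "{..<N} \<noteq> {}" using assms by (auto simp: lessThan_empty_iff)
  ultimately show ?thesis unfolding simple_graph_def chorded_cycle_def by (simp add: image_subset_iff)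
qed

text \<open>A proper subgraph has at most as many edges as vertices: sending a cycle edge to its first
  endpoint is injective, and it is surjective only if all cycle edges are present.\<close>

lemma strictly_balanced_chorded_cycle:
  assumes N: "5 \<le> N"
  shows "strictly_balanced (chorded_cycle N)"
  unfolding strictly_balanced_def
proof (intro allI impI)
  fix K assume K: "subgraph K (chorded_cycle N) \<and> K \<noteq> chorded_cycle N"
  let ?c = "\<lambda>i. {i, cyc_next N i}"
  obtain V E where [simp]: "K = (V, E)" by (cases K)
  have sK: "simple_graph K" using K by (simp add: subgraph_def)
  have V: "V \<subseteq> {..<N}" "V \<noteq> {}" "finite V" using K sK by (auto simp: subgraph_def simple_graph_def)
  have E: "E \<subseteq> insert {0, 2} (?c ` {..<N})" using K by (auto simp: subgraph_def chorded_cycle_def)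
  have EV: "e \<subseteq> V" if "e \<in> E" for e using simple_graphD(4)[OF sK] that by auto
  define I where "I = {i. i < N \<and> ?c i \<in> E}"
  have fI: "finite I" unfolding I_def by simp
  have IV: "I \<subseteq> V" using EV unfolding I_def by blast
  have EI: "E \<subseteq> insert {0, 2} (?c ` I)" using E unfolding I_def by auto
  have cI: "card (?c ` I) \<le> card I" by (rule card_image_le[OF fI])
  have "card E \<le> card V"
  proof (cases "I = V")
    case True
    \<comment> \<open>A nonempty set closed under the cyclic successor is everything: climb to
      \<open>N - 1\<close>, wrap around to 0, climb again.\<close>
    have step: "cyc_next N i \<in> V" if "i \<in> V" for i
    proof -
      have "?c i \<in> E" using that unfolding True[symmetric] I_def by simp
      from EV[OF this] show ?thesis by auto
    qed
    obtain i0 where i0: "i0 \<in> V" using V by auto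
    have up: "i0 + k < N \<Longrightarrow> i0 + k \<in> V" for k
    proof (induction k)
      case (Suc k)
      then have "cyc_next N (i0 + k) \<in> V" by (intro step) auto
      then show ?case using Suc.prems by (simp add: cyc_next_def)
    qed (use i0 in simp)
    have "N - 1 \<in> V" using up[of "N - 1 - i0"] V i0 N by auto
    from step[OF this] have z: "0 \<in> V" using N by (simp add: cyc_next_def)
    have "k < N \<Longrightarrow> k \<in> V" for k
    proof (induction k)
      case (Suc k)
      then have "cyc_next N k \<in> V" by (intro step) auto
      then show ?case using Suc.prems by (simp add: cyc_next_def)
    qed (use z in simp)
    then have VN: "V = {..<N}" using V by auto
    have "?c ` {..<N} \<subseteq> E" using True VN unfolding I_def by auto
    moreover have "E \<noteq> insert {0, 2} (?c ` {..<N})" using K VN by (auto simp: chorded_cycle_def)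
    ultimately have "{0, 2} \<notin> E" using E by blast
    then have "E \<subseteq> ?c ` I" using EI by blast
    then have "card E \<le> card (?c ` I)" using fI by (intro card_mono) auto
    then show ?thesis using cI True by simp
  next
    case False
    have "card E \<le> card (insert {0, 2} (?c ` I))" using fI EI by (intro card_mono) auto
    also have "\<dots> \<le> Suc (card (?c ` I))" by (rule card_insert_le_m1[of "Suc _"]) auto
    also have "\<dots> \<le> Suc (card I)" using cI by simp
    also have "\<dots> \<le> card V" using psubset_card_mono[OF V(3)] IV False by (simp add: psubset_eq Suc_le_eq)
    finally show ?thesis .
  qed
  then have "average_degree K \<le> 2"
    using V unfolding average_degree_eq[OF sK] by (simp add: card_gt_0_iff divide_le_eq)
  also have "2 < average_degree (chorded_cycle N)"
    using N unfolding average_degree_eq[OF simple_graph_chorded_cycle[OF N]] card_edges_chorded_cycle[OF N]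
    by (simp add: field_simps)
  finally show "average_degree K < average_degree (chorded_cycle N)" .
qed

lemma chorded_cycle_edge_cases:
  assumes "{i, j} \<in> edges (chorded_cycle N)"
  obtains "i = 0" "j = 2" | "i = 2" "j = 0" | "i < N" "j = cyc_next N i" | "j < N" "i = cyc_next N j"
proof -
  consider "{i, j} = {0, 2}" | k where "k < N" "{i, j} = {k, cyc_next N k}"
    using assms by (auto simp: chorded_cycle_def)
  then show ?thesis
  proof cases
    case 1
    then show ?thesis using that(1,2) by (auto simp: doubleton_eq_iff)
  next
    case 2
    then show ?thesis using that(3,4) by (auto simp: doubleton_eq_iff)
  qed
qed

lemma cyc_next_cases:
  obtains "Suc i = N" "cyc_next N i = 0" | "Suc i \<noteq> N" "cyc_next N i = Suc i"
  by (cases "Suc i = N") (auto simp: cyc_next_def)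

text \<open>\<open>2 - i\<close> exchanges the ends 0 and 2 of the chord. For other \<open>i\<close>
  it is a spurious candidate, harmless because only a set of at most three neighbours is
  wanted.\<close>

lemma chorded_cycle_adjacent:
  assumes "{i, j} \<in> edges (chorded_cycle N)"
  shows "j \<in> {cyc_next N i, (if i = 0 then N - 1 else i - 1), 2 - i}"
  using assms
proof (cases rule: chorded_cycle_edge_cases)
  case 4
  then show ?thesis by (cases rule: cyc_next_cases[of j N]) auto
qed auto

lemma chorded_cycle_adjacentD:
  assumes "{i, j} \<in> edges (chorded_cycle N)"
  shows "i = 0 \<and> j = 2 \<or> i = 2 \<and> j = 0 \<or> j = i + 1 \<or> i = j + 1 \<or> i = 0 \<and> j + 1 = N \<or> j = 0 \<and> i + 1 = N"
  using assms
proof (cases rule: chorded_cycle_edge_cases)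
  case 3
  then show ?thesis by (cases rule: cyc_next_cases[of i N]) auto
next
  case 4
  then show ?thesis by (cases rule: cyc_next_cases[of j N]) auto
qed auto

text \<open>Beyond the chord lies a cycle of length N - 1 \<ge> 4, so 0, 1, 2 span the only
  triangle.\<close>

lemma chorded_cycle_triangle:
  assumes "5 \<le> N" "{i, j} \<in> edges (chorded_cycle N)"
    "{j, k} \<in> edges (chorded_cycle N)" "{i, k} \<in> edges (chorded_cycle N)"
  shows "i < 3 \<and> j < 3 \<and> k < 3"
  using assms(1) assms(2-4)[THEN chorded_cycle_adjacentD]
  by (elim disjE conjE) simp_all

lemma doubleton_in_edge_image:
  assumes "simple_graph H" "{x, y} \<in> edge_image H \<phi>"
  obtains i j where "i \<in> verts H" "j \<in> verts H" "x = \<phi> i" "y = \<phi> j" "{i, j} \<in> edges H"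
proof -
  obtain e where e: "e \<in> edges H" "{x, y} = \<phi> ` e" using assms(2) by (auto simp: edge_image_def)
  have "card e = 2" "e \<subseteq> verts H" using simple_graphD(4)[OF assms(1) e(1)] by auto
  then obtain a b where ab: "e = {a, b}" "a \<in> verts H" "b \<in> verts H" by (auto simp: card_2_iff)
  then have "(x = \<phi> a \<and> y = \<phi> b) \<or> (x = \<phi> b \<and> y = \<phi> a)" using e(2) by (auto simp: doubleton_eq_iff)
  then show ?thesis using that[of a b] that[of b a] ab e(1) by (auto simp: insert_commute)
qed

text \<open>The bound 27 = 3^3 counts all ordered triples from the images of 0, 1, 2, where every
  triangle of the copy lives.\<close>

lemma sparse_overlay_chorded_cycle:
  assumes N: "5 \<le> N" "2 * N\<^sup>2 \<le> n" and \<phi>: "\<phi> \<in> embeddings (chorded_cycle N) n"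
  shows "sparse_overlay n N (\<lambda>x y. {x, y} \<in> edge_image (chorded_cycle N) \<phi>) (\<phi> ` {..<N})"
proof
  let ?H = "chorded_cycle N"
  let ?A = "\<lambda>x y. {x, y} \<in> edge_image ?H \<phi>"
  note sH = simple_graph_chorded_cycle[OF N(1)]
  have inj: "inj_on \<phi> {..<N}" and im: "\<phi> ` {..<N} \<subseteq> {..<n}" using \<phi> by (auto simp: embeddings_def)
  show "\<phi> ` {..<N} \<subseteq> {..<n}" by (rule im)
  show "card (\<phi> ` {..<N}) \<le> N" using card_image_le[of "{..<N}" \<phi>] by simp
  show "5 \<le> N" "2 * N\<^sup>2 \<le> n" by fact+
  show "?A x y \<Longrightarrow> ?A y x" for x y by (simp add: insert_commute)
  show "x \<in> \<phi> ` {..<N}" if "?A x y" for x y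
    using doubleton_in_edge_image[OF sH that] by (metis imageI verts_chorded_cycle)
  show "card {y \<in> {..<n}. ?A x y} \<le> 3" for x
  proof (cases "\<exists>i<N. x = \<phi> i")
    case True
    then obtain i where i: "i < N" "x = \<phi> i" by auto
    let ?B = "{cyc_next N i, (if i = 0 then N - 1 else i - 1), 2 - i}"
    have "{y \<in> {..<n}. ?A x y} \<subseteq> \<phi> ` ?B"
    proof
      fix y assume "y \<in> {y \<in> {..<n}. ?A x y}"
      then obtain i' j where ij: "i' < N" "j < N" "x = \<phi> i'" "y = \<phi> j" "{i', j} \<in> edges ?H"
        using doubleton_in_edge_image[OF sH, of x y \<phi>] by auto
      have "i' = i" using inj_onD[OF inj, of i' i] ij i by auto
      then have "j \<in> ?B" using chorded_cycle_adjacent[of i j N] ij by blast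
      then show "y \<in> \<phi> ` ?B" using ij(4) by (simp only: imageI)
    qed
    then have "card {y \<in> {..<n}. ?A x y} \<le> card (\<phi> ` ?B)" by (intro card_mono) auto
    also have "\<dots> \<le> card ?B" by (intro card_image_le) auto
    also have "\<dots> \<le> 3" by (simp add: card_insert_if)
    finally show ?thesis .
  next
    case False
    have "\<not> ?A x y" for y
      using doubleton_in_edge_image[OF sH, of x y \<phi>] False by (metis lessThan_iff verts_chorded_cycle)
    then show ?thesis by simp
  qed
  let ?T = "\<phi> ` {..<3}"
  have tri: "x \<in> ?T \<and> y \<in> ?T \<and> z \<in> ?T" if A: "?A x y" "?A y z" "?A x z" for x y z
  proof -
    obtain i j where 1: "i < N" "j < N" "x = \<phi> i" "y = \<phi> j" "{i, j} \<in> edges ?H"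
      using doubleton_in_edge_image[OF sH A(1)] by auto
    obtain j' k where 2: "j' < N" "k < N" "y = \<phi> j'" "z = \<phi> k" "{j', k} \<in> edges ?H"
      using doubleton_in_edge_image[OF sH A(2)] by auto
    obtain i' k' where 3: "i' < N" "k' < N" "x = \<phi> i'" "z = \<phi> k'" "{i', k'} \<in> edges ?H"
      using doubleton_in_edge_image[OF sH A(3)] by auto
    have e: "j' = j" "i' = i" "k' = k" 
      using inj_onD[OF inj, of j' j] inj_onD[OF inj, of i' i] inj_onD[OF inj, of k' k] 1(1-4) 2(1-4) 3(1-4)
      by simp_all
    have "i < 3 \<and> j < 3 \<and> k < 3"
      using chorded_cycle_triangle[OF N(1) 1(5)] 2(5) 3(5) unfolding e by blast
    then show ?thesis using 1 2 by auto
  qed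
  have T: "?T \<subseteq> {..<n}" using im N(1) by (auto simp: image_subset_iff)
  have cT: "(\<Sum>x<n. of_bool (x \<in> ?T)) \<le> (3::real)"
    using card_image_le[of "{..<3}" \<phi>] T by (simp add: of_bool_def sum.If_cases Int_absorb1)
  have c0: "0 \<le> (\<Sum>x<n. of_bool (x \<in> ?T) :: real)" by (intro sum_nonneg) auto
  have "(\<Sum>x<n. \<Sum>y<n. \<Sum>z<n. of_bool (?A x y) * of_bool (?A y z) * of_bool (?A x z))
    \<le> (\<Sum>x<n. \<Sum>y<n. \<Sum>z<n. of_bool (x \<in> ?T) * (of_bool (y \<in> ?T) * of_bool (z \<in> ?T)) :: real)"
  proof (intro sum_mono)
    fix x y z
    show "of_bool (?A x y) * of_bool (?A y z) * of_bool (?A x z)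
        \<le> (of_bool (x \<in> ?T) * (of_bool (y \<in> ?T) * of_bool (z \<in> ?T)) :: real)"
    proof (cases "?A x y \<and> ?A y z \<and> ?A x z")
      case True
      then show ?thesis using tri[of x y z] by simp
    next
      case False
      then have "of_bool (?A x y) * of_bool (?A y z) * of_bool (?A x z) = (0 :: real)" by auto
      then show ?thesis by simp
    qed
  qed
  also have "\<dots> = (\<Sum>x<n. of_bool (x \<in> ?T)) * ((\<Sum>x<n. of_bool (x \<in> ?T)) * (\<Sum>x<n. of_bool (x \<in> ?T)))"
    by (simp only: sum_distrib_left[symmetric] sum_distrib_right[symmetric])
  also have "\<dots> \<le> 3 * (3 * 3)" using cT c0 by (intro mult_mono) auto
  finally show "(\<Sum>x<n. \<Sum>y<n. \<Sum>z<n. of_bool (?A x y) * of_bool (?A y z) * of_bool (?A x z)) \<le> (27::real)" by simp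
qed

lemma overlap_weight_le:
  assumes N: "5 \<le> N" "2 * N\<^sup>2 \<le> n" and \<phi>: "\<phi> \<in> embeddings (chorded_cycle N) n"
    and exp: "real n * 3 ^ (N - 2) \<le> 6 ^ (N - 2)"
  shows "(\<Sum>\<psi>\<in>embeddings (chorded_cycle N) n.
      (6 / n) ^ card (edge_image (chorded_cycle N) \<psi> - edge_image (chorded_cycle N) \<phi>)) \<le> 3900 * 6 ^ (N - 2) / n"
proof -
  let ?H = "chorded_cycle N"
  note sH = simple_graph_chorded_cycle[OF N(1)]
  interpret sparse_overlay n N "\<lambda>x y. {x, y} \<in> edge_image ?H \<phi>" "\<phi> ` {..<N}"
    by (rule sparse_overlay_chorded_cycle[OF N \<phi>])
  define j where "j = N - 3"
  have j: "j + 3 = N" "N - 2 = j + 1" using N(1) by (auto simp: j_def)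
  let ?W = "\<lambda>\<psi>. (wt (\<psi> 0) (\<psi> 1) * wt (\<psi> 1) (\<psi> 2) * wt (\<psi> 0) (\<psi> 2)) *
      (\<Prod>i<j. wt (\<psi> (i + 2)) (\<psi> (i + 3))) * wt (\<psi> (j + 2)) (\<psi> 0)"
  have wt0: "0 \<le> wt x y" for x y by (simp add: wt_def)
  have 1: "(6 / n) ^ card (edge_image ?H \<psi> - edge_image ?H \<phi>) \<le> ?W \<psi>" if \<psi>: "\<psi> \<in> embeddings ?H n" for \<psi>
  proof -
    \<comment> \<open>The price of a single edge. Injectivity of \<open>\<psi>\<close> makes
      distinct edges of H have distinct images, so the power becomes a product over the edges of
      H.\<close>
    define g where "g e = (if e \<in> edge_image ?H \<phi> then 1 else 6 / real n)" for e
    have fin: "finite (edge_image ?H \<psi>)" using simple_graphD(3)[OF sH] by (simp add: edge_image_def)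
    have g: "g {x, y} \<le> wt x y" "0 \<le> g {x, y}" for x y by (auto simp: g_def wt_def)
    have "(6 / n) ^ card (edge_image ?H \<psi> - edge_image ?H \<phi>) = (\<Prod>e\<in>edge_image ?H \<psi>. g e)"
      using fin by (simp add: g_def prod.If_cases Diff_eq)
    also have "\<dots> = (\<Prod>e\<in>edges ?H. g (\<psi> ` e))"
      unfolding edge_image_def using inj_on_edge_image[OF sH \<psi>] by (simp add: prod.reindex)
    also have "\<dots> = g {\<psi> 0, \<psi> 2} * (\<Prod>e\<in>(\<lambda>i. {i, cyc_next N i}) ` {..<N}. g (\<psi> ` e))"
      using chord_not_cycle_edge[OF N(1)] by (simp add: chorded_cycle_def)
    also have "(\<Prod>e\<in>(\<lambda>i. {i, cyc_next N i}) ` {..<N}. g (\<psi> ` e)) = (\<Prod>i<N. g {\<psi> i, \<psi> (cyc_next N i)})"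
      using inj_on_cycle_edges[OF N(1)] by (simp add: prod.reindex)
    also have "g {\<psi> 0, \<psi> 2} * (\<Prod>i<N. g {\<psi> i, \<psi> (cyc_next N i)})
        \<le> wt (\<psi> 0) (\<psi> 2) * (\<Prod>i<N. wt (\<psi> i) (\<psi> (cyc_next N i)))"
      using g wt0 by (intro mult_mono prod_mono prod_nonneg) auto
    also have "(\<Prod>i<N. wt (\<psi> i) (\<psi> (cyc_next N i)))
        = (\<Prod>i<j + 2. wt (\<psi> i) (\<psi> (cyc_next N i))) * wt (\<psi> (j + 2)) (\<psi> 0)"
    proof -
      have "{..<N} = {..<Suc (j + 2)}" using j by auto
      moreover have "cyc_next N (j + 2) = 0" using j by (simp add: cyc_next_def)
      ultimately show ?thesis by (simp only: prod.lessThan_Suc)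
    qed
    also have "(\<Prod>i<j + 2. wt (\<psi> i) (\<psi> (cyc_next N i)))
        = wt (\<psi> 0) (\<psi> 1) * wt (\<psi> 1) (\<psi> 2) * (\<Prod>i<j. wt (\<psi> (i + 2)) (\<psi> (cyc_next N (i + 2))))"
    proof -
      have "{..<j + 2} = {..<Suc (Suc j)}" by auto
      then show ?thesis using N(1)
        by (simp only: prod.lessThan_Suc_shift) (simp add: cyc_next_def numeral_2_eq_2)
    qed
    also have "(\<Prod>i<j. wt (\<psi> (i + 2)) (\<psi> (cyc_next N (i + 2)))) = (\<Prod>i<j. wt (\<psi> (i + 2)) (\<psi> (i + 3)))"
      using j by (intro prod.cong refl) (auto simp: cyc_next_def numeral_3_eq_3)
    finally show ?thesis by (simp only: mult_ac)
  qed
  have "(\<Sum>\<psi>\<in>embeddings ?H n. (6 / n) ^ card (edge_image ?H \<psi> - edge_image ?H \<phi>))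
    \<le> (\<Sum>\<psi>\<in>embeddings ?H n. ?W \<psi>)" by (intro sum_mono 1)
  \<comment> \<open>All weights are nonnegative, so the sum may be enlarged to closed walks with
    repeated vertices.\<close>
  also have "\<dots> \<le> (\<Sum>\<psi>\<in>{..<N} \<rightarrow>\<^sub>E {..<n}. ?W \<psi>)"
    using wt0 by (intro sum_mono2 finite_PiE) (auto simp: embeddings_def intro!: mult_nonneg_nonneg prod_nonneg)
  also have "\<dots> \<le> 3900 * 6 ^ (j + 1) / n"
    by (rule closed_walk_weight_le[OF j(1)]) (use exp j in simp)
  finally show ?thesis unfolding j(2) .
qed

text \<open>The mean m of the number of open embeddings is at least 3 * 6^N / n = 108 * 6^(N-2) / n.
  Given one open embedding, the expected number is at most 3900 * 6^(N-2) / n, and 3900 / 108 < 37;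
  so the second moment is at most 37 m^2.\<close>

lemma chorded_cycle_prob_ge:
  assumes N: "5 \<le> N" "2 * N\<^sup>2 \<le> n" and exp: "real n * 3 ^ (N - 2) \<le> 6 ^ (N - 2)" and n6: "6 \<le> n"
  shows "1 / 37 \<le> ev (potential_edges n) (6 / n) (\<lambda>w. of_bool (covered (copies (chorded_cycle N) n) w))"
proof -
  let ?H = "chorded_cycle N" and ?\<Lambda> = "potential_edges n"
  define p where "p = 6 / real n"
  have p: "0 \<le> p" "p \<le> 1" using n6 by (auto simp: p_def)
  note sH = simple_graph_chorded_cycle[OF N(1)]
  note fin = finite_potential_edges[of n]
  define X :: "(nat set \<Rightarrow> bool) \<Rightarrow> real" where "X w = (\<Sum>\<phi>\<in>embeddings ?H n. of_bool (\<forall>e\<in>edge_image ?H \<phi>. w e))" for w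
  define P where "P = ev ?\<Lambda> p (\<lambda>w. of_bool (covered (copies ?H n) w))"
  define m where "m = real (card (embeddings ?H n)) * p ^ (N + 1)"
  have ce: "card (edge_image ?H \<phi>) = N + 1" if "\<phi> \<in> embeddings ?H n" for \<phi>
    using card_edge_image[OF sH that] card_edges_chorded_cycle[OF N(1)] by simp
  have evX: "ev ?\<Lambda> p X = m"
    unfolding X_def[abs_def] m_def
    by (simp add: ev_sum fin ev_all edge_image_subset[OF sH] p ce)
  have "real n ^ N / 2 * p ^ (N + 1) \<le> m"
    using card_embeddings_ge[OF sH, of n] N(2) p unfolding m_def by (intro mult_right_mono) auto
  also have "real n ^ N / 2 * p ^ (N + 1) = 3 * 6 ^ N / n"
    using n6 by (simp add: p_def power_divide)
  finally have m: "3 * 6 ^ N / n \<le> m" .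
  then have m0: "0 < m" using n6 by (intro less_le_trans[OF _ m]) simp
  have B: "3900 * 6 ^ (N - 2) / n \<le> 37 * m"
  proof -
    have "(6::real) ^ N = 36 * 6 ^ (N - 2)"
    proof -
      have "N = 2 + (N - 2)" using N(1) by simp
      then show ?thesis using power_add[of "6::real" 2 "N - 2"] by simp
    qed
    then have "3900 * 6 ^ (N - 2) / n \<le> 37 * (3 * 6 ^ N / n)" using n6 by (simp add: field_simps)
    then show ?thesis using m by linarith
  qed
  have "ev ?\<Lambda> p (\<lambda>w. X w * X w) = ev ?\<Lambda> p (\<lambda>w. \<Sum>\<phi>\<in>embeddings ?H n. \<Sum>\<psi>\<in>embeddings ?H n.
      of_bool (\<forall>e\<in>edge_image ?H \<phi> \<union> edge_image ?H \<psi>. w e))"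
    unfolding X_def sum_product
    by (intro arg_cong[of _ _ "ev ?\<Lambda> p"] ext sum.cong refl) (auto simp: of_bool_def)
  also have "\<dots> = (\<Sum>\<phi>\<in>embeddings ?H n. \<Sum>\<psi>\<in>embeddings ?H n. p ^ card (edge_image ?H \<phi> \<union> edge_image ?H \<psi>))"
    by (simp only: ev_sum fin)
       (intro sum.cong refl ev_all fin p Un_least edge_image_subset[OF sH])
  also have "\<dots> = (\<Sum>\<phi>\<in>embeddings ?H n. p ^ (N + 1) * (\<Sum>\<psi>\<in>embeddings ?H n. p ^ card (edge_image ?H \<psi> - edge_image ?H \<phi>)))"
    unfolding sum_distrib_left
  proof (intro sum.cong refl)
    fix \<phi> \<psi> assume e: "\<phi> \<in> embeddings ?H n" "\<psi> \<in> embeddings ?H n"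
    have f: "finite (edge_image ?H \<phi>)" for \<phi> using simple_graphD(3)[OF sH] by (simp add: edge_image_def)
    have "card (edge_image ?H \<phi> \<union> edge_image ?H \<psi>) = (N + 1) + card (edge_image ?H \<psi> - edge_image ?H \<phi>)"
      using card_Un_disjoint[of "edge_image ?H \<phi>" "edge_image ?H \<psi> - edge_image ?H \<phi>"] f ce[OF e(1)] by simp
    then show "p ^ card (edge_image ?H \<phi> \<union> edge_image ?H \<psi>) = p ^ (N + 1) * p ^ card (edge_image ?H \<psi> - edge_image ?H \<phi>)"
      by (simp only: power_add)
  qed
  also have "\<dots> \<le> (\<Sum>\<phi>\<in>embeddings ?H n. p ^ (N + 1) * (37 * m))"
    unfolding p_def using B p
    by (intro sum_mono mult_left_mono order.trans[OF overlap_weight_le[OF N _ exp]]) auto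
  also have "\<dots> = m * (37 * m)" unfolding m_def by simp
  finally have XX: "ev ?\<Lambda> p (\<lambda>w. X w * X w) \<le> m * (37 * m)" .
  have P0: "0 \<le> P" unfolding P_def by (rule ev_nonneg) simp
  have "(ev ?\<Lambda> p X)\<^sup>2 \<le> ev ?\<Lambda> p (\<lambda>w. X w * X w) * P"
    unfolding P_def
  proof (rule second_moment_ge[OF fin])
    fix w assume "X w \<noteq> 0"
    then obtain \<phi> where "\<phi> \<in> embeddings ?H n" "\<forall>e\<in>edge_image ?H \<phi>. w e"
      unfolding X_def using sum.neutral[of "embeddings ?H n" "\<lambda>\<phi>. of_bool (\<forall>e\<in>edge_image ?H \<phi>. w e) :: real"] by force
    then show "covered (copies ?H n) w" by (auto simp: covered_def copies_def)
  qed
  also have "\<dots> \<le> m * (37 * m) * P" by (rule mult_right_mono[OF XX P0])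
  finally have "m * m * 1 \<le> m * m * (37 * P)" unfolding evX by (simp add: power2_eq_square mult_ac)
  then have "1 \<le> 37 * P" using m0 by (simp only: mult_le_cancel_left_pos mult_pos_pos)
  then show ?thesis unfolding P_def p_def by simp
qed

section \<open>Triangles at edge probability 6 / n\<close>

definition triangle_graph :: "nat ugraph" where
  "triangle_graph = ({..<3}, {{0, 1}, {1, 2}, {0, 2}})"

lemma simple_graph_triangle: "simple_graph triangle_graph"
  by (auto simp: simple_graph_def triangle_graph_def nsets_def lessThan_empty_iff)

lemma card_edges_triangle: "card (edges triangle_graph) = 3"
  by (simp add: triangle_graph_def card_insert_if doubleton_eq_iff)

lemma chorded_cycle_contains_triangle:
  assumes N: "5 \<le> N" and "covered (copies (chorded_cycle N) n) w"
  shows "covered (copies triangle_graph n) w"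
proof -
  obtain \<phi> where \<phi>: "\<phi> \<in> embeddings (chorded_cycle N) n" "\<forall>e\<in>edge_image (chorded_cycle N) \<phi>. w e"
    using assms(2) by (auto simp: covered_def copies_def)
  let ?\<phi> = "restrict \<phi> {..<3}"
  have "{0, 1} \<in> edges (chorded_cycle N)" "{1, 2} \<in> edges (chorded_cycle N)" "{0, 2} \<in> edges (chorded_cycle N)"
  proof -
    have "{0, 1} = {0, cyc_next N 0}" "{1, 2} = {1, cyc_next N 1}" using N by (auto simp: cyc_next_def)
    then show "{0, 1} \<in> edges (chorded_cycle N)" "{1, 2} \<in> edges (chorded_cycle N)"
      "{0, 2} \<in> edges (chorded_cycle N)"
      using N unfolding chorded_cycle_def snd_conv
      by (intro insertI2 image_eqI[of _ _ 0] image_eqI[of _ _ 1] insertI1; simp)+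
  qed
  then have "(`) \<phi> ` {{0, 1}, {1, 2}, {0, 2}} \<subseteq> edge_image (chorded_cycle N) \<phi>"
    unfolding edge_image_def by (intro image_mono) simp
  then have "edge_image triangle_graph ?\<phi> \<subseteq> edge_image (chorded_cycle N) \<phi>"
    by (simp add: edge_image_def triangle_graph_def)
  moreover have "?\<phi> \<in> embeddings triangle_graph n"
  proof -
    have "{..<3} \<subseteq> {..<N}" using N by auto
    then have "inj_on \<phi> {..<3}" "\<phi> \<in> {..<3} \<rightarrow> {..<n}"
      using \<phi>(1) inj_on_subset[of \<phi> "{..<N}"] by (auto simp: embeddings_def)
    then show ?thesis by (simp add: embeddings_def triangle_graph_def inj_on_restrict_eq)
  qed
  ultimately show ?thesis using \<phi>(2) by (auto simp: covered_def copies_def)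
qed

lemma exp_le_one_minus:
  fixes x :: real
  assumes "0 \<le> x" "x \<le> 1 / 2"
  shows "exp (- 2 * x) \<le> 1 - x"
proof -
  have "0 \<le> x * (1 - 2 * x)" using assms by simp
  then have "1 \<le> (1 - x) * (1 + 2 * x)" by (simp add: algebra_simps)
  also have "\<dots> \<le> (1 - x) * exp (2 * x)" using assms by (intro mult_left_mono exp_ge_add_one_self) auto
  finally show ?thesis by (simp add: exp_minus field_simps)
qed

text \<open>There are at most n^3 triangles, each open with probability p^3, and n^3 p^3 = 216. From
  n \<ge> 8 one has p^3 \<le> 1/2, so each factor 1 - p^3 is at least exp (-2 p^3); hence 432 = 2 *
  216.\<close>

lemma triangle_free_prob_ge:
  assumes n: "8 \<le> n"
  shows "ev (potential_edges n) (6 / n) (\<lambda>w. of_bool (covered (copies triangle_graph n) w)) \<le> 1 - exp (- 432)"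
proof -
  define p where "p = 6 / real n"
  have p: "0 \<le> p" "p \<le> 1" using n by (auto simp: p_def)
  interpret uniform_family "potential_edges n" "copies triangle_graph n" 3 p
    using uniform_family_copies[OF simple_graph_triangle p] by (simp add: card_edges_triangle)
  have p3: "real (n ^ 3) * p ^ 3 = 216" using n by (simp add: p_def power_divide)
  have "8 ^ 3 \<le> n ^ 3" using n by (rule power_mono) simp
  then have "p ^ 3 \<le> 1 / 2" using n by (simp add: p_def power_divide field_simps flip: of_nat_power)
  then have e: "exp (- 2 * p ^ 3) \<le> 1 - p ^ 3" using p by (intro exp_le_one_minus) auto
  have "exp (- 432) = exp (- 2 * p ^ 3) ^ (n ^ 3)"
    unfolding exp_of_nat_mult[symmetric] using p3 by (simp add: mult_ac)
  also have "\<dots> \<le> (1 - p ^ 3) ^ (n ^ 3)" using e by (intro power_mono) auto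
  also have "\<dots> \<le> (1 - p ^ 3) ^ card (copies triangle_graph n)"
    using card_copies_le[OF simple_graph_triangle, of n] p
    by (intro power_decreasing) (auto simp: triangle_graph_def power_le_one)
  finally show ?thesis using uncovered_prob_ge unfolding p_def by simp
qed

text \<open>648 = 216 * 3: the bound on the mean number of triangles times their number of
  edges.\<close>

lemma triangle_lost_prob_le:
  assumes n: "8 \<le> n" and eps: "0 \<le> \<epsilon>" "\<epsilon> \<le> 1"
  shows "nev (potential_edges n) (6 / n) \<epsilon> (\<lambda>a b. of_bool (covered (copies triangle_graph n) a) *
    (1 - of_bool (covered (copies triangle_graph n) b))) \<le> 648 * \<epsilon>"
proof -
  define p where "p = 6 / real n"
  have p: "0 \<le> p" "p \<le> 1" using n by (auto simp: p_def)
  interpret uniform_family "potential_edges n" "copies triangle_graph n" 3 p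
    using uniform_family_copies[OF simple_graph_triangle p] by (simp add: card_edges_triangle)
  have "real (card (copies triangle_graph n)) \<le> real (n ^ 3)"
    using card_copies_le[OF simple_graph_triangle, of n] by (simp add: triangle_graph_def flip: of_nat_power)
  then have "real (card (copies triangle_graph n)) * p ^ 3 * (real 3 * \<epsilon>) \<le> real (n ^ 3) * p ^ 3 * (real 3 * \<epsilon>)"
    using p eps by (intro mult_right_mono) auto
  also have "real (n ^ 3) * p ^ 3 = 216" using n by (simp add: p_def power_divide)
  finally show ?thesis using nev_covered_lost_le[OF eps] unfolding p_def of_nat_numeral by linarith
qed

text \<open>Since f implies g, their covariance is P(f) (1 - P(g)), at least exp (-432) / 37 = 2
  \<kappa>. Noise at level \<kappa> / 648 loses a triangle with probability at most \<kappa>, so a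
  covariance of \<kappa> remains between f and the noisy g.\<close>

lemma chorded_cycle_noise_correlation:
  assumes N: "5 \<le> N" "2 * N\<^sup>2 \<le> n" and exp: "real n * 3 ^ (N - 2) \<le> 6 ^ (N - 2)" and n: "8 \<le> n"
  defines "\<kappa> \<equiv> exp (- 432) / 74"
  shows "(ev (potential_edges n) (6 / n) (\<lambda>w. of_bool (covered (copies (chorded_cycle N) n) w)))\<^sup>2 + \<kappa>\<^sup>2
    \<le> nev (potential_edges n) (6 / n) (\<kappa> / 648)
      (\<lambda>a b. of_bool (covered (copies (chorded_cycle N) n) a) * of_bool (covered (copies (chorded_cycle N) n) b))"
proof -
  define p where "p = 6 / real n"
  let ?\<Lambda> = "potential_edges n" and ?\<epsilon> = "\<kappa> / 648"
  let ?f = "\<lambda>w. of_bool (covered (copies (chorded_cycle N) n) w) :: real"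
  let ?g = "\<lambda>w. of_bool (covered (copies triangle_graph n) w) :: real"
  have p: "0 \<le> p" "p \<le> 1" using n by (auto simp: p_def)
  have "exp (- 432 :: real) \<le> 1" by simp
  then have k: "0 < \<kappa>" "\<kappa> \<le> 1" unfolding \<kappa>_def by (simp, linarith)
  then have eps: "0 \<le> ?\<epsilon>" "?\<epsilon> \<le> 1" by auto
  note par = finite_potential_edges[of n] p eps
  have fg: "?f w \<le> ?g w" for w using chorded_cycle_contains_triangle[OF N(1)] by (simp add: of_bool_def)
  have P: "1 / 37 \<le> ev ?\<Lambda> p ?f" unfolding p_def using n by (intro chorded_cycle_prob_ge[OF N exp]) simp
  have G: "ev ?\<Lambda> p ?g \<le> 1 - exp (- 432)" unfolding p_def by (rule triangle_free_prob_ge[OF n])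
  have "1 / 37 * exp (- 432) \<le> ev ?\<Lambda> p ?f * (1 - ev ?\<Lambda> p ?g)"
    using P G by (intro mult_mono) auto
  then have PG: "2 * \<kappa> \<le> ev ?\<Lambda> p ?f * (1 - ev ?\<Lambda> p ?g)" by (simp add: \<kappa>_def)
  have "nev ?\<Lambda> p ?\<epsilon> (\<lambda>a b. ?f a * (1 - ?g b)) \<le> nev ?\<Lambda> p ?\<epsilon> (\<lambda>a b. ?g a * (1 - ?g b))"
    by (intro nev_mono par mult_right_mono fg) auto
  also have "\<dots> \<le> 648 * ?\<epsilon>" unfolding p_def by (rule triangle_lost_prob_le[OF n eps])
  finally have "nev ?\<Lambda> p ?\<epsilon> (\<lambda>a b. ?f a - ?f a * ?g b) \<le> \<kappa>" by (simp add: right_diff_distrib)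
  then have "ev ?\<Lambda> p ?f - nev ?\<Lambda> p ?\<epsilon> (\<lambda>a b. ?f a * ?g b) \<le> \<kappa>"
    by (simp only: nev_diff[OF par(1)] nev_fst[OF par])
  then have "ev ?\<Lambda> p ?f * ev ?\<Lambda> p ?g + \<kappa> \<le> nev ?\<Lambda> p ?\<epsilon> (\<lambda>a b. ?f a * ?g b)"
    using PG by (simp add: algebra_simps)
  from nev_covariance_ge[OF par _ _ _ this] show ?thesis using k unfolding p_def by simp
qed

text \<open>The summand 5 keeps the graph simple and strictly balanced for every n, including the
  smallest.\<close>

definition cycle_length :: "nat \<Rightarrow> nat" where
  "cycle_length n = nat \<lceil>2 * ln (real n)\<rceil> + 5"

lemma cycle_length_bounds:
  assumes "1 \<le> n"
  shows "2 * ln n \<le> real (cycle_length n - 2)" "real (cycle_length n) \<le> 2 * ln n + 6"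
  using assms ln_ge_zero[of "real n"] unfolding cycle_length_def by linarith+

text \<open>Amounts to n \<le> 2^(N-2). The factor 2 in the length is more than enough, as 2 ln 2 >
  1.\<close>

lemma cycle_length_exp:
  assumes "1 \<le> n"
  shows "real n * 3 ^ (cycle_length n - 2) \<le> 6 ^ (cycle_length n - 2)"
proof -
  let ?k = "cycle_length n - 2"
  have "ln (real n) \<le> 2 * ln n * ln 2"
    using ln2_ge_two_thirds assms mult_left_mono[of "1 / 2" "ln 2" "2 * ln (real n)"] by simp
  also have "\<dots> \<le> real ?k * ln 2" using cycle_length_bounds(1)[OF assms] by (intro mult_right_mono) auto
  also have "\<dots> = ln (2 ^ ?k)" by (simp add: ln_realpow)
  finally have "real n \<le> 2 ^ ?k" using assms by (simp add: ln_le_cancel_iff)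
  then have "real n * 3 ^ ?k \<le> 2 ^ ?k * 3 ^ ?k" by (intro mult_right_mono) auto
  then show ?thesis by (simp flip: power_mult_distrib)
qed

text \<open>The minimum with 1 only makes \<open>p n\<close> a probability for small n. Sensitivity
  is refuted at the single noise level \<open>\<kappa> / 648\<close>.\<close>

lemma chorded_cycles_not_noise_sensitive:
  defines "H \<equiv> \<lambda>n. chorded_cycle (cycle_length n)" and "p \<equiv> \<lambda>n::nat. min 1 (6 / real n)"
  shows "nondegenerate potential_edges p (copy_indicator H)"
    and "\<not> noise_sensitive potential_edges p (copy_indicator H)"
    and "(\<lambda>n. real (card (edges (H n)))) \<in> \<Theta>(\<lambda>n. ln (real n))"
proof -
  have N5: "5 \<le> cycle_length n" for n by (simp add: cycle_length_def)
  have sH: "simple_graph (H n)" for n unfolding H_def by (rule simple_graph_chorded_cycle[OF N5])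
  define P where "P n = ev (potential_edges n) (p n) (\<lambda>w. of_bool (covered (copies (H n) n) w))" for n
  have prob: "\<P>(\<omega> in measure_pmf (bernoulli_product (potential_edges n) (p n)). copy_indicator H n \<omega>) = P n" for n
    unfolding P_def copy_indicator_iff_covered[OF sH] by (rule prob_eq_ev)
  have "\<forall>\<^sub>F n in sequentially. 2 * (2 * ln (real n) + 6)\<^sup>2 \<le> real n" by real_asymp
  then have good: "\<forall>\<^sub>F n in sequentially. 8 \<le> n \<and> 2 * (cycle_length n)\<^sup>2 \<le> n"
    using eventually_ge_at_top[of 8]
  proof eventually_elim
    case (elim n)
    have "(real (cycle_length n))\<^sup>2 \<le> (2 * ln (real n) + 6)\<^sup>2"
      using elim by (intro power_mono cycle_length_bounds) auto
    then have "real (2 * (cycle_length n)\<^sup>2) \<le> real n"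
      using elim(1) unfolding of_nat_mult of_nat_numeral of_nat_power by linarith
    then show ?case using elim by (simp only: of_nat_le_iff)
  qed
  define \<kappa> where "\<kappa> = exp (- 432 :: real) / 74"
  have "exp (- 432 :: real) \<le> 1" by simp
  then have k: "0 < \<kappa>" "\<kappa> < 1" unfolding \<kappa>_def by (simp, linarith)
  have bounds: "\<forall>\<^sub>F n in sequentially. 1 / 37 \<le> P n \<and> P n \<le> 1 - exp (- 432) \<and>
    (P n)\<^sup>2 + \<kappa>\<^sup>2 \<le> nev (potential_edges n) (p n) (\<kappa> / 648)
      (\<lambda>a b. of_bool (covered (copies (H n) n) a) * of_bool (covered (copies (H n) n) b))"
    using good
  proof eventually_elim
    case (elim n)
    have pn: "p n = 6 / real n" using elim by (simp add: p_def)
    have N: "2 * (cycle_length n)\<^sup>2 \<le> n" "8 \<le> n" using elim by auto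
    have exp: "real n * 3 ^ (cycle_length n - 2) \<le> 6 ^ (cycle_length n - 2)"
      using elim by (intro cycle_length_exp) simp
    have "P n \<le> ev (potential_edges n) (p n) (\<lambda>w. of_bool (covered (copies triangle_graph n) w))"
      unfolding P_def H_def using chorded_cycle_contains_triangle[OF N5]
      by (intro ev_mono finite_potential_edges) (simp add: of_bool_def)
    also have "\<dots> \<le> 1 - exp (- 432)" unfolding pn by (rule triangle_free_prob_ge[OF N(2)])
    finally have "P n \<le> 1 - exp (- 432)" .
    moreover have "1 / 37 \<le> P n"
      unfolding P_def H_def pn using N by (intro chorded_cycle_prob_ge[OF N5 _ exp]) auto
    ultimately show ?case
      using chorded_cycle_noise_correlation[OF N5 N(1) exp N(2)] unfolding P_def H_def pn \<kappa>_def by simp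
  qed
  show "nondegenerate potential_edges p (copy_indicator H)"
    unfolding nondegenerate_def prob
  proof (intro exI[of _ "min (1 / 37) (exp (- 432))"] conjI)
    show "\<forall>\<^sub>F n in sequentially. min (1 / 37) (exp (- 432)) \<le> P n \<and> P n \<le> 1 - min (1 / 37) (exp (- 432))"
      using bounds by eventually_elim (auto simp: min_def)
  qed simp
  show "\<not> noise_sensitive potential_edges p (copy_indicator H)"
  proof
    assume ns: "noise_sensitive potential_edges p (copy_indicator H)"
    let ?\<epsilon> = "\<kappa> / 648"
    have eps: "?\<epsilon> \<in> {0<..<1}" using k by auto
    let ?N = "\<lambda>n. nev (potential_edges n) (p n) ?\<epsilon>
      (\<lambda>a b. of_bool (covered (copies (H n) n) a) * of_bool (covered (copies (H n) n) b))"
    have eq: "\<P>(x in measure_pmf (noise_pair (potential_edges n) (p n) ?\<epsilon>). copy_indicator H n (snd x) \<bar> copy_indicator H n (fst x))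
      = ?N n / P n" for n
      using cond_prob_noise_pair_eq[of "potential_edges n" "p n" ?\<epsilon> "copy_indicator H n"] eps
      by (simp add: copy_indicator_iff_covered[OF sH] finite_potential_edges P_def p_def)
    have "(\<lambda>n. ?N n / P n - P n) \<longlonglongrightarrow> 0"
      using bspec[OF ns[unfolded noise_sensitive_def prob] eps] unfolding eq .
    moreover have "\<forall>\<^sub>F n in sequentially. \<kappa>\<^sup>2 \<le> ?N n / P n - P n"
      using bounds
    proof eventually_elim
      case (elim n)
      have P: "0 < P n" "P n \<le> 1" using elim by (auto intro: order.trans)
      \<comment> \<open>The excess \<kappa>^2 of the joint probability only grows on division by
        \<open>P n \<le> 1\<close>.\<close>
      have "\<kappa>\<^sup>2 * P n \<le> \<kappa>\<^sup>2" using P by (intro mult_right_le_one_le) auto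
      then have "(P n + \<kappa>\<^sup>2) * P n \<le> ?N n" using elim by (simp add: power2_eq_square distrib_right)
      then have "P n + \<kappa>\<^sup>2 \<le> ?N n / P n" using P by (simp add: pos_le_divide_eq)
      then show ?case by simp
    qed
    ultimately have "\<kappa>\<^sup>2 \<le> 0" by (rule tendsto_lowerbound) simp
    then show False using k by simp
  qed
  show "(\<lambda>n. real (card (edges (H n)))) \<in> \<Theta>(\<lambda>n. ln (real n))"
  proof (rule bigthetaI')
    \<comment> \<open>The number of edges lies between 2 ln n and 2 ln n + 7, and the latter is at
      most 9 ln n once ln n \<ge> 1.\<close>
    show "0 < (2::real)" "0 < (9::real)" by simp_all
    have "\<forall>\<^sub>F n in sequentially. 1 \<le> ln (real n)" by real_asymp
    then show "\<forall>\<^sub>F n in sequentially. 2 * norm (ln (real n)) \<le> norm (real (card (edges (H n)))) \<and>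
      norm (real (card (edges (H n)))) \<le> 9 * norm (ln (real n))"
      using eventually_ge_at_top[of 1]
    proof eventually_elim
      case (elim n)
      have "card (edges (H n)) = cycle_length n + 1" unfolding H_def by (rule card_edges_chorded_cycle[OF N5])
      then show ?case using cycle_length_bounds[OF elim(2)] elim(1) by simp
    qed
  qed
qed

theorem theorem1p6:
  shows
    "(\<forall>(H :: nat \<Rightarrow> nat ugraph) (p :: nat \<Rightarrow> real).
        (\<forall>n. simple_graph (H n)) \<and> (\<forall>n. 0 \<le> p n \<and> p n \<le> 1) \<and>
        nondegenerate potential_edges p (copy_indicator H) \<and>
        (\<forall>n. strictly_balanced (H n)) \<and>
        (\<lambda>_. 1) \<in> o(\<lambda>n. real (card (edges (H n)))) \<and>
        (\<forall>\<^sub>F n in sequentially.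
           real (card (edges (H n))) \<le> (ln (real n) / ln (ln (real n))) powr (1/2))
        \<longrightarrow> noise_sensitive potential_edges p (copy_indicator H) \<and>
            one_strongly_noise_sensitive potential_edges p (copy_indicator H))
     \<and>
     (\<exists>(H :: nat \<Rightarrow> nat ugraph) (p :: nat \<Rightarrow> real).
        (\<forall>n. simple_graph (H n)) \<and> (\<forall>n. 0 \<le> p n \<and> p n \<le> 1) \<and>
        nondegenerate potential_edges p (copy_indicator H) \<and>
        (\<forall>n. strictly_balanced (H n)) \<and>
        (\<lambda>n. real (card (edges (H n)))) \<in> \<Theta>(\<lambda>n. ln (real n)) \<and>
        \<not> noise_sensitive potential_edges p (copy_indicator H))"
proof (intro conjI allI impI)
  fix H :: "nat \<Rightarrow> nat ugraph" and p :: "nat \<Rightarrow> real"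
  assume a: "(\<forall>n. simple_graph (H n)) \<and> (\<forall>n. 0 \<le> p n \<and> p n \<le> 1) \<and>
        nondegenerate potential_edges p (copy_indicator H) \<and>
        (\<forall>n. strictly_balanced (H n)) \<and>
        (\<lambda>_. 1) \<in> o(\<lambda>n. real (card (edges (H n)))) \<and>
        (\<forall>\<^sub>F n in sequentially.
           real (card (edges (H n))) \<le> (ln (real n) / ln (ln (real n))) powr (1/2))"
  show "noise_sensitive potential_edges p (copy_indicator H)"
    "one_strongly_noise_sensitive potential_edges p (copy_indicator H)"
    using a by (auto intro!: strictly_balanced_noise_sensitive)
next
  have N5: "5 \<le> cycle_length n" for n by (simp add: cycle_length_def)
  show "\<exists>(H :: nat \<Rightarrow> nat ugraph) (p :: nat \<Rightarrow> real).
        (\<forall>n. simple_graph (H n)) \<and> (\<forall>n. 0 \<le> p n \<and> p n \<le> 1) \<and>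
        nondegenerate potential_edges p (copy_indicator H) \<and>
        (\<forall>n. strictly_balanced (H n)) \<and>
        (\<lambda>n. real (card (edges (H n)))) \<in> \<Theta>(\<lambda>n. ln (real n)) \<and>
        \<not> noise_sensitive potential_edges p (copy_indicator H)"
    using chorded_cycles_not_noise_sensitive simple_graph_chorded_cycle[OF N5]
      strictly_balanced_chorded_cycle[OF N5]
    by (intro exI[of _ "\<lambda>n. chorded_cycle (cycle_length n)"] exI[of _ "\<lambda>n. min 1 (6 / real n)"]) auto
qed

end
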